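(* Let $E\subset\mathbb{R}$ be a (Lebesgue) measurable set, let $\mu\in\mathcal{R}(E)$, and let $\mu_s$ denote the singular part of $\mu$ with respect to Lebesgue measure. Then: (a) $\mu_s$ is supported by $$\left\{ x\in\mathbb{R} : \lim_{h\to 0+} \frac{|E\cap (x-h,x+h)|}{2h} = 0 \right\}.$$ (b) Let $\theta\in L_{\infty}(E)$ be an arbitrary bounded measurable function. Then $\mu_s$ is also supported by $$\{ x\in\mathbb{R} : (\widetilde{H}_E\theta)(x) \text{ exists} \},$$ where $$(\widetilde{H}_E f)(x) = \lim_{y\to 0+} \int_E \left( \frac{t-x}{(t-x)^2 + y^2} - \frac{t}{t^2+1} \right) f(t)\,dt ,$$ if the (finite) limit exists.
   Context: $|\cdot|$ denotes Lebesgue measure. A Herglotz function is a holomorphic mapping $F$ of $\mathbb{C}^+=\{z\in\mathbb{C}:\operatorname{Im} z>0\}$ to itself; for such $F$ the limit $F(t)=\lim_{y\to0+}F(t+iy)$ exists for Lebesgue almost every $t\in\mathbb{R}$. $\mathcal{N}(E)$ is the set of Herglotz functions that are reflectionless on $E$, i.e. $\operatorname{Re}F(t)=0$ for almost every $t\in E$. Every Herglotz function has a unique representation $$F(z)=F_\mu(z)=a+bz+\int_{-\infty}^\infty\left(\frac1{t-z}-\frac{t}{t^2+1}\right)d\mu(t),$$ with $a\in\mathbb{R}$, $b\ge0$ and a positive Borel measure $\mu$ on $\mathbb{R}$ with $\int_{\mathbb{R}}\frac{d\mu(t)}{t^2+1}<\infty$. $\mathcal{R}(E)$ is the set of all such measures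 $\mu$ for which $F_\mu\in\mathcal{N}(E)$ for some choice of $a\in\mathbb{R}$, $b\ge0$. A positive measure $\nu$ is supported by a measurable (not necessarily closed) set $S$ if $\nu(S^c)=0$. *)

theory Defs
  imports "HOL-Complex_Analysis.Complex_Analysis"
begin

definition upper_half_plane :: "complex set" where
  "upper_half_plane = {z. Im z > 0}"

definition herglotz :: "(complex \<Rightarrow> complex) \<Rightarrow> bool" where
  "herglotz F \<longleftrightarrow>
     F holomorphic_on upper_half_plane \<and> F ` upper_half_plane \<subseteq> upper_half_plane"

definition has_boundary_value :: "(complex \<Rightarrow> complex) \<Rightarrow> real \<Rightarrow> complex \<Rightarrow> bool" where
  "has_boundary_value F t w \<longleftrightarrow> ((\<lambda>y. F (Complex t y)) \<longlongrightarrow> w) (at_right 0)"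

text \<open>A Herglotz function has a boundary value at Lebesgue almost every point, so requiring the
  boundary value to exist in the definition below adds nothing to the condition that its real
  part vanishes almost everywhere on the set.\<close>

definition reflectionless :: "real set \<Rightarrow> (complex \<Rightarrow> complex) set" where
  "reflectionless E =
     {F. herglotz F \<and> (AE t in lebesgue. t \<in> E \<longrightarrow> (\<exists>w. has_boundary_value F t w \<and> Re w = 0))}"

definition herglotz_measure :: "real measure \<Rightarrow> bool" where
  "herglotz_measure \<mu> \<longleftrightarrow>
     sets \<mu> = sets borel \<and> (\<integral>\<^sup>+ t. ennreal (1 / (t\<^sup>2 + 1)) \<partial>\<mu>) < \<infinity>"

definition herglotz_rep :: "real \<Rightarrow> real \<Rightarrow> real measure \<Rightarrow> complex \<Rightarrow> complex" where
  "herglotz_rep a b \<mu> z =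
     of_real a + of_real b * z +
     (LINT t|\<mu>. 1 / (of_real t - z) - of_real (t / (t\<^sup>2 + 1)))"

definition reflectionless_measures :: "real set \<Rightarrow> real measure set" where
  "reflectionless_measures E =
     {\<mu>. herglotz_measure \<mu> \<and> (\<exists>a b. b \<ge> 0 \<and> herglotz_rep a b \<mu> \<in> reflectionless E)}"

definition singular_part :: "real measure \<Rightarrow> real measure \<Rightarrow> bool" where
  "singular_part \<mu> \<mu>s \<longleftrightarrow>
     sets \<mu>s = sets borel \<and>
     (\<exists>N\<in>null_sets lborel. emeasure \<mu>s (- N) = 0) \<and>
     (\<exists>\<mu>a. sets \<mu>a = sets borel \<and> absolutely_continuous lborel \<mu>a \<and>
        (\<forall>A\<in>sets borel. emeasure \<mu> A = emeasure \<mu>a A + emeasure \<mu>s A))"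

definition supported_by :: "real measure \<Rightarrow> real set \<Rightarrow> bool" where
  "supported_by \<nu> S \<longleftrightarrow> S \<in> sets \<nu> \<and> emeasure \<nu> (space \<nu> - S) = 0"

definition L_infinity :: "real set \<Rightarrow> (real \<Rightarrow> complex) set" where
  "L_infinity E =
     {f \<in> borel_measurable (lebesgue_on E). \<exists>C. AE t in lebesgue_on E. norm (f t) \<le> C}"

definition has_hilbert_value :: "real set \<Rightarrow> (real \<Rightarrow> complex) \<Rightarrow> real \<Rightarrow> complex \<Rightarrow> bool" where
  "has_hilbert_value E f x w \<longleftrightarrow>
     ((\<lambda>y. LINT t:E|lebesgue. of_real ((t - x) / ((t - x)\<^sup>2 + y\<^sup>2) - t / (t\<^sup>2 + 1)) * f t)
        \<longlongrightarrow> w) (at_right 0)"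

text \<open>By the Lebesgue decomposition theorem, proved here because the library does not contain it,
  a measure as in the Herglotz representation has exactly one singular part.\<close>

lemma singular_part_exists:
  assumes "herglotz_measure \<mu>"
  shows "\<exists>\<mu>s. singular_part \<mu> \<mu>s"
proof -
  have sets_mu [measurable_cong, simp]: "sets \<mu> = sets borel"
    and fin: "(\<integral>\<^sup>+ t. ennreal (1 / (t\<^sup>2 + 1)) \<partial>\<mu>) < \<infinity>"
    using assms by (auto simp: herglotz_measure_def)
  have sp: "space \<mu> = UNIV"
    using sets_eq_imp_space_eq[OF sets_mu] by simp
  define \<rho> where "\<rho> = density \<mu> (\<lambda>t. ennreal (1 / (t\<^sup>2 + 1)))"
  have sr [measurable_cong, simp]: "sets \<rho> = sets borel"
    by (simp add: \<rho>_def)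
  have spr: "space \<rho> = UNIV"
    by (simp add: \<rho>_def sp)
  interpret finite_measure \<rho>
    by standard (use fin sp in \<open>simp add: \<rho>_def emeasure_density less_top[symmetric]\<close>)
  have null_iff: "A \<in> null_sets \<rho> \<longleftrightarrow> A \<in> null_sets \<mu>" if "A \<in> sets borel" for A
  proof -
    have pos: "1 / (t\<^sup>2 + 1) > 0" for t :: real
      by (simp add: add_nonneg_pos)
    have ne: "\<not> ennreal (1 / (t\<^sup>2 + 1)) \<le> 0" for t :: real
      using pos[of t] by (simp add: ennreal_eq_0_iff not_le)
    have "A \<in> null_sets \<rho> \<longleftrightarrow> A \<in> sets \<mu> \<and> (AE x in \<mu>. x \<in> A \<longrightarrow> ennreal (1 / (x\<^sup>2 + 1)) = 0)"
      unfolding \<rho>_def by (rule null_sets_density_iff) measurable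
    also have "\<dots> \<longleftrightarrow> A \<in> null_sets \<mu>"
      using that ne by (auto simp: AE_iff_null_sets)
    finally show ?thesis .
  qed
  obtain f where f: "range f \<subseteq> emeasure \<rho> ` null_sets lborel"
      "Sup (emeasure \<rho> ` null_sets lborel) = (SUP n::nat. f n)"
    using ennreal_Sup_countable_SUP[of "emeasure \<rho> ` null_sets lborel"] by auto
  then have "\<forall>n. \<exists>N\<in>null_sets lborel. f n = emeasure \<rho> N" by auto
  then obtain Z where Z: "\<And>n. Z n \<in> null_sets lborel" "\<And>n. f n = emeasure \<rho> (Z n)" by metis
  define N where "N = (\<Union>n. Z n)"
  have N: "N \<in> null_sets lborel"
    using Z by (auto simp: N_def intro!: null_sets_UN)
  then have Nb [measurable, simp]: "N \<in> sets borel" by auto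
  have mx: "emeasure \<rho> B \<le> emeasure \<rho> N" if "B \<in> null_sets lborel" for B
  proof -
    have "emeasure \<rho> B \<le> (SUP n. f n)"
      using that by (auto simp: f(2)[symmetric] intro!: SUP_upper)
    also have "\<dots> \<le> emeasure \<rho> N"
      by (intro SUP_least) (auto simp: Z(2) N_def[symmetric] intro!: emeasure_mono, auto simp: N_def)
    finally show ?thesis .
  qed
  define \<mu>a where "\<mu>a = density \<mu> (indicator (- N))"
  define \<mu>s where "\<mu>s = density \<mu> (indicator N)"
  have ea: "emeasure \<mu>a A = emeasure \<mu> (A - N)" if "A \<in> sets borel" for A
    using that by (simp add: \<mu>a_def emeasure_density indicator_inter_arith[symmetric] Diff_eq Int_commute)
  have es: "emeasure \<mu>s A = emeasure \<mu> (A \<inter> N)" if "A \<in> sets borel" for A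
    using that by (simp add: \<mu>s_def emeasure_density indicator_inter_arith[symmetric] Int_commute)
  have "singular_part \<mu> \<mu>s"
    unfolding singular_part_def
  proof (intro conjI)
    show "sets \<mu>s = sets borel" by (simp add: \<mu>s_def)
    show "\<exists>N\<in>null_sets lborel. emeasure \<mu>s (- N) = 0"
      using N es[of "- N"] by (intro bexI[of _ N]) auto
    show "\<exists>\<mu>a. sets \<mu>a = sets borel \<and> absolutely_continuous lborel \<mu>a \<and>
        (\<forall>A\<in>sets borel. emeasure \<mu> A = emeasure \<mu>a A + emeasure \<mu>s A)"
    proof (intro exI[of _ \<mu>a] conjI ballI)
      show "sets \<mu>a = sets borel" by (simp add: \<mu>a_def)
      show "absolutely_continuous lborel \<mu>a"
        unfolding absolutely_continuous_def
      proof
        fix A :: "real set" assume A: "A \<in> null_sets lborel"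
        then have Ab [measurable]: "A \<in> sets borel" by auto
        have "emeasure \<rho> N + emeasure \<rho> (A - N) = emeasure \<rho> (N \<union> (A - N))"
          by (rule plus_emeasure) auto
        also have "\<dots> = emeasure \<rho> (N \<union> A)" by simp
        also have "\<dots> \<le> emeasure \<rho> N + 0"
          using mx[of "N \<union> A"] N A by auto
        finally have "emeasure \<rho> (A - N) = 0"
          using emeasure_finite[of N] by (simp add: ennreal_add_left_cancel_le)
        then have "A - N \<in> null_sets \<mu>"
          using null_iff[of "A - N"] by (auto simp: null_sets_def)
        then show "A \<in> null_sets \<mu>a"
          using ea[OF Ab] Ab by (auto simp: null_sets_def \<mu>a_def)
      qed
      fix A :: "real set" assume A: "A \<in> sets borel"
      then have "emeasure \<mu> (A - N) + emeasure \<mu> (A \<inter> N) = emeasure \<mu> ((A - N) \<union> (A \<inter> N))"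
        by (intro plus_emeasure) auto
      then show "emeasure \<mu> A = emeasure \<mu>a A + emeasure \<mu>s A"
        using A by (simp add: ea es Un_Diff_Int)
    qed
  qed
  then show ?thesis by blast
qed

lemma singular_part_unique:
  assumes "singular_part \<mu> \<mu>1" "singular_part \<mu> \<mu>2"
  shows "\<mu>1 = \<mu>2"
proof -
  have *: "\<exists>N\<in>null_sets lborel. \<forall>M\<in>null_sets lborel. N \<subseteq> M \<longrightarrow>
             (\<forall>A\<in>sets borel. emeasure \<nu> A = emeasure \<mu> (A \<inter> M))"
    if s: "singular_part \<mu> \<nu>" for \<nu>
  proof -
    from s have sn [simp]: "sets \<nu> = sets borel" by (simp add: singular_part_def)
    from s obtain N where N: "N \<in> null_sets lborel" "emeasure \<nu> (- N) = 0"
      by (auto simp: singular_part_def)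
    from s obtain \<alpha> where al: "sets \<alpha> = sets borel" "absolutely_continuous lborel \<alpha>"
      "\<And>A. A \<in> sets borel \<Longrightarrow> emeasure \<mu> A = emeasure \<alpha> A + emeasure \<nu> A"
      by (auto simp: singular_part_def)
    have "emeasure \<nu> A = emeasure \<mu> (A \<inter> M)"
      if M: "M \<in> null_sets lborel" "N \<subseteq> M" and A: "A \<in> sets borel" for M A
    proof -
      have Mb: "M \<in> sets borel" and Nb: "N \<in> sets borel" using M N by auto
      have "A \<inter> M \<in> null_sets lborel"
        using M A by (metis Int_commute null_set_Int2 sets_lborel)
      then have "emeasure \<alpha> (A \<inter> M) = 0"
        using al(2) by (auto simp: absolutely_continuous_def null_sets_def)
      then have 1: "emeasure \<mu> (A \<inter> M) = emeasure \<nu> (A \<inter> M)"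
        using al(3)[of "A \<inter> M"] A Mb by auto
      have "emeasure \<nu> (A - M) \<le> emeasure \<nu> (- N)"
        using Nb M by (intro emeasure_mono) auto
      then have "emeasure \<nu> (A - M) = 0" using N by simp
      moreover have "emeasure \<nu> (A \<inter> M) + emeasure \<nu> (A - M) = emeasure \<nu> ((A \<inter> M) \<union> (A - M))"
        using A Mb by (intro plus_emeasure) auto
      ultimately show ?thesis using 1 by (simp add: Int_Diff_Un)
    qed
    then show ?thesis using N by blast
  qed
  from *[OF assms(1)] obtain N1 where N1: "N1 \<in> null_sets lborel" "\<And>M A. M \<in> null_sets lborel \<Longrightarrow>
      N1 \<subseteq> M \<Longrightarrow> A \<in> sets borel \<Longrightarrow> emeasure \<mu>1 A = emeasure \<mu> (A \<inter> M)" by blast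
  from *[OF assms(2)] obtain N2 where N2: "N2 \<in> null_sets lborel" "\<And>M A. M \<in> null_sets lborel \<Longrightarrow>
      N2 \<subseteq> M \<Longrightarrow> A \<in> sets borel \<Longrightarrow> emeasure \<mu>2 A = emeasure \<mu> (A \<inter> M)" by blast
  have U: "N1 \<union> N2 \<in> null_sets lborel" using N1 N2 by auto
  show ?thesis
    using assms N1(2)[OF U] N2(2)[OF U]
    by (intro measure_eqI) (auto simp: singular_part_def)
qed

end

theory Submission
  imports Defs "HOL-Probability.Probability"
begin

text \<open>
  Write \<open>F\<close> for the reflectionless Herglotz function with measure \<open>\<mu>\<close>. Its argument, the imaginary part
  of \<open>Ln F\<close>, is a bounded positive harmonic function with boundary values \<open>\<pi>/2\<close> almost everywhere on
  \<open>E\<close>, so it dominates half of the Poisson integral of the indicator of \<open>E\<close>; the same holds for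
  \<open>\<pi> - arg F\<close>. Hence, for a real function \<open>\<theta>\<close> supported by \<open>E\<close> and bounded by \<open>1/4\<close>, with
  Cauchy transform \<open>\<Theta>\<close>, multiplying \<open>F\<close> by \<open>exp \<Theta>\<close> or by \<open>exp (-\<Theta>)\<close> keeps the argument in
  \<open>(0, \<pi>)\<close> and so gives Herglotz functions \<open>G\<^sub>+\<close> and \<open>G\<^sub>-\<close>
  (\<open>reflectionless_perturbation\<close>).

  By a theorem of Poltoratski the quotient of two Herglotz functions has a finite nonnegative limit
  along verticals at almost every point with respect to the singular part of the measure of the
  denominator (\<open>herglotz_ratio_limit\<close>). Applied to \<open>G\<^sub>+ / F = exp \<Theta>\<close> and
  \<open>G\<^sub>- / F = exp (-\<Theta>)\<close> this shows that \<open>exp \<Theta>\<close> has a limit in \<open>(0, \<infinity>)\<close>, hence that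
  \<open>\<Theta>\<close> itself has a real limit (\<open>cauchy_transform_tendsto_real\<close>). Its real part is the Hilbert
  transform of (b). Its imaginary part, for \<open>\<theta>\<close> a multiple of the indicator of \<open>E\<close>, is the Poisson
  integral of the indicator, which therefore tends to zero and forces the density in (a) to vanish.

  The proof of Poltoratski's theorem rests on an identity. Let \<open>m\<close> be the measure of \<open>F\<close>, let
  \<open>F\<^sub>f\<close> be the Cauchy transform of \<open>f m\<close> and put \<open>g = F\<^sub>f / F\<close>. Then the imaginary part of
  \<open>F\<^bsub>f\<^sup>2\<^esub> - F\<^sub>f\<^sup>2 / F\<close> at \<open>z\<close> is the Poisson integral at \<open>z\<close> of \<open>\<bar>f - g z\<bar>\<^sup>2 m\<close>, up to a nonnegative
  term. The imaginary part of this function is thus nonnegative, and the value at \<open>\<i>\<close> bounds the mass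
  of its representing measure by a weighted integral of \<open>f\<^sup>2\<close>. Comparing its Poisson integral with
  that of \<open>m\<close> by a maximal inequality yields a weak type bound for \<open>\<bar>g\<bar>\<^sup>2\<close>
  (\<open>cauchy_ratio_maximal\<close>), and the convergence of \<open>g\<close> to \<open>f\<close> almost everywhere on Lebesgue null
  sets follows by approximation, beginning with functions that vanish near the point considered.
  Apart from this the proof uses only the comparison of Poisson integrals
  (\<open>null_set_poisson_negligible\<close>) and the integral representation of Herglotz functions
  (\<open>herglotz_representation\<close>).
\<close>

section \<open>A maximal inequality for measures on the line\<close>

text \<open>Take a subfamily with the same union and as few members as possible. If three of its intervals met,
  the one reaching furthest to the left and the one reaching furthest to the right would cover the
  third, which could be dropped.\<close>

lemma overlap_two_subfamily:
  fixes \<I> :: "real set set"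
  assumes "finite \<I>" and iv: "\<And>I. I \<in> \<I> \<Longrightarrow> \<exists>a b. I = {a<..<b}"
  obtains \<J> where "\<J> \<subseteq> \<I>" "\<Union>\<J> = \<Union>\<I>" "\<And>x. card {I\<in>\<J>. x \<in> I} \<le> 2"
proof -
  define P where "P = (\<lambda>\<J>. \<J> \<subseteq> \<I> \<and> \<Union>\<J> = \<Union>\<I>)"
  have "P \<I>" by (simp add: P_def)
  define \<J> where "\<J> = arg_min card P"
  have PJ: "P \<J>" and min: "\<And>\<K>. P \<K> \<Longrightarrow> card \<J> \<le> card \<K>"
    using arg_min_natI[of P \<I> card] arg_min_nat_le[of P _ card] \<open>P \<I>\<close> by (auto simp: \<J>_def)
  have fin: "finite \<J>" using PJ assms(1) by (auto simp: P_def intro: finite_subset)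
  have "card {I\<in>\<J>. x \<in> I} \<le> 2" for x
  proof (rule ccontr)
    assume "\<not> ?thesis"
    then have c3: "card {I\<in>\<J>. x \<in> I} \<ge> 3" by simp
    define X where "X = {I\<in>\<J>. x \<in> I}"
    have fX: "finite X" "X \<noteq> {}" using c3 fin unfolding X_def by (auto simp del: Collect_empty_eq)
    have "\<forall>I\<in>X. \<exists>a b. I = {a<..<b}" using PJ iv by (auto simp: X_def P_def)
    then obtain l r where lr: "\<And>I. I \<in> X \<Longrightarrow> I = {l I<..<r I}" by metis
    have xin: "l I < x" "x < r I" if "I \<in> X" for I
      using lr[OF that] that by (auto simp: X_def)
    obtain L where L: "L \<in> X" "\<And>I. I \<in> X \<Longrightarrow> l L \<le> l I"
      using ex_is_arg_min_if_finite[OF fX, of l] by (auto simp: is_arg_min_linorder)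
    obtain R where R: "R \<in> X" "\<And>I. I \<in> X \<Longrightarrow> r I \<le> r R"
      using ex_is_arg_min_if_finite[OF fX, of "\<lambda>I. - r I"] by (auto simp: is_arg_min_linorder)
    have "card {L, R} \<le> 2" by (simp add: card_insert_if)
    then have "\<not> X \<subseteq> {L, R}"
      using c3 card_mono[of "{L, R}" X] by (auto simp: X_def)
    then obtain I where I: "I \<in> X" "I \<noteq> L" "I \<noteq> R" by auto
    have "I \<subseteq> L \<union> R"
    proof
      fix z assume "z \<in> I"
      then have "l I < z" "z < r I" using lr[OF I(1)] by auto
      then have "l L < z" "z < r R" using L(2)[OF I(1)] R(2)[OF I(1)] by auto
      moreover have "x < r L" "l R < x" using xin L(1) R(1) by auto
      ultimately have "z \<in> {l L<..<r L} \<or> z \<in> {l R<..<r R}" by auto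
      then show "z \<in> L \<union> R" using lr[OF L(1)] lr[OF R(1)] by blast
    qed
    then have "\<Union>(\<J> - {I}) = \<Union>\<J>"
      using I L(1) R(1) by (auto simp: X_def)
    then have "P (\<J> - {I})" using PJ by (auto simp: P_def)
    from min[OF this] show False
      using I(1) fin card_Diff1_less[of \<J> I] by (simp add: X_def)
  qed
  then show ?thesis using PJ that by (auto simp: P_def)
qed

lemma finite_interval_cover_le:
  fixes m s :: "real measure" and \<I> :: "real set set"
  assumes m: "sets m = sets borel" and s: "sets s = sets borel"
    and "finite \<I>" and iv: "\<And>I. I \<in> \<I> \<Longrightarrow> \<exists>a b. I = {a<..<b}"
    and big: "\<And>I. I \<in> \<I> \<Longrightarrow> d * emeasure s I \<le> emeasure m I"
  shows "d * emeasure s (\<Union>\<I>) \<le> 2 * emeasure m UNIV"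
proof -
  note [measurable_cong] = m s
  obtain \<J> where J: "\<J> \<subseteq> \<I>" "\<Union>\<J> = \<Union>\<I>" "\<And>x. card {I\<in>\<J>. x \<in> I} \<le> 2"
    using overlap_two_subfamily[OF assms(3) iv] by metis
  have fin: "finite \<J>" using J assms(3) finite_subset by blast
  have bI: "I \<in> sets borel" if "I \<in> \<J>" for I
    using iv[of I] that J(1) by (metis borel_open open_greaterThanLessThan subsetD)
  have "d * emeasure s (\<Union>\<I>) \<le> d * (\<Sum>I\<in>\<J>. emeasure s I)"
    unfolding J(2)[symmetric] using bI s fin
    by (intro mult_left_mono) (auto intro!: emeasure_subadditive_finite[where A="\<lambda>x. x", simplified])
  also have "\<dots> \<le> (\<Sum>I\<in>\<J>. emeasure m I)"
    unfolding sum_distrib_left using big J(1) by (intro sum_mono) auto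
  also have "\<dots> = (\<Sum>I\<in>\<J>. \<integral>\<^sup>+x. indicator I x \<partial>m)"
    using bI m by (intro sum.cong) auto
  also have "\<dots> = (\<integral>\<^sup>+x. (\<Sum>I\<in>\<J>. indicator I x) \<partial>m)"
    using bI m by (intro nn_integral_sum[symmetric]) auto
  also have "\<dots> \<le> (\<integral>\<^sup>+x. 2 \<partial>m)"
  proof (intro nn_integral_mono)
    fix x
    have "(\<Sum>I\<in>\<J>. indicator I x :: ennreal) = of_nat (card {I\<in>\<J>. x \<in> I})"
      using fin by (simp add: indicator_def sum.If_cases Int_def)
    also have "\<dots> \<le> of_nat 2" using J(3)[of x] by (intro of_nat_mono)
    finally show "(\<Sum>I\<in>\<J>. indicator I x) \<le> (2::ennreal)" by simp
  qed
  also have "\<dots> = 2 * emeasure m UNIV"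
    using sets_eq_imp_space_eq[OF m] by simp
  finally show ?thesis .
qed

text \<open>The overlap bound takes the place of a doubling condition, so the inequality holds for any pair of
  Borel measures. The exceptional set is the union of all intervals on which \<open>m\<close> is
  large compared with \<open>s\<close>.\<close>

lemma interval_maximal_inequality:
  fixes m s :: "real measure"
  assumes m: "sets m = sets borel" and s: "sets s = sets borel"
  obtains B where "open B" "d * emeasure s B \<le> 2 * emeasure m UNIV"
    "\<And>x a b. x \<notin> B \<Longrightarrow> x \<in> {a<..<b} \<Longrightarrow> emeasure m {a<..<b} \<le> d * emeasure s {a<..<b}"
proof -
  define \<F> where "\<F> = {I. (\<exists>a b::real. I = {a<..<b}) \<and> d * emeasure s I \<le> emeasure m I}"
  have op: "\<And>I. I \<in> \<F> \<Longrightarrow> open I" by (auto simp: \<F>_def)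
  obtain \<G> where G: "\<G> \<subseteq> \<F>" "countable \<G>" "\<Union>\<G> = \<Union>\<F>"
    using Lindelof[OF op] by metis
  have eF: "{} \<in> \<F>" by (auto simp: \<F>_def intro!: exI[of _ 0])
  define g where "g = from_nat_into (insert {} \<G>)"
  have g: "range g = insert {} \<G>"
    unfolding g_def using G by (intro range_from_nat_into) auto
  have gF: "g n \<in> \<F>" for n 
  proof -
    have "g n \<in> insert {} \<G>" using rangeI[of g n] unfolding g .
    then consider "g n = {}" | "g n \<in> \<G>" by (rule insertE)
    then show ?thesis using G(1) eF by cases (simp, rule subsetD)
  qed
  define U where "U n = \<Union>(g ` {..<n})" for n
  have oU: "open (U n)" for n unfolding U_def by (rule open_Union, clarify, rule op[OF gF])
  have le: "d * emeasure s (U n) \<le> 2 * emeasure m UNIV" for n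
    unfolding U_def
  proof (rule finite_interval_cover_le[OF m s])
    fix I assume "I \<in> g ` {..<n}"
    then have "I \<in> \<F>" using gF by blast
    then show "\<exists>a b. I = {a<..<b}" "d * emeasure s I \<le> emeasure m I"
      unfolding \<F>_def by blast+
  qed simp
  have UF: "(\<Union>n. U n) = \<Union>\<F>"
  proof -
    have "(\<Union>n. U n) = \<Union>(range g)"
    proof (intro equalityI subsetI)
      fix x assume "x \<in> \<Union>(range g)"
      then obtain i where "x \<in> g i" by blast
      then have "x \<in> U (Suc i)" unfolding U_def by (intro UnionI[of "g i"]) auto
      then show "x \<in> (\<Union>n. U n)" by blast
    qed (auto simp: U_def)
    then show ?thesis unfolding g G(3)[symmetric] by simp
  qed
  have "incseq U" unfolding U_def incseq_def by (intro allI impI Union_mono image_mono) auto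
  then have "emeasure s (\<Union>\<F>) = (SUP n. emeasure s (U n))"
    using oU s UF by (subst SUP_emeasure_incseq) auto
  then have "d * emeasure s (\<Union>\<F>) = (SUP n. d * emeasure s (U n))"
    by (simp add: SUP_mult_left_ennreal)
  also have "\<dots> \<le> 2 * emeasure m UNIV" using le by (intro SUP_least) auto
  finally have 1: "d * emeasure s (\<Union>\<F>) \<le> 2 * emeasure m UNIV" .
  show ?thesis
  proof (rule that[OF _ 1])
    show "open (\<Union>\<F>)" using op by auto
    fix x a b assume x: "x \<notin> \<Union>\<F>" "x \<in> {a<..<b::real}"
    then have "{a<..<b} \<notin> \<F>" by auto
    then show "emeasure m {a<..<b} \<le> d * emeasure s {a<..<b}" by (auto simp: \<F>_def)
  qed
qed

section \<open>Poisson integrals\<close>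

definition poisson :: "real measure \<Rightarrow> real \<Rightarrow> real \<Rightarrow> real" where
  "poisson m x y = (LINT t|m. y / ((t - x)\<^sup>2 + y\<^sup>2))"

definition cauchy_mass :: "real measure \<Rightarrow> real" where
  "cauchy_mass m = (LINT t|m. 1 / (t\<^sup>2 + 1))"

text \<open>The Poisson kernel at any point of the upper half plane is comparable to \<open>1 / (t\<^sup>2 + 1)\<close>, so the
  integrability condition on a Herglotz measure makes all its Poisson integrals finite.\<close>

lemma sq_le_kernel:
  fixes t x y :: real
  assumes "y > 0"
  shows "t\<^sup>2 + 1 \<le> (2 + (2*x\<^sup>2+1)/y\<^sup>2) * ((t - x)\<^sup>2 + y\<^sup>2)"
proof -
  have 1: "0 \<le> (t - 2*x)\<^sup>2" by simp
  have "t\<^sup>2 + 1 \<le> 2*(t-x)\<^sup>2 + (2*x\<^sup>2+1)"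
    using 1 by (simp add: power2_eq_square algebra_simps)
  also have "(2*x\<^sup>2+1) = (2*x\<^sup>2+1)/y\<^sup>2 * y\<^sup>2" using assms by simp
  also have "2*(t-x)\<^sup>2 + (2*x\<^sup>2+1)/y\<^sup>2 * y\<^sup>2 \<le> (2 + (2*x\<^sup>2+1)/y\<^sup>2) * ((t - x)\<^sup>2 + y\<^sup>2)"
    unfolding distrib_left distrib_right by simp
  finally show ?thesis by simp
qed

lemma kernel_pos: "y > 0 \<Longrightarrow> (t - x)\<^sup>2 + y\<^sup>2 > (0::real)"
  by (simp add: add_nonneg_pos)

lemma kernel_le:
  fixes t x y :: real
  assumes "y > 0"
  shows "y / ((t - x)\<^sup>2 + y\<^sup>2) \<le> y * (2 + (2*x\<^sup>2+1)/y\<^sup>2) * (1 / (t\<^sup>2 + 1))"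
proof -
  have p: "t\<^sup>2 + 1 > 0" by (simp add: add_nonneg_pos)
  have "1 / ((t - x)\<^sup>2 + y\<^sup>2) \<le> (2 + (2*x\<^sup>2+1)/y\<^sup>2) * (1 / (t\<^sup>2 + 1))"
    using sq_le_kernel[OF assms, of t x] kernel_pos[OF assms, of t x] p by (simp add: field_simps)
  from mult_left_mono[OF this, of y] assms show ?thesis by (simp add: mult.assoc)
qed

lemma sigma_finite_measureI_bounded:
  fixes m :: "real measure"
  assumes "sets m = sets borel" "\<And>R. emeasure m {-R..R} \<noteq> \<infinity>"
  shows "sigma_finite_measure m"
proof
  have "(\<Union>n. {- real n..real n}) = UNIV"
  proof (intro equalityI subsetI)
    fix x :: real
    obtain n where "\<bar>x\<bar> \<le> real n" using real_arch_simple by blast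
    then show "x \<in> (\<Union>n. {- real n..real n})" by (auto intro!: exI[of _ n])
  qed simp
  then show "\<exists>A. countable A \<and> A \<subseteq> sets m \<and> \<Union> A = space m \<and> (\<forall>a\<in>A. emeasure m a \<noteq> \<infinity>)"
    using assms sets_eq_imp_space_eq[OF assms(1)] by (intro exI[of _ "range (\<lambda>n. {- real n..real n})"]) auto
qed

locale herglotz_measure_space =
  fixes m :: "real measure"
  assumes hm: "herglotz_measure m"
begin

lemma sets_m [measurable_cong, simp]: "sets m = sets borel"
  using hm by (simp add: herglotz_measure_def)

lemma space_m [simp]: "space m = UNIV"
  using sets_eq_imp_space_eq[OF sets_m] by simp

lemma integrable_weight: "integrable m (\<lambda>t. 1 / (t\<^sup>2 + 1))"
  using hm by (intro integrableI_nonneg) (auto simp: herglotz_measure_def)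

lemma nn_weight: "(\<integral>\<^sup>+t. ennreal (1 / (t\<^sup>2 + 1)) \<partial>m) = ennreal (cauchy_mass m)"
  unfolding cauchy_mass_def by (intro nn_integral_eq_integral integrable_weight) auto

lemma cauchy_mass_nonneg: "cauchy_mass m \<ge> 0"
  unfolding cauchy_mass_def by (intro integral_nonneg_AE) auto

lemma integrable_le_weight:
  fixes f :: "real \<Rightarrow> 'b::{banach, second_countable_topology}"
  assumes "f \<in> borel_measurable borel" "\<And>t. norm (f t) \<le> C * (1 / (t\<^sup>2 + 1))"
  shows "integrable m f"
proof (rule Bochner_Integration.integrable_bound)
  show "integrable m (\<lambda>t. C * (1 / (t\<^sup>2 + 1)))" using integrable_weight by (rule integrable_mult_right)
  show "AE t in m. norm (f t) \<le> norm (C * (1 / (t\<^sup>2 + 1)))"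
    using assms(2) by (intro always_eventually allI) (metis norm_ge_zero order_trans real_norm_def abs_ge_self)
qed (use assms(1) in measurable)

lemma integrable_kernel: "y > 0 \<Longrightarrow> integrable m (\<lambda>t. y / ((t - x)\<^sup>2 + y\<^sup>2))"
  using kernel_le[of y _ x] kernel_pos[of y]
  by (intro integrable_le_weight[where C="y * (2 + (2*x\<^sup>2+1)/y\<^sup>2)"]) (auto simp: less_imp_le)

lemma poisson_nonneg: "y > 0 \<Longrightarrow> poisson m x y \<ge> 0"
  unfolding poisson_def by (intro integral_nonneg_AE) auto

lemma nn_kernel: "y > 0 \<Longrightarrow> (\<integral>\<^sup>+t. ennreal (y / ((t - x)\<^sup>2 + y\<^sup>2)) \<partial>m) = ennreal (poisson m x y)"
  unfolding poisson_def by (intro nn_integral_eq_integral integrable_kernel) auto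

lemma emeasure_bounded_le:
  assumes "A \<in> sets borel" "A \<subseteq> {-R..R}"
  shows "emeasure m A \<le> ennreal (R\<^sup>2 + 1) * (\<integral>\<^sup>+t. ennreal (1 / (t\<^sup>2 + 1)) * indicator A t \<partial>m)"
proof -
  have "emeasure m A = (\<integral>\<^sup>+t. indicator A t \<partial>m)" using assms by simp
  also have "\<dots> \<le> (\<integral>\<^sup>+t. ennreal (R\<^sup>2 + 1) * (ennreal (1 / (t\<^sup>2 + 1)) * indicator A t) \<partial>m)"
  proof (intro nn_integral_mono)
    fix t
    show "indicator A t \<le> ennreal (R\<^sup>2 + 1) * (ennreal (1 / (t\<^sup>2 + 1)) * indicator A t)"
    proof (cases "t \<in> A")
      case True
      then have "- R \<le> t \<and> t \<le> R" using assms by auto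
      then have "\<bar>t\<bar> \<le> \<bar>R\<bar>" by linarith
      then have "t\<^sup>2 \<le> R\<^sup>2" by (simp add: abs_le_square_iff)
      then have "1 \<le> (R\<^sup>2 + 1) * (1 / (t\<^sup>2 + 1))"
        by (simp add: add_nonneg_pos)
      then have "ennreal 1 \<le> ennreal ((R\<^sup>2 + 1) * (1 / (t\<^sup>2 + 1)))" by (intro ennreal_leI)
      also have "\<dots> = ennreal (R\<^sup>2 + 1) * ennreal (1 / (t\<^sup>2 + 1))" by (rule ennreal_mult) auto
      finally show ?thesis using True by simp
    qed auto
  qed
  also have "\<dots> = ennreal (R\<^sup>2 + 1) * (\<integral>\<^sup>+t. ennreal (1 / (t\<^sup>2 + 1)) * indicator A t \<partial>m)"
    using assms(1) by (intro nn_integral_cmult) auto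
  finally show ?thesis .
qed

lemma emeasure_bounded_le_mass:
  assumes "A \<in> sets borel" "A \<subseteq> {-R..R}"
  shows "emeasure m A \<le> ennreal ((R\<^sup>2 + 1) * cauchy_mass m)"
proof -
  have "(\<integral>\<^sup>+t. ennreal (1 / (t\<^sup>2 + 1)) * indicator A t \<partial>m) \<le> (\<integral>\<^sup>+t. ennreal (1 / (t\<^sup>2 + 1)) \<partial>m)"
    by (intro nn_integral_mono) (auto simp: indicator_def)
  then have "emeasure m A \<le> ennreal (R\<^sup>2 + 1) * ennreal (cauchy_mass m)"
    unfolding nn_weight[symmetric] by (intro order_trans[OF emeasure_bounded_le[OF assms]] mult_left_mono) auto
  then show ?thesis by (simp add: ennreal_mult cauchy_mass_nonneg)
qed

lemma sigma_finite: "sigma_finite_measure m"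
proof (rule sigma_finite_measureI_bounded[OF sets_m])
  show "emeasure m {-R..R} \<noteq> \<infinity>" for R
    using emeasure_bounded_le_mass[of "{-R..R}" R] by (auto simp: top_unique)
qed

end

lemma herglotz_measure_restrict:
  assumes "herglotz_measure m" "A \<in> sets borel"
  shows "herglotz_measure (density m (indicator A))"
proof -
  interpret herglotz_measure_space m using assms(1) by unfold_locales
  have "(\<integral>\<^sup>+t. ennreal (1 / (t\<^sup>2 + 1)) \<partial>density m (indicator A)) = (\<integral>\<^sup>+t. indicator A t * ennreal (1 / (t\<^sup>2 + 1)) \<partial>m)"
    using assms(2) by (subst nn_integral_density) auto
  also have "\<dots> \<le> (\<integral>\<^sup>+t. ennreal (1 / (t\<^sup>2 + 1)) \<partial>m)"
    by (intro nn_integral_mono) (auto simp: indicator_def)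
  also have "\<dots> < \<infinity>" using nn_weight by simp
  finally show ?thesis by (simp add: herglotz_measure_def)
qed

lemma poisson_restrict_split:
  assumes "herglotz_measure m" "A \<in> sets borel" "y > 0"
  shows "poisson m x y = poisson (density m (indicator A)) x y + poisson (density m (indicator (-A))) x y"
proof -
  interpret herglotz_measure_space m using assms(1) by unfold_locales
  interpret A: herglotz_measure_space "density m (indicator A)" using herglotz_measure_restrict[OF assms(1,2)] by unfold_locales
  interpret B: herglotz_measure_space "density m (indicator (-A))" using herglotz_measure_restrict[OF assms(1), of "-A"] assms(2) by unfold_locales auto
  let ?k = "\<lambda>t. ennreal (y / ((t - x)\<^sup>2 + y\<^sup>2))"
  have "ennreal (poisson m x y) = (\<integral>\<^sup>+t. indicator A t * ?k t + indicator (-A) t * ?k t \<partial>m)"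
    unfolding nn_kernel[OF assms(3), symmetric] by (intro nn_integral_cong) (auto simp: indicator_def)
  also have "\<dots> = (\<integral>\<^sup>+t. indicator A t * ?k t \<partial>m) + (\<integral>\<^sup>+t. indicator (-A) t * ?k t \<partial>m)"
    using assms(2) by (intro nn_integral_add) auto
  also have "(\<integral>\<^sup>+t. indicator A t * ?k t \<partial>m) = ennreal (poisson (density m (indicator A)) x y)"
    unfolding A.nn_kernel[OF assms(3), symmetric] using assms(2) by (subst nn_integral_density) auto
  also have "(\<integral>\<^sup>+t. indicator (-A) t * ?k t \<partial>m) = ennreal (poisson (density m (indicator (-A))) x y)"
    unfolding B.nn_kernel[OF assms(3), symmetric] using assms(2) by (subst nn_integral_density) auto
  finally show ?thesis
    using assms(3) by (simp add: poisson_nonneg A.poisson_nonneg B.poisson_nonneg flip: ennreal_plus)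
qed

text \<open>The Poisson kernel is a positive mixture of indicators of centred intervals. A comparison of two
  measures on intervals therefore passes to their Poisson integrals.\<close>

lemma kernel_layer_cake:
  fixes u y :: real
  assumes "y > 0" "u \<ge> 0"
  shows "(\<integral>\<^sup>+h. ennreal (2 * h * y / (h\<^sup>2 + y\<^sup>2)\<^sup>2) * indicator {u<..} h \<partial>lborel) = ennreal (y / (u\<^sup>2 + y\<^sup>2))"
proof -
  have pos: "h\<^sup>2 + y\<^sup>2 > 0" for h using assms(1) by (simp add: add_nonneg_pos)
  have "(\<integral>\<^sup>+h. ennreal (2 * h * y / (h\<^sup>2 + y\<^sup>2)\<^sup>2) * indicator {u<..} h \<partial>lborel)
      = (\<integral>\<^sup>+h. ennreal (2 * h * y / (h\<^sup>2 + y\<^sup>2)\<^sup>2) * indicator {u..} h \<partial>lborel)"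
    using AE_lborel_singleton[of u] by (intro nn_integral_cong_AE) (auto simp: indicator_def elim!: eventually_mono)
  also have "\<dots> = ennreal (0 - (- y / (u\<^sup>2 + y\<^sup>2)))"
  proof (rule nn_integral_FTC_atLeast)
    show "((\<lambda>h. - y / (h\<^sup>2 + y\<^sup>2)) \<longlongrightarrow> 0) at_top" by real_asymp
    show "DERIV (\<lambda>h. - y / (h\<^sup>2 + y\<^sup>2)) h :> 2 * h * y / (h\<^sup>2 + y\<^sup>2)\<^sup>2" for h
      using pos[of h] by (auto intro!: derivative_eq_intros simp: power2_eq_square)
    show "0 \<le> 2 * h * y / (h\<^sup>2 + y\<^sup>2)\<^sup>2" if "u \<le> h" for h using that assms by auto
  qed measurable
  finally show ?thesis by simp
qed

lemma poisson_layer_cake: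
  assumes "herglotz_measure m" "y > 0"
  shows "ennreal (poisson m x y) = (\<integral>\<^sup>+h. ennreal (2 * h * y / (h\<^sup>2 + y\<^sup>2)\<^sup>2) * emeasure m {x-h<..<x+h} \<partial>lborel)"
proof -
  interpret herglotz_measure_space m using assms(1) by unfold_locales
  interpret sigma_finite_measure m by (rule sigma_finite)
  interpret pair_sigma_finite m lborel ..
  let ?w = "\<lambda>h. ennreal (2 * h * y / (h\<^sup>2 + y\<^sup>2)\<^sup>2)"
  have "ennreal (poisson m x y) = (\<integral>\<^sup>+t. (\<integral>\<^sup>+h. ?w h * indicator {p. \<bar>fst p - x\<bar> < snd p} (t, h) \<partial>lborel) \<partial>m)"
    unfolding nn_kernel[OF assms(2), symmetric]
  proof (intro nn_integral_cong)
    fix t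
    have "(\<integral>\<^sup>+h. ?w h * indicator {p. \<bar>fst p - x\<bar> < snd p} (t, h) \<partial>lborel) = (\<integral>\<^sup>+h. ?w h * indicator {\<bar>t - x\<bar><..} h \<partial>lborel)"
      by (intro nn_integral_cong) (auto simp: indicator_def)
    also have "\<dots> = ennreal (y / (\<bar>t - x\<bar>\<^sup>2 + y\<^sup>2))" by (rule kernel_layer_cake) (use assms in auto)
    finally show "ennreal (y / ((t - x)\<^sup>2 + y\<^sup>2)) = (\<integral>\<^sup>+h. ?w h * indicator {p. \<bar>fst p - x\<bar> < snd p} (t, h) \<partial>lborel)" by simp
  qed
  also have "\<dots> = (\<integral>\<^sup>+h. (\<integral>\<^sup>+t. ?w h * indicator {p. \<bar>fst p - x\<bar> < snd p} (t, h) \<partial>m) \<partial>lborel)"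
    by (rule Fubini'[symmetric]) measurable
  also have "\<dots> = (\<integral>\<^sup>+h. ?w h * emeasure m {x-h<..<x+h} \<partial>lborel)"
  proof (intro nn_integral_cong)
    fix h
    have "(\<integral>\<^sup>+t. ?w h * indicator {p. \<bar>fst p - x\<bar> < snd p} (t, h) \<partial>m) = (\<integral>\<^sup>+t. ?w h * indicator {x-h<..<x+h} t \<partial>m)"
      by (intro nn_integral_cong) (auto simp: indicator_def)
    also have "\<dots> = ?w h * emeasure m {x-h<..<x+h}" by (rule nn_integral_cmult_indicator) simp
    finally show "(\<integral>\<^sup>+t. ?w h * indicator {p. \<bar>fst p - x\<bar> < snd p} (t, h) \<partial>m) = \<dots>" .
  qed
  finally show ?thesis .
qed

lemma poisson_maximal_inequality:
  assumes m: "herglotz_measure m" and s: "herglotz_measure s" and d: "d > 0"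
  obtains B where "open B" "ennreal d * emeasure s B \<le> 2 * emeasure m UNIV"
    "\<And>x y. x \<notin> B \<Longrightarrow> y > 0 \<Longrightarrow> poisson m x y \<le> d * poisson s x y"
proof -
  interpret m: herglotz_measure_space m using m by unfold_locales
  interpret s: herglotz_measure_space s using s by unfold_locales
  obtain B where B: "open B" "ennreal d * emeasure s B \<le> 2 * emeasure m UNIV"
    "\<And>x a b. x \<notin> B \<Longrightarrow> x \<in> {a<..<b} \<Longrightarrow> emeasure m {a<..<b} \<le> ennreal d * emeasure s {a<..<b}"
    using interval_maximal_inequality[OF m.sets_m s.sets_m] by metis
  show ?thesis
  proof (rule that[OF B(1,2)])
    fix x y :: real assume x: "x \<notin> B" and y: "y > 0"
    have "ennreal (poisson m x y) \<le> (\<integral>\<^sup>+h. ennreal d * (ennreal (2 * h * y / (h\<^sup>2 + y\<^sup>2)\<^sup>2) * emeasure s {x-h<..<x+h}) \<partial>lborel)"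
      unfolding poisson_layer_cake[OF m y]
    proof (intro nn_integral_mono)
      fix h :: real
      have "emeasure m {x-h<..<x+h} \<le> ennreal d * emeasure s {x-h<..<x+h}"
        using B(3)[OF x, of "x-h" "x+h"] by (cases "h > 0") auto
      from mult_left_mono[OF this, of "ennreal (2 * h * y / (h\<^sup>2 + y\<^sup>2)\<^sup>2)"]
      show "ennreal (2 * h * y / (h\<^sup>2 + y\<^sup>2)\<^sup>2) * emeasure m {x-h<..<x+h} \<le>
        ennreal d * (ennreal (2 * h * y / (h\<^sup>2 + y\<^sup>2)\<^sup>2) * emeasure s {x-h<..<x+h})"
        by (simp add: mult_ac)
    qed
    also have "\<dots> = ennreal d * ennreal (poisson s x y)"
    proof -
      have "(\<lambda>h. emeasure s {x-h<..<x+h}) \<in> borel_measurable lborel"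
      proof -
        interpret sigma_finite_measure s by (rule s.sigma_finite)
        have "open {p::real \<times> real. \<bar>snd p - x\<bar> < fst p}"
          by (intro open_Collect_less continuous_intros)
        then have "{p::real \<times> real. \<bar>snd p - x\<bar> < fst p} \<in> sets (borel \<Otimes>\<^sub>M borel)"
          unfolding borel_prod by (rule borel_open)
        also have "sets (borel \<Otimes>\<^sub>M borel) = sets (lborel \<Otimes>\<^sub>M s)"
          by (intro sets_pair_measure_cong) auto
        finally have "{p::real \<times> real. \<bar>snd p - x\<bar> < fst p} \<in> sets (lborel \<Otimes>\<^sub>M s)" .
        from measurable_emeasure_Pair[OF this]
        have "(\<lambda>h. emeasure s (Pair h -` {p. \<bar>snd p - x\<bar> < fst p})) \<in> borel_measurable lborel" .
        moreover have "Pair h -` {p. \<bar>snd p - x\<bar> < fst p} = {x-h<..<x+h}" for h :: real by auto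
        ultimately show ?thesis by (simp only: )
      qed
      then show ?thesis
        unfolding poisson_layer_cake[OF s y] by (intro nn_integral_cmult) simp
    qed
    finally have "ennreal (poisson m x y) \<le> ennreal (d * poisson s x y)"
      using d y by (simp add: ennreal_mult s.poisson_nonneg)
    then show "poisson m x y \<le> d * poisson s x y"
      using d y by (simp add: s.poisson_nonneg)
  qed
qed

section \<open>Comparison of Poisson integrals near the boundary\<close>

lemma herglotz_measure_lborel: "herglotz_measure lborel"
proof -
  have "integrable lborel (\<lambda>x::real. inverse (1 + x\<^sup>2))"
    using integrable_inverse_1_plus_square by (simp add: set_integrable_def)
  then have "integrable lborel (\<lambda>x::real. 1 / (x\<^sup>2 + 1))"
    by (simp add: inverse_eq_divide add.commute)
  then have "(\<integral>\<^sup>+x. ennreal (1 / (x\<^sup>2 + 1)) \<partial>lborel) = ennreal (LINT x|lborel. 1 / (x\<^sup>2 + 1))"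
    by (intro nn_integral_eq_integral) auto
  then show ?thesis by (simp add: herglotz_measure_def)
qed

interpretation lborel_herglotz: herglotz_measure_space lborel
  by unfold_locales (rule herglotz_measure_lborel)

lemma poisson_lborel:
  assumes "y > 0"
  shows "poisson lborel x y = pi"
proof -
  have "poisson lborel x y = \<bar>y\<bar> *\<^sub>R (LINT t|lborel. y / ((x + y * t - x)\<^sup>2 + y\<^sup>2))"
    unfolding poisson_def using assms by (intro lborel_integral_real_affine) auto
  also have "\<dots> = (LINT t|lborel. y * (y / ((x + y * t - x)\<^sup>2 + y\<^sup>2)))"
    using assms unfolding integral_mult_right_zero by simp
  also have "\<dots> = (LINT t|lborel. inverse (1 + t\<^sup>2))"
  proof (rule Bochner_Integration.integral_cong[OF refl])
    fix t :: real
    have "(x + y * t - x)\<^sup>2 + y\<^sup>2 = y\<^sup>2 * (1 + t\<^sup>2)" by (simp add: power2_eq_square algebra_simps)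
    then show "y * (y / ((x + y * t - x)\<^sup>2 + y\<^sup>2)) = inverse (1 + t\<^sup>2)"
      using assms by (simp add: power2_eq_square inverse_eq_divide)
  qed
  also have "\<dots> = pi"
    using LBINT_inverse_1_plus_square by (simp add: interval_lebesgue_integral_def set_lebesgue_integral_def)
  finally show ?thesis .
qed

text \<open>Mass at positive distance from \<open>x\<close> contributes only \<open>O(y)\<close> to the Poisson integral at height \<open>y\<close>.\<close>

lemma poisson_far_le:
  assumes "herglotz_measure m" "r > 0" and null: "emeasure m {x-r<..<x+r} = 0"
  obtains C where "\<And>y. y > 0 \<Longrightarrow> poisson m x y \<le> C * y"
proof -
  interpret herglotz_measure_space m using assms(1) by unfold_locales
  define K where "K = 2 + (2*x\<^sup>2+1)/r\<^sup>2"
  have "poisson m x y \<le> K * cauchy_mass m * y" if y: "y > 0" for y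
  proof -
    have "AE t in m. t \<notin> {x-r<..<x+r}"
      using null by (intro AE_not_in) (auto simp: null_sets_def)
    then have "AE t in m. y / ((t - x)\<^sup>2 + y\<^sup>2) \<le> (K * y) * (1 / (t\<^sup>2 + 1))"
    proof (rule eventually_mono)
      fix t assume "t \<notin> {x-r<..<x+r}"
      then have "r \<le> \<bar>t - x\<bar>" by (auto simp: abs_if)
      then have rt: "r\<^sup>2 \<le> (t - x)\<^sup>2" using assms(2) by (metis abs_ge_zero abs_le_square_iff abs_of_pos power2_abs)
      have p: "t\<^sup>2 + 1 > 0" by (simp add: add_nonneg_pos)
      have "t\<^sup>2 + 1 \<le> 2*(t-x)\<^sup>2 + (2*x\<^sup>2+1)"
        using zero_le_power2[of "t - 2*x"] by (simp add: power2_eq_square algebra_simps)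
      also have "(2*x\<^sup>2+1) = (2*x\<^sup>2+1)/r\<^sup>2 * r\<^sup>2" using assms(2) by simp
      also have "\<dots> \<le> (2*x\<^sup>2+1)/r\<^sup>2 * (t-x)\<^sup>2" using rt by (intro mult_left_mono) auto
      also have "2*(t-x)\<^sup>2 + (2*x\<^sup>2+1)/r\<^sup>2 * (t-x)\<^sup>2 = K * (t-x)\<^sup>2" unfolding K_def by (rule distrib_right[symmetric])
      also have "\<dots> \<le> K * ((t-x)\<^sup>2 + y\<^sup>2)" unfolding K_def by (intro mult_left_mono) auto
      finally have "1 / ((t - x)\<^sup>2 + y\<^sup>2) \<le> K * (1 / (t\<^sup>2 + 1))"
        using kernel_pos[OF y, of t x] p by (simp add: field_simps)
      from mult_left_mono[OF this, of y] y
      show "y / ((t - x)\<^sup>2 + y\<^sup>2) \<le> (K * y) * (1 / (t\<^sup>2 + 1))" by (simp add: mult_ac)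
    qed
    then have "poisson m x y \<le> (LINT t|m. (K * y) * (1 / (t\<^sup>2 + 1)))"
      unfolding poisson_def using integrable_weight y
      by (intro integral_mono_AE integrable_kernel integrable_mult_right) auto
    also have "\<dots> = (K * y) * cauchy_mass m"
      unfolding cauchy_mass_def by (rule integral_mult_right_zero)
    finally show ?thesis by (simp add: mult_ac)
  qed
  then show ?thesis by (rule that)
qed

text \<open>The form in which maximal inequalities give statements almost everywhere: a property that holds
  outside sets of arbitrarily small measure.\<close>

lemma AE_I_small:
  assumes s: "sets s = sets borel"
    and small: "\<And>e::real. e > 0 \<Longrightarrow> \<exists>B\<in>sets borel. emeasure s B \<le> ennreal e \<and> (\<forall>x. x \<notin> B \<longrightarrow> Q x)"
  shows "AE x in s. Q x"
proof -
  have "\<forall>n. \<exists>B\<in>sets borel. emeasure s B \<le> ennreal (1 / Suc n) \<and> (\<forall>x. x \<notin> B \<longrightarrow> Q x)"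
    using small by simp
  then obtain B where B: "\<And>n. B n \<in> sets borel" "\<And>n. emeasure s (B n) \<le> ennreal (1 / Suc n)"
    "\<And>n x. x \<notin> B n \<Longrightarrow> Q x" by metis
  have "emeasure s (\<Inter>n. B n) \<le> ennreal (1 / Suc n)" for n
    using B s by (intro order_trans[OF emeasure_mono B(2)[of n]]) auto
  then have "emeasure s (\<Inter>n. B n) \<le> 0"
    by (intro LIMSEQ_le_const[OF tendsto_ennrealI[OF LIMSEQ_Suc[OF lim_1_over_n], simplified]]) auto
  then have N: "(\<Inter>n. B n) \<in> null_sets s" using B(1) s by (auto simp: null_sets_def)
  show ?thesis
    by (rule AE_I'[OF N]) (use B(3) in blast)
qed

lemma AE_I_small_windows:
  fixes s :: "real measure"
  assumes s: "sets s = sets borel"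
    and small: "\<And>R e::real. R > 0 \<Longrightarrow> e > 0 \<Longrightarrow>
      \<exists>B\<in>sets borel. emeasure s B \<le> ennreal e \<and> (\<forall>x\<in>{-R<..<R} - B. Q x)"
  shows "AE x in s. Q x"
proof -
  have "AE x in s. x \<in> {- real (Suc n)<..<real (Suc n)} \<longrightarrow> Q x" for n
  proof (rule AE_I_small[OF s])
    fix e :: real assume "e > 0"
    then show "\<exists>B\<in>sets borel. emeasure s B \<le> ennreal e \<and> (\<forall>x. x \<notin> B \<longrightarrow> x \<in> {- real (Suc n)<..<real (Suc n)} \<longrightarrow> Q x)"
      using small[of "real (Suc n)" e] by (simp add: Ball_def) blast
  qed
  then have "AE x in s. \<forall>n. x \<in> {- real (Suc n)<..<real (Suc n)} \<longrightarrow> Q x"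
    by (simp only: AE_all_countable) blast
  then show ?thesis
  proof (rule eventually_mono)
    fix x assume *: "\<forall>n. x \<in> {- real (Suc n)<..<real (Suc n)} \<longrightarrow> Q x"
    obtain n where "\<bar>x\<bar> < real n" using reals_Archimedean2 by blast
    then have "x \<in> {- real (Suc n)<..<real (Suc n)}" by (auto simp: abs_less_iff)
    then show "Q x" using * by blast
  qed
qed

text \<open>At such a point every contribution of order \<open>O(y)\<close>, in particular that of distant mass and of the
  linear term of a Herglotz function, is negligible against the Poisson integral of \<open>s\<close>.\<close>

definition poisson_dominates :: "real measure \<Rightarrow> real \<Rightarrow> bool" where
  "poisson_dominates s x \<longleftrightarrow> (\<forall>e>0. \<forall>\<^sub>F y in at_right 0. y \<le> e * poisson s x y)"

lemma eventually_pos_at_right: "\<forall>\<^sub>F y in at_right (0::real). y > 0"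
  by (rule eventually_at_right_less)

lemma poisson_dominates_linear:
  assumes "poisson_dominates s x" "e > 0"
  shows "\<forall>\<^sub>F y in at_right 0. c * y \<le> e * poisson s x y"
proof -
  have "e / (\<bar>c\<bar> + 1) > 0" using assms(2) by simp
  then have "\<forall>\<^sub>F y in at_right 0. y \<le> e / (\<bar>c\<bar> + 1) * poisson s x y"
    using assms(1) unfolding poisson_dominates_def by blast
  then show ?thesis using eventually_pos_at_right
  proof eventually_elim
    case (elim y)
    have "c * y \<le> (\<bar>c\<bar> + 1) * y" using elim(2) by (intro mult_right_mono) auto
    also have "\<dots> \<le> (\<bar>c\<bar> + 1) * (e / (\<bar>c\<bar> + 1) * poisson s x y)"
      using elim(1) by (intro mult_left_mono) auto
    also have "\<dots> = e * poisson s x y" by simp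
    finally show ?case .
  qed
qed

text \<open>The maximal inequality only sees the mass of \<open>m\<close> in \<open>U\<close>, because the remaining mass and a linear
  term are absorbed at points where \<open>s\<close> dominates. The localisation is what makes the inequality
  useful for measures of infinite total mass and for neighbourhoods of null sets.\<close>

lemma poisson_local_maximal:
  assumes m: "herglotz_measure m" and s: "herglotz_measure s" and U: "open U" and d: "d > 0"
  obtains B where "open B" "ennreal d * emeasure s B \<le> 2 * emeasure m U"
    "\<And>x c. x \<in> U \<Longrightarrow> x \<notin> B \<Longrightarrow> poisson_dominates s x \<Longrightarrow>
       \<forall>\<^sub>F y in at_right 0. poisson m x y + c * y \<le> 2 * d * poisson s x y"
proof -
  interpret m: herglotz_measure_space m using m by unfold_locales
  have Ub: "U \<in> sets borel" using U by simp
  define m1 where "m1 = density m (indicator U)"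
  define m2 where "m2 = density m (indicator (-U))"
  have h1: "herglotz_measure m1" and h2: "herglotz_measure m2"
    unfolding m1_def m2_def using Ub m by (auto intro!: herglotz_measure_restrict)
  have e1: "emeasure m1 UNIV = emeasure m U"
    unfolding m1_def using Ub by (subst emeasure_density) auto
  have e2: "emeasure m2 A = 0" if "A \<in> sets borel" "A \<subseteq> U" for A
  proof -
    have "emeasure m2 A = (\<integral>\<^sup>+x. indicator (-U) x * indicator A x \<partial>m)"
      unfolding m2_def using Ub that by (subst emeasure_density) auto
    also have "\<dots> = (\<integral>\<^sup>+x. 0 \<partial>m)" using that by (intro nn_integral_cong) (auto simp: indicator_def)
    finally show ?thesis by simp
  qed
  obtain B where B: "open B" "ennreal d * emeasure s B \<le> 2 * emeasure m1 UNIV"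
    "\<And>x y. x \<notin> B \<Longrightarrow> y > 0 \<Longrightarrow> poisson m1 x y \<le> d * poisson s x y"
    using poisson_maximal_inequality[OF h1 s d] by metis
  show ?thesis
  proof (rule that[OF B(1)])
    show "ennreal d * emeasure s B \<le> 2 * emeasure m U" using B(2) e1 by simp
    fix x c assume x: "x \<in> U" "x \<notin> B" "poisson_dominates s x"
    obtain r where r: "r > 0" "ball x r \<subseteq> U" using U x(1) openE by blast
    have "{x-r<..<x+r} \<subseteq> U" using r by (auto simp: ball_eq_greaterThanLessThan)
    then obtain C where C: "\<And>y. y > 0 \<Longrightarrow> poisson m2 x y \<le> C * y"
      using poisson_far_le[OF h2 r(1), of x] e2 by auto
    show "\<forall>\<^sub>F y in at_right 0. poisson m x y + c * y \<le> 2 * d * poisson s x y"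
      using poisson_dominates_linear[OF x(3) d, of "C + c"] eventually_pos_at_right
    proof eventually_elim
      case (elim y)
      have "poisson m x y = poisson m1 x y + poisson m2 x y"
        unfolding m1_def m2_def by (rule poisson_restrict_split[OF m Ub elim(2)])
      also have "\<dots> \<le> d * poisson s x y + C * y" using B(3)[OF x(2) elim(2)] C[OF elim(2)] by simp
      finally show ?case using elim(1) by (simp add: algebra_simps)
    qed
  qed
qed

lemma ennreal_mult_le_imp_le:
  assumes "ennreal d * a \<le> ennreal c" "d > 0"
  shows "a \<le> ennreal (c / d)"
proof -
  have "ennreal (1/d) * (ennreal d * a) \<le> ennreal (1/d) * ennreal c"
    using assms(1) by (intro mult_left_mono) auto
  also have "ennreal (1/d) * (ennreal d * a) = a"
    using assms(2) by (simp add: mult.assoc[symmetric] flip: ennreal_mult)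
  finally show ?thesis using assms(2) by (simp flip: ennreal_mult')
qed

text \<open>If the Poisson integral of \<open>s\<close> came close to zero at a point, Lebesgue measure on a window would
  have a large Poisson integral relative to \<open>s\<close> there; by the maximal inequality this happens only on
  a set of small \<open>s\<close>-measure.\<close>

lemma AE_poisson_dominates:
  assumes s: "herglotz_measure s"
  shows "AE x in s. poisson_dominates s x"
proof -
  interpret s: herglotz_measure_space s using s by unfold_locales
  show ?thesis
  proof (rule AE_I_small_windows[OF s.sets_m])
    fix R e :: real assume R: "R > 0" and e: "e > 0"
    define J where "J = {-R<..<R}"
    have J: "J \<in> sets borel" by (simp add: J_def)
    define l1 where "l1 = density lborel (indicator J)"
    define l2 where "l2 = density lborel (indicator (-J))"
    have h1: "herglotz_measure l1" and h2: "herglotz_measure l2"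
      unfolding l1_def l2_def using J herglotz_measure_lborel by (auto intro!: herglotz_measure_restrict)
    have e1: "emeasure l1 UNIV = ennreal (2 * R)"
      unfolding l1_def using J by (subst emeasure_density) (use R in \<open>auto simp: J_def\<close>)
    define d where "d = 4 * R / e"
    have d: "d > 0" using e R by (simp add: d_def)
    obtain B where B: "open B" "ennreal d * emeasure s B \<le> 2 * emeasure l1 UNIV"
      "\<And>x y. x \<notin> B \<Longrightarrow> y > 0 \<Longrightarrow> poisson l1 x y \<le> d * poisson s x y"
      using poisson_maximal_inequality[OF h1 s d] by metis
    have "2 * ennreal (2 * R) = ennreal (4 * R)" using R by (simp flip: ennreal_numeral ennreal_mult')
    then have "emeasure s B \<le> ennreal (4 * R / d)"
      using B(2) d unfolding e1 by (intro ennreal_mult_le_imp_le) auto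
    also have "4 * R / d = e" using e R by (simp add: d_def)
    finally have sB: "emeasure s B \<le> ennreal e" .
    have "poisson_dominates s x" if x: "x \<in> J" "x \<notin> B" for x
      unfolding poisson_dominates_def
    proof (intro allI impI)
      fix e' :: real assume e': "e' > 0"
      define r where "r = min (x + R) (R - x)"
      have r: "r > 0" "{x-r<..<x+r} \<subseteq> J" using x by (auto simp: r_def J_def)
      have "emeasure l2 {x-r<..<x+r} = (\<integral>\<^sup>+t. indicator (-J) t * indicator {x-r<..<x+r} t \<partial>lborel)"
        unfolding l2_def using J by (subst emeasure_density) auto
      also have "\<dots> = (\<integral>\<^sup>+t. 0 \<partial>(lborel :: real measure))" using r(2) by (intro nn_integral_cong) (auto simp: indicator_def)
      finally obtain C where C: "\<And>y. y > 0 \<Longrightarrow> poisson l2 x y \<le> C * y"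
        using poisson_far_le[OF h2 r(1), of x] by auto
      have "((\<lambda>y. C * y + d * y / e') \<longlongrightarrow> C * 0 + d * 0 / e') (at_right 0)"
        using e' by (intro tendsto_intros) auto
      then have "\<forall>\<^sub>F y in at_right 0. C * y + d * y / e' < pi"
        by (rule order_tendstoD) simp
      then show "\<forall>\<^sub>F y in at_right 0. y \<le> e' * poisson s x y"
        using eventually_pos_at_right
      proof eventually_elim
        case (elim y)
        have "pi = poisson l1 x y + poisson l2 x y"
          unfolding l1_def l2_def poisson_lborel[OF elim(2), of x, symmetric]
          by (rule poisson_restrict_split[OF herglotz_measure_lborel J elim(2)])
        also have "\<dots> \<le> d * poisson s x y + C * y" using B(3)[OF x(2) elim(2)] C[OF elim(2)] by simp
        finally have "d * (y / e') \<le> d * poisson s x y" using elim(1) by simp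
        then have "y / e' \<le> poisson s x y" using d mult_le_cancel_left_pos by blast
        then show ?case using e' by (simp add: field_simps)
      qed
    qed
    then show "\<exists>B\<in>sets borel. emeasure s B \<le> ennreal e \<and> (\<forall>x\<in>{-R<..<R} - B. poisson_dominates s x)"
      using B(1) sB by (intro bexI[of _ B]) (auto simp: J_def)
  qed
qed

lemma open_superset_small:
  fixes m :: "real measure"
  assumes "finite_measure m" "sets m = sets borel" "A \<in> sets borel" "emeasure m A = 0" "e > 0"
  obtains U where "open U" "A \<subseteq> U" "emeasure m U < ennreal e"
proof -
  interpret finite_measure m by fact
  have "(INF U \<in> {U. A \<subseteq> U \<and> open U}. emeasure m U) < ennreal e"
    using outer_regular[OF assms(2) _ assms(3)] assms(4,5) by simp
  then show ?thesis using that by (auto simp: INF_less_iff)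
qed

definition weighted :: "real measure \<Rightarrow> real measure" where
  "weighted m = density m (\<lambda>t. ennreal (1 / (t\<^sup>2 + 1)))"

lemma (in herglotz_measure_space) emeasure_weighted:
  "A \<in> sets borel \<Longrightarrow> emeasure (weighted m) A = (\<integral>\<^sup>+t. ennreal (1 / (t\<^sup>2 + 1)) * indicator A t \<partial>m)"
  unfolding weighted_def by (subst emeasure_density) auto

lemma (in herglotz_measure_space) finite_weighted: "finite_measure (weighted m)"
  using emeasure_weighted[of UNIV] nn_weight
  by (intro finite_measureI) (simp add: weighted_def)

text \<open>A null set of \<open>m\<close> has open neighbourhoods of small \<open>m\<close>-measure, and the local maximal inequality
  applies to them. The lemma takes the place of a differentiation theorem for measures: for Lebesgue
  measure \<open>m\<close> it shows that Poisson integrals of \<open>s\<close> are large on null sets, and for a measure whose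
  density is the positive part of \<open>h - q\<close> it compares the density \<open>h\<close> with the constant \<open>q\<close>.\<close>

lemma null_set_poisson_negligible:
  assumes m: "herglotz_measure m" and s: "herglotz_measure s" and A: "A \<in> sets borel" "emeasure m A = 0"
  shows "AE x in s. x \<in> A \<longrightarrow> (\<forall>e>0. \<forall>\<^sub>F y in at_right 0. poisson m x y \<le> e * poisson s x y)"
proof -
  interpret m: herglotz_measure_space m using m by unfold_locales
  interpret s: herglotz_measure_space s using s by unfold_locales
  have sw: "sets (weighted m) = sets borel" by (simp add: weighted_def)
  let ?Q = "\<lambda>k x. \<forall>\<^sub>F y in at_right 0. poisson m x y \<le> (1 / Suc k) * poisson s x y"
  have wA: "emeasure (weighted m) A = 0"
  proof -
    have "AE t in m. t \<notin> A" using A by (intro AE_not_in) (auto simp: null_sets_def)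
    then have "(\<integral>\<^sup>+t. ennreal (1 / (t\<^sup>2 + 1)) * indicator A t \<partial>m) = (\<integral>\<^sup>+t. 0 \<partial>m)"
      by (intro nn_integral_cong_AE) (auto elim!: eventually_mono)
    then show ?thesis using m.emeasure_weighted[OF A(1)] by simp
  qed
  have "AE x in s. poisson_dominates s x \<longrightarrow> x \<in> A \<longrightarrow> ?Q k x" for k :: nat
  proof (rule AE_I_small_windows[OF s.sets_m])
    fix R e :: real assume e: "e > 0"
    define d where "d = 1 / (2 * real (Suc k))"
    have d: "d > 0" by (simp add: d_def)
    have "e * d / (2 * (R\<^sup>2 + 1)) > 0" using e d by (simp add: add_nonneg_pos)
    then obtain U where U: "open U" "A \<subseteq> U" "emeasure (weighted m) U < ennreal (e * d / (2 * (R\<^sup>2 + 1)))"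
      using open_superset_small[OF m.finite_weighted sw A(1) wA] by metis
    define V where "V = U \<inter> {-R<..<R}"
    have V: "open V" using U by (auto simp: V_def)
    have "emeasure m V \<le> ennreal (R\<^sup>2 + 1) * emeasure (weighted m) V"
      using V by (subst m.emeasure_weighted, simp, intro m.emeasure_bounded_le) (auto simp: V_def)
    also have "emeasure (weighted m) V \<le> emeasure (weighted m) U"
      using U by (intro emeasure_mono) (auto simp: V_def sw)
    also have "\<dots> \<le> ennreal (e * d / (2 * (R\<^sup>2 + 1)))" using U(3) by simp
    also have "ennreal (R\<^sup>2 + 1) * ennreal (e * d / (2 * (R\<^sup>2 + 1))) = ennreal (e * d / 2)"
    proof -
      have "(R\<^sup>2 + 1) * (e * d / (2 * (R\<^sup>2 + 1))) = e * d / 2"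
        using add_nonneg_pos[of "R\<^sup>2" 1] by (simp add: field_simps)
      moreover have "ennreal (R\<^sup>2 + 1) * ennreal q = ennreal ((R\<^sup>2 + 1) * q)" for q
        by (rule ennreal_mult'[symmetric]) simp
      ultimately show ?thesis by (simp only:)
    qed
    finally have mV: "emeasure m V \<le> ennreal (e * d / 2)" by (simp add: mult_left_mono)
    obtain B where B: "open B" "ennreal d * emeasure s B \<le> 2 * emeasure m V"
      "\<And>x c. x \<in> V \<Longrightarrow> x \<notin> B \<Longrightarrow> poisson_dominates s x \<Longrightarrow>
       \<forall>\<^sub>F y in at_right 0. poisson m x y + c * y \<le> 2 * d * poisson s x y"
      using poisson_local_maximal[OF m s V d] by metis
    have "2 * emeasure m V \<le> 2 * ennreal (e * d / 2)" using mV by (intro mult_left_mono) auto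
    also have "\<dots> = ennreal (e * d)" using e d by (simp flip: ennreal_numeral ennreal_mult')
    finally have "emeasure s B \<le> ennreal (e * d / d)"
      using B(2) d by (intro ennreal_mult_le_imp_le) auto
    then have "emeasure s B \<le> ennreal e" using d by simp
    moreover have "?Q k x" if "poisson_dominates s x" "x \<in> A \<inter> {-R<..<R}" "x \<notin> B" for x
    proof -
      have d2: "2 * d = 1 / Suc k" unfolding d_def by (simp add: field_simps)
      have "x \<in> V" using that U(2) by (auto simp: V_def)
      from B(3)[OF this that(3,1), of 0] show ?thesis unfolding d2 by simp
    qed
    ultimately show "\<exists>B\<in>sets borel. emeasure s B \<le> ennreal e \<and>
        (\<forall>x\<in>{-R<..<R} - B. poisson_dominates s x \<longrightarrow> x \<in> A \<longrightarrow> ?Q k x)"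
      using B(1) by (intro bexI[of _ B]) auto
  qed
  then have "AE x in s. \<forall>k. poisson_dominates s x \<longrightarrow> x \<in> A \<longrightarrow> ?Q k x"
    by (simp only: AE_all_countable) blast
  then show ?thesis using AE_poisson_dominates[OF s]
  proof eventually_elim
    case (elim x)
    show ?case
    proof (intro impI allI)
      fix e :: real assume x: "x \<in> A" and e: "e > 0"
      obtain k where k: "1 / real (Suc k) < e" using nat_approx_posE[OF e] by auto
      have "?Q k x" using elim x by blast
      then show "\<forall>\<^sub>F y in at_right 0. poisson m x y \<le> e * poisson s x y"
        using eventually_pos_at_right
      proof eventually_elim
        case (elim y)
        have "(1 / Suc k) * poisson s x y \<le> e * poisson s x y"
          using k s.poisson_nonneg[OF elim(2)] by (intro mult_right_mono) auto
        then show ?case using elim(1) by simp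
      qed
    qed
  qed
qed

text \<open>The preceding lemma for Lebesgue measure, whose Poisson integral is the constant \<open>\<pi>\<close>.\<close>

lemma poisson_at_top_on_null_set:
  assumes s: "herglotz_measure s" and N: "N \<in> null_sets lborel"
  shows "AE x in s. x \<in> N \<longrightarrow> filterlim (poisson s x) at_top (at_right 0)"
proof -
  have "AE x in s. x \<in> N \<longrightarrow> (\<forall>e>0. \<forall>\<^sub>F y in at_right 0. poisson lborel x y \<le> e * poisson s x y)"
    using N by (intro null_set_poisson_negligible[OF herglotz_measure_lborel s]) (auto simp: null_sets_def)
  then show ?thesis
  proof (rule eventually_mono, intro impI)
    fix x assume *: "x \<in> N \<longrightarrow> (\<forall>e>0. \<forall>\<^sub>F y in at_right 0. poisson lborel x y \<le> e * poisson s x y)" and "x \<in> N"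
    show "filterlim (poisson s x) at_top (at_right 0)"
      unfolding filterlim_at_top_gt[where c=0]
    proof (intro allI impI)
      fix Z :: real assume Z: "Z > 0"
      then have "pi / Z > 0" by simp
      then have "\<forall>\<^sub>F y in at_right 0. poisson lborel x y \<le> pi / Z * poisson s x y"
        using * \<open>x \<in> N\<close> by blast
      then show "\<forall>\<^sub>F y in at_right 0. Z \<le> poisson s x y"
        using eventually_pos_at_right
      proof eventually_elim
        case (elim y)
        then show ?case using Z by (simp add: poisson_lborel field_simps)
      qed
    qed
  qed
qed

section \<open>The integral representation of Herglotz functions\<close>

definition unit_point :: "real \<Rightarrow> complex" where
  "unit_point x = exp (2 * of_real pi * \<i> * of_real x)"

lemma norm_unit_point [simp]: "norm (unit_point x) = 1"
  by (simp add: unit_point_def)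

lemma unit_point_nonzero [simp]: "unit_point x \<noteq> 0"
  by (simp add: unit_point_def)

lemma continuous_unit_point [continuous_intros]: "continuous_on A unit_point"
  unfolding unit_point_def by (intro continuous_intros)

lemma cnj_unit_point: "cnj (unit_point x) = 1 / unit_point x"
  using complex_norm_square[of "unit_point x"] by (simp add: field_simps)

lemma cauchy_formula_unit_point:
  assumes q: "q holomorphic_on cball 0 1" and w: "norm w < 1"
  shows "((\<lambda>x. q (unit_point x) * (unit_point x / (unit_point x - w))) has_integral q w) {0..1}"
proof -
  have "((\<lambda>u. q u / (u - w)) has_contour_integral (2 * of_real pi * \<i> * q w)) (circlepath 0 1)"
    using Cauchy_integral_circlepath_simple[OF q] w by simp
  then have "((\<lambda>x. q (circlepath 0 1 x) / (circlepath 0 1 x - w) * vector_derivative (circlepath 0 1) (at x within {0..1}))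
      has_integral (2 * of_real pi * \<i> * q w)) {0..1}"
    by (simp add: has_contour_integral_def)
  then have "((\<lambda>x. 1 / (2 * of_real pi * \<i>) * (q (circlepath 0 1 x) / (circlepath 0 1 x - w) * vector_derivative (circlepath 0 1) (at x within {0..1})))
      has_integral 1 / (2 * of_real pi * \<i>) * (2 * of_real pi * \<i> * q w)) {0..1}"
    by (rule has_integral_mult_right)
  also have "1 / (2 * of_real pi * \<i>) * (2 * of_real pi * \<i> * q w) = q w" by simp
  finally show ?thesis
  proof (rule has_integral_eq[rotated])
    fix x :: real assume x: "x \<in> {0..1}"
    have vd: "vector_derivative (circlepath 0 1) (at x within {0..1}) = (2 * of_real pi * \<i>) * unit_point x"
      using x by (subst vector_derivative_circlepath01) (auto simp: unit_point_def)
    have cp: "circlepath 0 1 x = unit_point x" by (simp add: circlepath unit_point_def)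
    have gen: "1 / c * (A / B * (c * D)) = A * (D / B)" if "c \<noteq> 0" for A B c D :: complex
      using that by simp
    show "1 / (2 * of_real pi * \<i>) * (q (circlepath 0 1 x) / (circlepath 0 1 x - w) * vector_derivative (circlepath 0 1) (at x within {0..1}))
        = q (unit_point x) * (unit_point x / (unit_point x - w))"
      unfolding vd cp by (rule gen) simp
  qed
qed

text \<open>Schwarz's formula recovers a holomorphic function from the real part of its values on a circle. It
  is the sum of Cauchy's formula at \<open>w\<close> and of its conjugate at the reflected point, where the
  integral reduces to the value at the centre.\<close>

lemma schwarz_integral_formula:
  assumes f: "f holomorphic_on ball 0 1" and r: "0 < r" "r < 1" and w: "norm w < 1"
  shows "((\<lambda>x. (unit_point x + w) / (unit_point x - w) * of_real (Re (f (of_real r * unit_point x))))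
           has_integral (f (of_real r * w) - \<i> * of_real (Im (f 0)))) {0..1}"
proof -
  define q where "q = (\<lambda>z. f (of_real r * z))"
  have sub: "(\<lambda>z. of_real r * z) ` cball 0 1 \<subseteq> ball (0::complex) 1"
  proof
    fix z :: complex assume "z \<in> (\<lambda>z. of_real r * z) ` cball 0 1"
    then obtain v where v: "z = of_real r * v" "v \<in> cball 0 1" by blast
    then have "norm z \<le> r" using r by (simp add: norm_mult mult_left_le)
    then show "z \<in> ball 0 1" using r by simp
  qed
  have q: "q holomorphic_on cball 0 1"
    unfolding q_def using holomorphic_on_compose_gen[OF _ f sub] by (simp add: o_def holomorphic_intros)
  let ?e = unit_point
  have ne: "?e x - w \<noteq> 0" for x using w norm_unit_point[of x] by auto
  have A: "((\<lambda>x. q (?e x) * (?e x / (?e x - w))) has_integral q w) {0..1}"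
    by (rule cauchy_formula_unit_point[OF q w])
  have ne2: "1 - cnj w * u \<noteq> 0" if "u \<in> cball 0 1" for u
  proof
    assume "1 - cnj w * u = 0"
    then have "norm (cnj w * u) = 1" by (metis eq_iff_diff_eq_0 norm_one)
    moreover have "norm (cnj w * u) \<le> norm w * 1"
      unfolding norm_mult using that by (intro mult_mono) auto
    ultimately show False using w by simp
  qed
  have "(\<lambda>u. q u / (1 - cnj w * u)) holomorphic_on cball 0 1"
    using ne2 by (intro holomorphic_intros q) auto
  from cauchy_formula_unit_point[OF this, of 0]
  have "((\<lambda>x. q (?e x) / (1 - cnj w * ?e x)) has_integral q 0) {0..1}" by simp
  from has_integral_cnj[THEN iffD2, OF this]
  have "((\<lambda>x. cnj (q (?e x) / (1 - cnj w * ?e x))) has_integral cnj (q 0)) {0..1}"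
    by (simp only: o_def)
  then have B: "((\<lambda>x. cnj (q (?e x)) * (?e x / (?e x - w))) has_integral cnj (q 0)) {0..1}"
  proof (rule has_integral_eq[rotated])
    fix x
    have "1 - w * (1 / ?e x) = (?e x - w) / ?e x" by (simp add: field_simps)
    then show "cnj (q (?e x) / (1 - cnj w * ?e x)) = cnj (q (?e x)) * (?e x / (?e x - w))"
      by (simp add: cnj_unit_point)
  qed
  have C1: "((\<lambda>x. q (?e x)) has_integral q 0) {0..1}"
    using cauchy_formula_unit_point[OF q, of 0] by simp
  from has_integral_cnj[THEN iffD2, OF this]
  have C2: "((\<lambda>x. cnj (q (?e x))) has_integral cnj (q 0)) {0..1}"
    by (simp only: o_def)
  have C: "((\<lambda>x. 1/2 * (q (?e x) + cnj (q (?e x)))) has_integral 1/2 * (q 0 + cnj (q 0))) {0..1}"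
    by (intro has_integral_mult_right has_integral_add C1 C2)
  have "((\<lambda>x. (q (?e x) * (?e x / (?e x - w)) + cnj (q (?e x)) * (?e x / (?e x - w)))
       - 1/2 * (q (?e x) + cnj (q (?e x)))) has_integral (q w + cnj (q 0)) - 1/2 * (q 0 + cnj (q 0))) {0..1}"
    by (intro has_integral_diff has_integral_add A B C)
  also have "(q w + cnj (q 0)) - 1/2 * (q 0 + cnj (q 0)) = f (of_real r * w) - \<i> * of_real (Im (f 0))"
    by (simp add: q_def complex_eq_iff)
  finally show ?thesis
  proof (rule has_integral_eq[rotated])
    fix x
    have s: "q (?e x) + cnj (q (?e x)) = of_real (2 * Re (f (of_real r * ?e x)))"
      by (simp add: complex_add_cnj q_def)
    have "(q (?e x) * (?e x / (?e x - w)) + cnj (q (?e x)) * (?e x / (?e x - w)))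
       - 1/2 * (q (?e x) + cnj (q (?e x))) = (q (?e x) + cnj (q (?e x))) * (?e x / (?e x - w) - 1/2)"
      by (simp add: algebra_simps)
    also have "?e x / (?e x - w) - 1/2 = 1/2 * ((?e x + w) / (?e x - w))"
      using ne[of x] by (simp add: field_simps)
    finally have eq: "(q (?e x) * (?e x / (?e x - w)) + cnj (q (?e x)) * (?e x / (?e x - w)))
       - 1/2 * (q (?e x) + cnj (q (?e x))) = (q (?e x) + cnj (q (?e x))) * (1/2 * ((?e x + w) / (?e x - w)))" .
    show "(q (?e x) * (?e x / (?e x - w)) + cnj (q (?e x)) * (?e x / (?e x - w)))
       - 1/2 * (q (?e x) + cnj (q (?e x))) = (?e x + w) / (?e x - w) * of_real (Re (f (of_real r * ?e x)))"
    proof -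
      have half: "of_real (2 * a) * (1/2 * K) = K * of_real a" for a and K :: complex by simp
      show ?thesis unfolding eq unfolding s by (rule half)
    qed
  qed
qed

text \<open>On circles of radius less than one the representing measure is the density \<open>Re f\<close>, whose total mass
  is \<open>Re (f 0)\<close> for every radius. A weak limit of the normalised measures represents \<open>f\<close>. The circle is
  parametrised by the real line with period one; the kernel is periodic as well, so the
  limit may be taken among measures on the whole line.\<close>

lemma herglotz_representation_disc:
  assumes f: "f holomorphic_on ball 0 1" and pos: "\<And>z. norm z < 1 \<Longrightarrow> Re (f z) > 0"
  obtains M where "real_distribution M"
    "\<And>w. norm w < 1 \<Longrightarrow> f w = \<i> * of_real (Im (f 0)) +
       of_real (Re (f 0)) * (LINT x|M. (unit_point x + w) / (unit_point x - w))"
proof -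
  let ?e = unit_point
  define c where "c = Re (f 0)"
  have c: "c > 0" unfolding c_def by (rule pos) simp
  define r :: "nat \<Rightarrow> real" where "r n = 1 - 1 / real (n + 2)" for n
  have r: "0 < r n" "r n < 1" for n by (auto simp: r_def field_simps)
  have rlim: "r \<longlonglongrightarrow> 1" unfolding r_def by real_asymp
  define g where "g n x = Re (f (of_real (r n) * ?e x)) / c" for n x
  have gpos: "g n x \<ge> 0" for n x
    unfolding g_def using r[of n] c by (intro divide_nonneg_pos less_imp_le[OF pos]) (auto simp: norm_mult)
  have gcont: "continuous_on UNIV (g n)" for n
  proof -
    have "continuous_on UNIV (\<lambda>x. f (of_real (r n) * ?e x))"
      by (rule continuous_on_compose2[OF holomorphic_on_imp_continuous_on[OF f]])
         (use r[of n] in \<open>auto intro!: continuous_intros simp: norm_mult\<close>)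
    then show ?thesis unfolding g_def using c by (intro continuous_intros) auto
  qed
  have gm [measurable]: "g n \<in> borel_measurable borel" for n
    using gcont by (rule borel_measurable_continuous_onI)
  have key: "((\<lambda>x. (?e x + w) / (?e x - w) * of_real (g n x)) has_integral
      (f (of_real (r n) * w) - \<i> * of_real (Im (f 0))) / of_real c) {0..1}" if "norm w < 1" for n w
    using has_integral_divide[OF schwarz_integral_formula[OF f r[of n] that], of "of_real c"]
    by (simp add: g_def)
  have g1: "(g n has_integral 1) {0..1}" for n
  proof -
    have "((\<lambda>x. Re (of_real (g n x))) has_integral Re (of_real 1)) {0..1}"
      using has_integral_Re[OF key[of 0 n]] c by (simp add: c_def)
    then show ?thesis by simp
  qed
  define \<nu> where "\<nu> n = density lborel (\<lambda>x. ennreal (indicator {0..1} x * g n x))" for n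
  have sets_nu [measurable_cong, simp]: "sets (\<nu> n) = sets borel" for n by (simp add: \<nu>_def)
  have nu1: "emeasure (\<nu> n) A = 1" if "A \<in> sets borel" "{0..1} \<subseteq> A" for A n
  proof -
    have "emeasure (\<nu> n) A = (\<integral>\<^sup>+x. ennreal (indicator {0..1} x * g n x) * indicator A x \<partial>lborel)"
      unfolding \<nu>_def using that by (subst emeasure_density) auto
    also have "\<dots> = (\<integral>\<^sup>+x. ennreal (indicator {0..1} x * g n x) \<partial>lborel)"
      using that by (intro nn_integral_cong) (auto simp: indicator_def)
    also have "\<dots> = ennreal 1"
      using gpos g1 by (intro nn_integral_has_integral_lebesgue) auto
    finally show ?thesis by simp
  qed
  have rd: "real_distribution (\<nu> n)" for n
  proof -
    have "prob_space (\<nu> n)"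
      by (rule prob_spaceI) (simp add: \<nu>_def nu1[unfolded \<nu>_def])
    then show ?thesis by (simp add: real_distribution_def real_distribution_axioms_def)
  qed
  have "tight \<nu>"
    unfolding tight_def
  proof (intro conjI allI impI rd)
    fix e :: real assume "e > 0"
    have "measure (\<nu> n) {-1<..2} = 1" for n
      using nu1[of "{-1<..2}" n] by (simp add: measure_def subset_eq)
    then show "\<exists>a b. a < b \<and> (\<forall>n. 1 - e < measure (\<nu> n) {a<..b})"
      using \<open>e > 0\<close> by (intro exI[of _ "-1"] exI[of _ 2]) auto
  qed
  from tight_imp_convergent_subsubsequence[OF this, of id] obtain s M where
    s: "strict_mono s" and M: "real_distribution M" and wc: "weak_conv_m (\<nu> \<circ> s) M"
    by (auto simp: strict_mono_id)
  show ?thesis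
  proof (rule that[OF M])
    fix w :: complex assume w: "norm w < 1"
    let ?k = "\<lambda>x. (?e x + w) / (?e x - w)"
    have ne: "?e x - w \<noteq> 0" for x using w norm_unit_point[of x] by auto
    have kc: "continuous_on UNIV ?k" using ne by (intro continuous_intros) auto
    have kb: "norm (?k x) \<le> 2 / (1 - norm w)" for x
    proof -
      have "norm (?e x + w) \<le> 2" using norm_triangle_ineq[of "?e x" w] w by simp
      moreover have "norm (?e x - w) \<ge> 1 - norm w" using norm_triangle_ineq2[of "?e x" w] by simp
      ultimately show ?thesis using w unfolding norm_divide by (intro frac_le) auto
    qed
    have int: "(LINT x|\<nu> n. ?k x) = (f (of_real (r n) * w) - \<i> * of_real (Im (f 0))) / of_real c" for n
    proof -
      have km [measurable]: "?k \<in> borel_measurable borel" using kc by (rule borel_measurable_continuous_onI)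
      have "(LINT x|\<nu> n. ?k x) = (LINT x|lborel. (indicator {0..1} x * g n x) *\<^sub>R ?k x)"
        unfolding \<nu>_def using gpos by (intro integral_density) auto
      also have "\<dots> = (LINT x:{0..1}|lborel. ?k x * of_real (g n x))"
        unfolding set_lebesgue_integral_def by (intro Bochner_Integration.integral_cong) (auto simp: indicator_def scaleR_conv_of_real mult.commute)
      also have "\<dots> = integral {0..1} (\<lambda>x. ?k x * of_real (g n x))"
      proof (rule set_borel_integral_eq_integral)
        have "continuous_on {0..1} (\<lambda>x. ?k x * of_real (g n x))"
          by (intro continuous_on_mult continuous_on_of_real continuous_on_subset[OF kc] continuous_on_subset[OF gcont]) auto
        then show "set_integrable lborel {0..1} (\<lambda>x. ?k x * of_real (g n x))"
          unfolding set_integrable_def by (intro borel_integrable_compact) auto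
      qed
      also have "\<dots> = (f (of_real (r n) * w) - \<i> * of_real (Im (f 0))) / of_real c"
        using key[OF w] by (rule integral_unique)
      finally show ?thesis .
    qed
    have 1: "(\<lambda>n. LINT x|(\<nu> \<circ> s) n. ?k x) \<longlonglongrightarrow> (LINT x|M. ?k x)"
    proof (rule weak_conv_imp_integral_bdd_continuous_conv[OF _ M wc])
      show "real_distribution ((\<nu> \<circ> s) n)" for n using rd by simp
      show "isCont ?k x" for x using kc by (simp add: continuous_on_eq_continuous_at)
      show "norm (?k x) \<le> 2 / (1 - norm w)" for x by (rule kb)
    qed
    have rw: "(\<lambda>n. of_real (r n) * w) \<longlonglongrightarrow> of_real 1 * w" by (intro tendsto_intros rlim)
    have "isCont f (of_real 1 * w)"
      using holomorphic_on_imp_continuous_on[OF f] w by (simp add: continuous_on_eq_continuous_at)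
    from isCont_tendsto_compose[OF this rw] have "(\<lambda>n. f (of_real (r n) * w)) \<longlonglongrightarrow> f w" by simp
    from LIMSEQ_subseq_LIMSEQ[OF this s]
    have "(\<lambda>n. f (of_real (r (s n)) * w)) \<longlonglongrightarrow> f w" by (simp add: o_def)
    then have 2: "(\<lambda>n. (f (of_real (r (s n)) * w) - \<i> * of_real (Im (f 0))) / of_real c) \<longlonglongrightarrow> (f w - \<i> * of_real (Im (f 0))) / of_real c"
      using c by (intro tendsto_intros) auto
    have "(LINT x|M. ?k x) = (f w - \<i> * of_real (Im (f 0))) / of_real c"
      using LIMSEQ_unique[OF 1] 2 by (simp add: int)
    then show "f w = \<i> * of_real (Im (f 0)) + of_real (Re (f 0)) * (LINT x|M. ?k x)"
      using c by (simp add: c_def[symmetric])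
  qed
qed

lemma Re_cayley:
  assumes "\<zeta> \<noteq> (1::complex)"
  shows "Re ((1 + \<zeta>) / (1 - \<zeta>)) = (1 - (norm \<zeta>)\<^sup>2) / (norm (1 - \<zeta>))\<^sup>2"
proof -
  have "(1 + \<zeta>) / (1 - \<zeta>) = (1 + \<zeta>) * cnj (1 - \<zeta>) / of_real ((norm (1 - \<zeta>))\<^sup>2)"
    by (simp add: complex_div_cnj[of "1 + \<zeta>" "1 - \<zeta>"])
  then have "Re ((1 + \<zeta>) / (1 - \<zeta>)) = Re ((1 + \<zeta>) * cnj (1 - \<zeta>)) / (norm (1 - \<zeta>))\<^sup>2"
    by (simp only: Re_divide_of_real)
  also have "Re ((1 + \<zeta>) * cnj (1 - \<zeta>)) = 1 - (norm \<zeta>)\<^sup>2"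
    by (simp add: cmod_power2) (simp add: power2_eq_square algebra_simps)
  finally show ?thesis .
qed

text \<open>The Cayley transform turns the kernel of the disc into that of the half plane, with the weight
  \<open>1 + t\<^sup>2\<close>.\<close>

lemma cayley_kernel:
  assumes \<zeta>: "norm \<zeta> = 1" "\<zeta> \<noteq> 1" and z: "Im z > 0"
  defines "t \<equiv> Re (\<i> * (1 + \<zeta>) / (1 - \<zeta>))" and "w \<equiv> (z - \<i>) / (z + \<i>)"
  shows "\<i> * ((\<zeta> + w) / (\<zeta> - w)) = of_real (1 + t\<^sup>2) * (1 / (of_real t - z) - of_real (t / (t\<^sup>2 + 1)))"
proof -
  have "Im (\<i> * ((1 + \<zeta>) / (1 - \<zeta>))) = 0"
    unfolding Im_i_times using Re_cayley[OF \<zeta>(2)] \<zeta>(1) by simp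
  then have t: "of_real t = \<i> * (1 + \<zeta>) / (1 - \<zeta>)"
    unfolding t_def times_divide_eq_right by (simp only: complex_eq_iff Re_complex_of_real Im_complex_of_real)
  define T where "T = (of_real t :: complex)"
  have z0: "z + \<i> \<noteq> 0" using z by (auto simp: complex_eq_iff)
  have T0: "T + \<i> \<noteq> 0" by (auto simp: complex_eq_iff T_def)
  have Tz: "T - z \<noteq> 0" using z by (auto simp: complex_eq_iff T_def)
  have "T * (1 - \<zeta>) = \<i> * (1 + \<zeta>)" using \<zeta>(2) unfolding T_def t by simp
  then have "\<zeta> * (T + \<i>) = T - \<i>" by (simp add: algebra_simps)
  then have ze: "\<zeta> = (T - \<i>) / (T + \<i>)" using T0 by (simp add: field_simps)
  have p: "\<zeta> + w = 2 * (1 + T * z) / ((T + \<i>) * (z + \<i>))"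
    unfolding ze w_def add_frac_eq[OF T0 z0] by (simp add: algebra_simps)
  have m: "\<zeta> - w = 2 * (\<i> * (T - z)) / ((T + \<i>) * (z + \<i>))"
    unfolding ze w_def diff_frac_eq[OF T0 z0] by (simp add: algebra_simps)
  have "(\<zeta> + w) / (\<zeta> - w) = (1 + T * z) / (\<i> * (T - z))"
  proof -
    have gen: "(2 * N / K) / (2 * D / K) = N / D" if "K \<noteq> 0" for N D K :: complex
      using that by simp
    show ?thesis unfolding p m by (rule gen) (use T0 z0 in simp)
  qed
  then have 1: "\<i> * ((\<zeta> + w) / (\<zeta> - w)) = (1 + T * z) / (T - z)"
    using Tz by simp
  have q: "1 + T\<^sup>2 \<noteq> 0"
  proof -
    have "1 + t\<^sup>2 > 0" by (simp add: add_pos_nonneg)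
    then have "of_real (1 + t\<^sup>2) \<noteq> (0::complex)" by (metis less_irrefl of_real_eq_0_iff)
    then show ?thesis by (simp add: T_def)
  qed
  have "(1 + T\<^sup>2) * (1 / (T - z) - T / (T\<^sup>2 + 1)) = (1 + T\<^sup>2) / (T - z) - T"
    using q by (simp add: right_diff_distrib add.commute)
  also have "\<dots> = (1 + T * z) / (T - z)"
    using Tz by (simp add: field_simps power2_eq_square)
  finally show ?thesis using 1 by (simp add: T_def)
qed

text \<open>The half plane version follows by the Cayley transform. The mass at the boundary point one of the
  disc, which corresponds to infinity, becomes the linear coefficient.\<close>

theorem herglotz_representation:
  assumes G: "herglotz G"
  obtains a b \<mu> where "b \<ge> 0" "herglotz_measure \<mu>" "\<And>z. Im z > 0 \<Longrightarrow> G z = herglotz_rep a b \<mu> z"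
proof -
  let ?e = unit_point
  have Gh: "G holomorphic_on {z. Im z > 0}" and Gp: "\<And>z. Im z > 0 \<Longrightarrow> Im (G z) > 0"
    using G by (auto simp: herglotz_def upper_half_plane_def)
  define f where "f w = - \<i> * G (\<i> * ((1 + w) / (1 - w)))" for w
  have im: "Im (\<i> * ((1 + w) / (1 - w))) > 0" if "norm w < 1" for w
  proof -
    have w1: "w \<noteq> 1" using that by auto
    have "(norm w)\<^sup>2 < 1" using that by (simp add: power_less_one_iff)
    then show ?thesis unfolding Im_i_times using Re_cayley[OF w1] w1 by simp
  qed
  have fh: "f holomorphic_on ball 0 1"
    unfolding f_def
  proof (intro holomorphic_intros)
    have "(\<lambda>w. \<i> * ((1 + w) / (1 - w))) holomorphic_on ball 0 1"
      by (intro holomorphic_intros) auto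
    moreover have "(\<lambda>w. \<i> * ((1 + w) / (1 - w))) ` ball 0 1 \<subseteq> {z. Im z > 0}"
      using im by (intro image_subsetI) (simp only: mem_ball_0 mem_Collect_eq)
    ultimately show "(\<lambda>w. G (\<i> * ((1 + w) / (1 - w)))) holomorphic_on ball 0 1"
      using holomorphic_on_compose_gen[OF _ Gh] by (simp only: o_def)
  qed
  have fp: "Re (f w) > 0" if "norm w < 1" for w
    using Gp[OF im[OF that]] by (simp add: f_def)
  define c where "c = Re (f 0)"
  have c: "c > 0" unfolding c_def by (rule fp) simp
  obtain M where M: "real_distribution M" and rep: "\<And>w. norm w < 1 \<Longrightarrow> f w = \<i> * of_real (Im (f 0)) +
       of_real c * (LINT x|M. (?e x + w) / (?e x - w))"
    using herglotz_representation_disc[OF fh fp] unfolding c_def by metis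
  interpret M: real_distribution M by fact
  \<comment> \<open>The point of the real line that corresponds to the boundary point of the disc. At the boundary point
    one the quotient has the conventional value zero, and the density below removes it.\<close>
  define T where "T x = Re (\<i> * (1 + ?e x) / (1 - ?e x))" for x
  have em [measurable]: "?e \<in> borel_measurable borel"
    by (intro borel_measurable_continuous_onI continuous_intros)
  have Tm [measurable]: "T \<in> borel_measurable borel"
    unfolding T_def by measurable
  define g where "g x = c * (1 + (T x)\<^sup>2) * (if ?e x = 1 then 0 else 1)" for x
  have gm [measurable]: "g \<in> borel_measurable borel"
    unfolding g_def by measurable
  have g0: "g x \<ge> 0" for x using c by (simp add: g_def)
  define \<mu> where "\<mu> = distr (density M (\<lambda>x. ennreal (g x))) borel T"
  define b where "b = c * measure M {x. ?e x = 1}"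
  have b: "b \<ge> 0" using c by (simp add: b_def)
  have hm: "herglotz_measure \<mu>"
    unfolding herglotz_measure_def
  proof
    show "sets \<mu> = sets borel" by (simp add: \<mu>_def)
    have "(\<integral>\<^sup>+t. ennreal (1 / (t\<^sup>2 + 1)) \<partial>\<mu>) = (\<integral>\<^sup>+x. ennreal (g x) * ennreal (1 / ((T x)\<^sup>2 + 1)) \<partial>M)"
      unfolding \<mu>_def by (subst nn_integral_distr, measurable) (subst nn_integral_density, auto)
    also have "\<dots> \<le> (\<integral>\<^sup>+x. ennreal c \<partial>M)"
    proof (intro nn_integral_mono)
      fix x
      have "g x * (1 / ((T x)\<^sup>2 + 1)) \<le> c"
        using c add_nonneg_pos[of "(T x)\<^sup>2" 1] by (simp add: g_def add.commute)
      then show "ennreal (g x) * ennreal (1 / ((T x)\<^sup>2 + 1)) \<le> ennreal c"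
        using g0[of x] by (subst ennreal_mult[symmetric]) (auto intro!: ennreal_leI)
    qed
    also have "\<dots> < \<infinity>" using M.emeasure_space_1 by (simp add: ennreal_mult_less_top)
    finally show "(\<integral>\<^sup>+t. ennreal (1 / (t\<^sup>2 + 1)) \<partial>\<mu>) < \<infinity>" .
  qed
  show ?thesis
  proof (rule that[OF b hm])
    fix z assume z: "Im z > 0"
    define w where "w = (z - \<i>) / (z + \<i>)"
    have z0: "z + \<i> \<noteq> 0" using z by (auto simp: complex_eq_iff)
    have w1: "norm w < 1"
    proof -
      have "(norm (z - \<i>))\<^sup>2 < (norm (z + \<i>))\<^sup>2"
        using z unfolding cmod_power2 by (simp add: power2_eq_square algebra_simps)
      then have "norm (z - \<i>) < norm (z + \<i>)" by (rule power2_less_imp_less) simp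
      then show ?thesis using z0 by (simp add: w_def norm_divide)
    qed
    have wne: "?e x - w \<noteq> 0" for x using w1 norm_unit_point[of x] by auto
    have p: "1 + w = 2 * z / (z + \<i>)" using z0 by (simp add: w_def field_simps)
    have m: "1 - w = 2 * \<i> / (z + \<i>)" using z0 by (simp add: w_def field_simps)
    have zw: "\<i> * ((1 + w) / (1 - w)) = z" unfolding p m using z0 by simp
    have Gz: "G z = \<i> * f w" unfolding f_def zw by simp
    let ?k = "\<lambda>t. 1 / (of_real t - z) - of_real (t / (t\<^sup>2 + 1))"
    let ?K = "\<lambda>x. \<i> * ((?e x + w) / (?e x - w))"
    have K1: "?K x = z" if "?e x = 1" for x using zw that by simp
    have K2: "of_real c * ?K x = of_real (g x) * ?k (T x)" if "?e x \<noteq> 1" for x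
      unfolding w_def cayley_kernel[OF norm_unit_point that z] by (simp add: g_def T_def that mult.assoc)
    have Kb: "norm (?K x) \<le> 2 / (1 - norm w)" for x
    proof -
      have "norm (?e x + w) \<le> 2" using norm_triangle_ineq[of "?e x" w] w1 by simp
      moreover have "norm (?e x - w) \<ge> 1 - norm w" using norm_triangle_ineq2[of "?e x" w] by simp
      ultimately show ?thesis using w1 unfolding norm_divide norm_mult by (auto intro!: frac_le)
    qed
    have Km [measurable]: "?K \<in> borel_measurable borel" by measurable
    have Kint: "integrable M ?K"
      by (rule M.integrable_const_bound[where B="2 / (1 - norm w)"]) (use Kb in auto)
    have split: "of_real c * ?K x = of_real (indicator {x. ?e x = 1} x) * (of_real c * z) + of_real (g x) * ?k (T x)" for x
    proof (cases "?e x = 1")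
      case True then show ?thesis using K1[OF True] by (simp add: g_def)
    next
      case False then show ?thesis using K2[OF False] by simp
    qed
    have i1: "integrable M (\<lambda>x. of_real (indicator {x. ?e x = 1} x) * (of_real c * z))"
      by (rule M.integrable_const_bound[where B="norm (of_real c * z)"]) (auto simp: indicator_def)
    have i2: "integrable M (\<lambda>x. of_real (g x) * ?k (T x))"
    proof -
      have "integrable M (\<lambda>x. of_real c * ?K x - of_real (indicator {x. ?e x = 1} x) * (of_real c * z))"
        by (intro Bochner_Integration.integrable_diff i1 integrable_mult_right Kint)
      then show ?thesis unfolding split by simp
    qed
    have "of_real c * (LINT x|M. ?K x) = (LINT x|M. of_real (indicator {x. ?e x = 1} x) * (of_real c * z) + of_real (g x) * ?k (T x))"
      unfolding split[symmetric] by (rule integral_mult_right_zero[symmetric])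
    also have "\<dots> = (LINT x|M. of_real (indicator {x. ?e x = 1} x) * (of_real c * z)) + (LINT x|M. of_real (g x) * ?k (T x))"
      by (rule Bochner_Integration.integral_add[OF i1 i2])
    also have "(LINT x|M. of_real (indicator {x. ?e x = 1} x) * (of_real c * z)) = of_real b * z"
      by (simp add: b_def integral_complex_of_real)
    also have "(LINT x|M. of_real (g x) * ?k (T x)) = (LINT t|\<mu>. ?k t)"
      unfolding \<mu>_def using g0
      by (subst integral_distr, measurable) (subst integral_density, auto simp: scaleR_conv_of_real)
    finally have main: "of_real c * (LINT x|M. ?K x) = of_real b * z + (LINT t|\<mu>. ?k t)" .
    have "G z = of_real (- Im (f 0)) + of_real c * (LINT x|M. ?K x)"
      unfolding Gz rep[OF w1] integral_mult_right_zero by (simp add: algebra_simps)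
    then show "G z = herglotz_rep (- Im (f 0)) b \<mu> z"
      unfolding main herglotz_rep_def by simp
  qed
qed

section \<open>Cauchy transforms\<close>

definition herglotz_kernel :: "real \<Rightarrow> complex \<Rightarrow> complex" where
  "herglotz_kernel t z = 1 / (of_real t - z) - of_real (t / (t\<^sup>2 + 1))"

definition cauchy_transform :: "real measure \<Rightarrow> (real \<Rightarrow> real) \<Rightarrow> complex \<Rightarrow> complex" where
  "cauchy_transform m f z = (LINT t|m. of_real (f t) * herglotz_kernel t z)"

lemma herglotz_rep_cauchy_transform:
  "herglotz_rep a b m z = of_real a + of_real b * z + cauchy_transform m (\<lambda>_. 1) z"
  by (simp add: herglotz_rep_def cauchy_transform_def herglotz_kernel_def)

text \<open>This form shows that the kernel is of order \<open>1 / (t\<^sup>2 + 1)\<close>, uniformly for \<open>t\<close> at a fixed positive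
  distance from \<open>z\<close>.\<close>

lemma herglotz_kernel_alt:
  assumes "of_real t \<noteq> z"
  shows "herglotz_kernel t z = (z + (1 + z\<^sup>2) / (of_real t - z)) / of_real (t\<^sup>2 + 1)"
proof -
  define T where "T = (of_real t :: complex)"
  have "t\<^sup>2 + 1 > 0" by (simp add: add_nonneg_pos)
  then have "of_real (t\<^sup>2 + 1) \<noteq> (0::complex)" by (metis less_irrefl of_real_eq_0_iff)
  then have q: "T\<^sup>2 + 1 \<noteq> 0" by (simp add: T_def)
  have n: "T - z \<noteq> 0" using assms by (simp add: T_def)
  have "1 / (T - z) - T / (T\<^sup>2 + 1) = ((T\<^sup>2 + 1) / (T - z) - T) / (T\<^sup>2 + 1)"
    using q by (simp add: diff_divide_distrib)
  also have "(T\<^sup>2 + 1) / (T - z) - T = z + (1 + z\<^sup>2) / (T - z)"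
    using n by (simp add: field_simps power2_eq_square)
  finally show ?thesis by (simp add: herglotz_kernel_def T_def)
qed

lemma norm_herglotz_kernel_le:
  assumes "d > 0" "d \<le> norm (of_real t - z)"
  shows "norm (herglotz_kernel t z) \<le> (norm z + norm (1 + z\<^sup>2) / d) * (1 / (t\<^sup>2 + 1))"
proof -
  have ne: "of_real t \<noteq> z" using assms by auto
  have p: "t\<^sup>2 + 1 > 0" by (simp add: add_nonneg_pos)
  have "norm (z + (1 + z\<^sup>2) / (of_real t - z)) \<le> norm z + norm (1 + z\<^sup>2) / norm (of_real t - z)"
    using norm_triangle_ineq[of z "(1 + z\<^sup>2) / (of_real t - z)"] by (simp add: norm_divide)
  also have "\<dots> \<le> norm z + norm (1 + z\<^sup>2) / d"
    using assms less_le_trans[OF assms] by (intro add_left_mono divide_left_mono mult_pos_pos) auto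
  finally show ?thesis
    unfolding herglotz_kernel_alt[OF ne] norm_divide using p
    by (simp add: norm_of_real divide_right_mono del: of_real_add)
qed

lemma Im_le_norm_diff: "Im z \<le> norm (of_real t - z)"
  using abs_Im_le_cmod[of "of_real t - z"] by simp

lemma herglotz_kernel_measurable [measurable]: "(\<lambda>t. herglotz_kernel t z) \<in> borel_measurable borel"
  unfolding herglotz_kernel_def by measurable

lemma Im_herglotz_kernel:
  "Im (herglotz_kernel t (Complex x y)) = y / ((t - x)\<^sup>2 + y\<^sup>2)"
  by (simp add: herglotz_kernel_def Im_divide power2_eq_square)

lemma Re_herglotz_kernel:
  "Re (herglotz_kernel t (Complex x y)) = (t - x) / ((t - x)\<^sup>2 + y\<^sup>2) - t / (t\<^sup>2 + 1)"
  by (simp add: herglotz_kernel_def Re_divide power2_eq_square)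

lemma herglotz_kernel_ii: "herglotz_kernel t \<i> = \<i> * of_real (1 / (t\<^sup>2 + 1))"
proof -
  have "\<i> = Complex 0 1" by (simp add: complex_eq_iff)
  then have "Re (herglotz_kernel t \<i>) = 0" "Im (herglotz_kernel t \<i>) = 1 / (t\<^sup>2 + 1)"
    using Re_herglotz_kernel[of t 0 1] Im_herglotz_kernel[of t 0 1] by simp_all
  then show ?thesis by (simp add: complex_eq_iff)
qed

context herglotz_measure_space
begin

lemma integrable_bounded_mult_kernel:
  assumes f: "f \<in> borel_measurable borel" "\<And>t. \<bar>f t\<bar> \<le> C" and z: "Im z > 0"
  shows "integrable m (\<lambda>t. of_real (f t) * herglotz_kernel t z)"
proof (rule integrable_le_weight)
  show "(\<lambda>t. of_real (f t) * herglotz_kernel t z) \<in> borel_measurable borel" using f(1) by measurable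
  fix t
  have C: "0 \<le> C" using f(2)[of 0] by linarith
  have "norm (herglotz_kernel t z) \<le> (norm z + norm (1 + z\<^sup>2) / Im z) * (1 / (t\<^sup>2 + 1))"
    by (rule norm_herglotz_kernel_le[OF z Im_le_norm_diff])
  then have "norm (of_real (f t) * herglotz_kernel t z) \<le> C * ((norm z + norm (1 + z\<^sup>2) / Im z) * (1 / (t\<^sup>2 + 1)))"
    unfolding norm_mult using f(2)[of t] C by (intro mult_mono) auto
  then show "norm (of_real (f t) * herglotz_kernel t z) \<le> (C * (norm z + norm (1 + z\<^sup>2) / Im z)) * (1 / (t\<^sup>2 + 1))"
    by (simp add: mult.assoc)
qed

lemma integrable_bounded_mult_poisson_kernel:
  assumes f: "f \<in> borel_measurable borel" "\<And>t. \<bar>f t\<bar> \<le> (C::real)" and y: "y > 0"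
  shows "integrable m (\<lambda>t. f t * (y / ((t - x)\<^sup>2 + y\<^sup>2)))"
proof (rule Bochner_Integration.integrable_bound)
  show "integrable m (\<lambda>t. C * (y / ((t - x)\<^sup>2 + y\<^sup>2)))" by (intro integrable_mult_right integrable_kernel y)
  show "(\<lambda>t. f t * (y / ((t - x)\<^sup>2 + y\<^sup>2))) \<in> borel_measurable m" using f(1) by measurable
  have "norm (f t * (y / ((t - x)\<^sup>2 + y\<^sup>2))) \<le> norm (C * (y / ((t - x)\<^sup>2 + y\<^sup>2)))" for t
    unfolding norm_mult using f(2)[of t] by (intro mult_right_mono) auto
  then show "AE t in m. norm (f t * (y / ((t - x)\<^sup>2 + y\<^sup>2))) \<le> norm (C * (y / ((t - x)\<^sup>2 + y\<^sup>2)))" by simp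
qed

lemma Im_cauchy_transform:
  assumes f: "f \<in> borel_measurable borel" "\<And>t. \<bar>f t\<bar> \<le> C" and y: "y > 0"
  shows "Im (cauchy_transform m f (Complex x y)) = (LINT t|m. f t * (y / ((t - x)\<^sup>2 + y\<^sup>2)))"
proof -
  have "Im (cauchy_transform m f (Complex x y)) = (LINT t|m. Im (of_real (f t) * herglotz_kernel t (Complex x y)))"
    unfolding cauchy_transform_def using integrable_bounded_mult_kernel[OF f, of "Complex x y"] y
    by (intro integral_Im[symmetric]) simp
  then show ?thesis by (simp add: Im_herglotz_kernel)
qed

lemma Re_cauchy_transform:
  assumes f: "f \<in> borel_measurable borel" "\<And>t. \<bar>f t\<bar> \<le> C" and y: "y > 0"
  shows "Re (cauchy_transform m f (Complex x y)) = (LINT t|m. f t * ((t - x) / ((t - x)\<^sup>2 + y\<^sup>2) - t / (t\<^sup>2 + 1)))"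
proof -
  have "Re (cauchy_transform m f (Complex x y)) = (LINT t|m. Re (of_real (f t) * herglotz_kernel t (Complex x y)))"
    unfolding cauchy_transform_def using integrable_bounded_mult_kernel[OF f, of "Complex x y"] y
    by (intro integral_Re[symmetric]) simp
  then show ?thesis by (simp add: Re_herglotz_kernel)
qed

lemma cauchy_transform_add:
  assumes "f \<in> borel_measurable borel" "\<And>t. \<bar>f t\<bar> \<le> C" "h \<in> borel_measurable borel" "\<And>t. \<bar>h t\<bar> \<le> D" "Im z > 0"
  shows "cauchy_transform m (\<lambda>t. f t + h t) z = cauchy_transform m f z + cauchy_transform m h z"
  unfolding cauchy_transform_def of_real_add distrib_right
  by (rule Bochner_Integration.integral_add[OF integrable_bounded_mult_kernel[OF assms(1,2,5)] integrable_bounded_mult_kernel[OF assms(3,4,5)]])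

lemma cauchy_transform_diff:
  assumes "f \<in> borel_measurable borel" "\<And>t. \<bar>f t\<bar> \<le> C" "h \<in> borel_measurable borel" "\<And>t. \<bar>h t\<bar> \<le> D" "Im z > 0"
  shows "cauchy_transform m (\<lambda>t. f t - h t) z = cauchy_transform m f z - cauchy_transform m h z"
  unfolding cauchy_transform_def of_real_diff left_diff_distrib
  by (rule Bochner_Integration.integral_diff[OF integrable_bounded_mult_kernel[OF assms(1,2,5)] integrable_bounded_mult_kernel[OF assms(3,4,5)]])

lemma cauchy_transform_cmult: "cauchy_transform m (\<lambda>t. c * f t) z = of_real c * cauchy_transform m f z"
  unfolding cauchy_transform_def of_real_mult mult.assoc by (rule integral_mult_right_zero)

lemma cauchy_transform_sum:
  assumes "finite J" "\<And>j. j \<in> J \<Longrightarrow> f j \<in> borel_measurable borel" "\<And>j t. j \<in> J \<Longrightarrow> \<bar>f j t\<bar> \<le> C" "Im z > 0"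
  shows "cauchy_transform m (\<lambda>t. \<Sum>j\<in>J. f j t) z = (\<Sum>j\<in>J. cauchy_transform m (f j) z)"
  unfolding cauchy_transform_def of_real_sum sum_distrib_right
  by (rule Bochner_Integration.integral_sum) (intro integrable_bounded_mult_kernel[where C=C] assms)

text \<open>The difference quotients of the kernel are products of two resolvents, dominated by a multiple of
  \<open>1 / (t\<^sup>2 + 1)\<close>, so differentiation under the integral sign is permitted.\<close>

lemma holomorphic_cauchy_transform:
  assumes f: "f \<in> borel_measurable borel" "\<And>t. \<bar>f t\<bar> \<le> C"
  shows "cauchy_transform m f holomorphic_on {z. Im z > 0}"
proof -
  let ?F = "cauchy_transform m f"
  have C: "0 \<le> C" using f(2)[of 0] by linarith
  have "(?F has_field_derivative (LINT t|m. of_real (f t) * (1 / ((of_real t - z) * (of_real t - z))))) (at z)"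
    if z: "Im z > 0" for z
    unfolding has_field_derivative_iff tendsto_at_iff_sequentially
  proof (intro allI impI)
    fix X assume X: "\<forall>i. X i \<in> UNIV - {z}" and Xz: "X \<longlonglongrightarrow> z"
    have "\<forall>\<^sub>F n in sequentially. dist (X n) z < Im z / 2"
      using Xz z by (intro tendstoD) auto
    then obtain n0 where n0: "\<And>n. n \<ge> n0 \<Longrightarrow> dist (X n) z < Im z / 2"
      by (auto simp: eventually_sequentially)
    define Y where "Y n = X (n + n0)" for n
    have Y: "norm (Y n - z) < Im z / 2" "Y n \<noteq> z" for n
      using n0[of "n + n0"] X by (auto simp: Y_def dist_norm)
    have Yz: "Y \<longlonglongrightarrow> z" unfolding Y_def using Xz by (rule LIMSEQ_ignore_initial_segment)
    have ImY: "Im (Y n) > 0" for n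
      using abs_Im_le_cmod[of "Y n - z"] Y(1)[of n] z by simp
    have tz: "of_real t \<noteq> z" for t using z by auto
    have tY: "of_real t \<noteq> Y n" for t n using ImY[of n] by (metis Im_complex_of_real less_irrefl)
    have quot: "(?F (Y n) - ?F z) / (Y n - z) = (LINT t|m. of_real (f t) * (1 / ((of_real t - Y n) * (of_real t - z))))" for n
    proof -
      have "?F (Y n) - ?F z = (LINT t|m. of_real (f t) * herglotz_kernel t (Y n) - of_real (f t) * herglotz_kernel t z)"
        unfolding cauchy_transform_def
        by (rule Bochner_Integration.integral_diff[symmetric]) (intro integrable_bounded_mult_kernel[OF f] ImY z)+
      also have "\<dots> = (LINT t|m. (Y n - z) * (of_real (f t) * (1 / ((of_real t - Y n) * (of_real t - z)))))"
      proof (rule Bochner_Integration.integral_cong[OF refl])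
        fix t
        have "1 / (of_real t - Y n) - 1 / (of_real t - z) = (Y n - z) / ((of_real t - Y n) * (of_real t - z))"
          using tz[of t] tY[of t n] by (subst diff_frac_eq) auto
        then have "herglotz_kernel t (Y n) - herglotz_kernel t z = (Y n - z) * (1 / ((of_real t - Y n) * (of_real t - z)))"
          by (simp add: herglotz_kernel_def)
        then show "of_real (f t) * herglotz_kernel t (Y n) - of_real (f t) * herglotz_kernel t z =
           (Y n - z) * (of_real (f t) * (1 / ((of_real t - Y n) * (of_real t - z))))"
          unfolding right_diff_distrib[symmetric] by (simp only: mult.left_commute)
      qed
      also have "\<dots> = (Y n - z) * (LINT t|m. of_real (f t) * (1 / ((of_real t - Y n) * (of_real t - z))))"
        by (rule integral_mult_right_zero)
      finally show ?thesis using Y(2)[of n] by simp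
    qed
    obtain x y where xy: "z = Complex x y" "y > 0" using z by (cases z) auto
    define K where "K = 2 * C * (2 + (2*x\<^sup>2+1)/y\<^sup>2)"
    have "(\<lambda>n. LINT t|m. of_real (f t) * (1 / ((of_real t - Y n) * (of_real t - z)))) \<longlonglongrightarrow>
        (LINT t|m. of_real (f t) * (1 / ((of_real t - z) * (of_real t - z))))"
    proof (rule integral_dominated_convergence[where w="\<lambda>t. K * (1 / (t\<^sup>2 + 1))"])
      show "integrable m (\<lambda>t. K * (1 / (t\<^sup>2 + 1)))" by (intro integrable_mult_right integrable_weight)
      show "AE t in m. (\<lambda>n. of_real (f t) * (1 / ((of_real t - Y n) * (of_real t - z)))) \<longlonglongrightarrow>
        of_real (f t) * (1 / ((of_real t - z) * (of_real t - z)))"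
        using tz by (intro always_eventually allI tendsto_intros Yz) auto
      have "norm (of_real (f t) * (1 / ((of_real t - Y n) * (of_real t - z)))) \<le> K * (1 / (t\<^sup>2 + 1))" for t n
      proof -
        have p: "t\<^sup>2 + 1 > 0" by (simp add: add_nonneg_pos)
        let ?r = "norm (of_real t - z)"
        have r: "?r > 0" using tz[of t] by simp
        have "norm (Y n - z) \<le> ?r / 2" using Y(1)[of n] Im_le_norm_diff[of z t] by simp
        then have h: "norm (of_real t - Y n) \<ge> ?r / 2"
          using norm_triangle_ineq2[of "of_real t - z" "Y n - z"] by simp
        have rr: "?r * ?r = (t - x)\<^sup>2 + y\<^sup>2"
          unfolding power2_eq_square[symmetric] cmod_power2 xy by simp
        have "norm (1 / ((of_real t - Y n) * (of_real t - z))) = 1 / (norm (of_real t - Y n) * ?r)"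
          by (simp add: norm_divide norm_mult)
        also have "\<dots> \<le> 1 / (?r / 2 * ?r)"
          using h r by (intro divide_left_mono mult_right_mono mult_pos_pos) auto
        also have "\<dots> = 2 * (1 / ((t - x)\<^sup>2 + y\<^sup>2))" unfolding rr[symmetric] by simp
        also have "1 / ((t - x)\<^sup>2 + y\<^sup>2) \<le> (2 + (2*x\<^sup>2+1)/y\<^sup>2) * (1 / (t\<^sup>2 + 1))"
          using sq_le_kernel[OF xy(2), of t x] kernel_pos[OF xy(2), of t x] p by (simp add: field_simps)
        finally have "norm (1 / ((of_real t - Y n) * (of_real t - z))) \<le> 2 * ((2 + (2*x\<^sup>2+1)/y\<^sup>2) * (1 / (t\<^sup>2 + 1)))"
          by simp
        then have "norm (of_real (f t) * (1 / ((of_real t - Y n) * (of_real t - z)))) \<le> C * (2 * ((2 + (2*x\<^sup>2+1)/y\<^sup>2) * (1 / (t\<^sup>2 + 1))))"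
          unfolding norm_mult using f(2)[of t] C by (intro mult_mono) auto
        then show ?thesis by (simp add: K_def mult_ac)
      qed
      then show "AE t in m. norm (of_real (f t) * (1 / ((of_real t - Y n) * (of_real t - z)))) \<le> K * (1 / (t\<^sup>2 + 1))" for n
        by simp
    qed (use f(1) in measurable)
    then have "(\<lambda>n. (?F (X (n + n0)) - ?F z) / (X (n + n0) - z)) \<longlonglongrightarrow>
        (LINT t|m. of_real (f t) * (1 / ((of_real t - z) * (of_real t - z))))"
      unfolding quot[unfolded Y_def, symmetric] Y_def .
    then have "(\<lambda>n. (?F (X n) - ?F z) / (X n - z)) \<longlonglongrightarrow>
        (LINT t|m. of_real (f t) * (1 / ((of_real t - z) * (of_real t - z))))"
      by (rule LIMSEQ_offset)
    then show "((\<lambda>w. (?F w - ?F z) / (w - z)) \<circ> X) \<longlonglongrightarrow>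
        (LINT t|m. of_real (f t) * (1 / ((of_real t - z) * (of_real t - z))))"
      by (simp add: o_def)
  qed
  moreover have "open {z. Im z > 0}" by (rule open_halfspace_Im_gt)
  ultimately show ?thesis by (subst holomorphic_on_open) auto
qed

lemma Im_herglotz_rep: "y > 0 \<Longrightarrow> Im (herglotz_rep a b m (Complex x y)) = b * y + poisson m x y"
  unfolding herglotz_rep_cauchy_transform poisson_def
  by (simp add: Im_cauchy_transform[where C=1])

lemma Im_herglotz_rep_ii: "Im (herglotz_rep a b m \<i>) = b + cauchy_mass m"
proof -
  have i: "\<i> = Complex 0 1" by (simp add: complex_eq_iff)
  show ?thesis unfolding i by (subst Im_herglotz_rep) (auto simp: poisson_def cauchy_mass_def)
qed

lemma holomorphic_herglotz_rep: "herglotz_rep a b m holomorphic_on {z. Im z > 0}"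
proof -
  have "(\<lambda>z. of_real a + of_real b * z + cauchy_transform m (\<lambda>_. 1) z) holomorphic_on {z. Im z > 0}"
    by (intro holomorphic_intros holomorphic_cauchy_transform[where C=1]) auto
  then show ?thesis by (simp add: herglotz_rep_cauchy_transform[abs_def])
qed

lemma poisson_density:
  assumes f: "f \<in> borel_measurable borel" "\<And>t. 0 \<le> f t"
  shows "poisson (density m (\<lambda>t. ennreal (f t))) x y = (LINT t|m. f t * (y / ((t - x)\<^sup>2 + y\<^sup>2)))"
  unfolding poisson_def using f by (subst integral_density) auto

lemma herglotz_measure_density:
  assumes f: "f \<in> borel_measurable borel" "\<And>t. 0 \<le> f t" "\<And>t. f t \<le> C"
  shows "herglotz_measure (density m (\<lambda>t. ennreal (f t)))"
proof -
  have "(\<integral>\<^sup>+t. ennreal (1 / (t\<^sup>2 + 1)) \<partial>density m (\<lambda>t. ennreal (f t))) = (\<integral>\<^sup>+t. ennreal (f t) * ennreal (1 / (t\<^sup>2 + 1)) \<partial>m)"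
    using f by (subst nn_integral_density) auto
  also have "\<dots> \<le> (\<integral>\<^sup>+t. ennreal C * ennreal (1 / (t\<^sup>2 + 1)) \<partial>m)"
    using f by (intro nn_integral_mono mult_right_mono ennreal_leI) auto
  also have "\<dots> = ennreal C * ennreal (cauchy_mass m)"
    unfolding nn_weight[symmetric] by (rule nn_integral_cmult) measurable
  also have "\<dots> < \<infinity>" by (simp add: ennreal_mult_less_top)
  finally show ?thesis by (simp add: herglotz_measure_def)
qed

lemma cauchy_mass_density:
  assumes f: "f \<in> borel_measurable borel" "\<And>t. 0 \<le> f t"
  shows "cauchy_mass (density m (\<lambda>t. ennreal (f t))) = (LINT t|m. f t * (1 / (t\<^sup>2 + 1)))"
  unfolding cauchy_mass_def using f by (subst integral_density) auto

end

section \<open>Quotients of Cauchy transforms\<close>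

locale herglotz_function = herglotz_measure_space m for m :: "real measure" +
  fixes a b :: real
  assumes b_nonneg: "b \<ge> 0"
    and Im_pos: "\<And>z. Im z > 0 \<Longrightarrow> Im (herglotz_rep a b m z) > 0"
begin

abbreviation F :: "complex \<Rightarrow> complex" where
  "F \<equiv> herglotz_rep a b m"

definition cauchy_ratio :: "(real \<Rightarrow> real) \<Rightarrow> complex \<Rightarrow> complex" where
  "cauchy_ratio f z = cauchy_transform m f z / F z"

lemma F_nonzero: "Im z > 0 \<Longrightarrow> F z \<noteq> 0"
  using Im_pos[of z] by auto

text \<open>The Schur complement of the first diagonal entry in the matrix of the Cauchy transforms of
  \<open>m\<close>, \<open>f m\<close> and \<open>f\<^sup>2 m\<close>. Since that matrix has a positive semidefinite imaginary part, so has its Schur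
  complement.\<close>

definition schur_complement :: "(real \<Rightarrow> real) \<Rightarrow> complex \<Rightarrow> complex" where
  "schur_complement f z = cauchy_transform m (\<lambda>t. (f t)\<^sup>2) z - (cauchy_transform m f z)\<^sup>2 / F z"

text \<open>With \<open>g\<close> for the quotient, the function equals \<open>F\<^bsub>f\<^sup>2\<^esub> - 2 (Re g) F\<^sub>f + \<bar>g\<bar>\<^sup>2 F\<close> because
  \<open>F\<^sub>f = g F\<close>; the coefficients are real, so the imaginary part can be taken termwise. The
  integrand is \<open>\<bar>f t - g\<bar>\<^sup>2\<close> times the Poisson kernel.\<close>

lemma Im_schur_complement:
  fixes x y :: real
  assumes f: "f \<in> borel_measurable borel" "\<And>t. \<bar>f t\<bar> \<le> C" and y: "y > 0"
  defines "z \<equiv> Complex x y"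
  defines "g \<equiv> cauchy_ratio f z"
  shows "Im (schur_complement f z) =
    (LINT t|m. ((f t)\<^sup>2 - 2 * Re g * f t + (norm g)\<^sup>2) * (y / ((t - x)\<^sup>2 + y\<^sup>2))) + (norm g)\<^sup>2 * (b * y)"
proof -
  have z: "Im z > 0" using y by (simp add: z_def)
  have C: "0 \<le> C" using f(2)[of 0] by linarith
  have f2: "(\<lambda>t. (f t)\<^sup>2) \<in> borel_measurable borel" using f(1) by measurable
  have f2b: "\<bar>(f t)\<^sup>2\<bar> \<le> C\<^sup>2" for t
    using power_mono[OF f(2)[of t], of 2] by simp
  let ?k = "\<lambda>t. y / ((t - x)\<^sup>2 + y\<^sup>2)"
  let ?F1 = "cauchy_transform m f z"
  have F1: "?F1 = g * F z" using F_nonzero[OF z] by (simp add: g_def cauchy_ratio_def)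
  have "?F1\<^sup>2 / F z = g * ?F1" unfolding F1 using F_nonzero[OF z] by (simp add: power2_eq_square)
  also have "\<dots> = of_real (2 * Re g) * ?F1 - cnj g * ?F1"
  proof -
    have "g = of_real (2 * Re g) - cnj g" by (simp add: complex_eq_iff)
    then show ?thesis by (metis left_diff_distrib)
  qed
  also have "cnj g * ?F1 = of_real ((norm g)\<^sup>2) * F z"
  proof -
    have "cnj g * g = of_real ((norm g)\<^sup>2)" by (metis complex_norm_square mult.commute)
    then show ?thesis unfolding F1 mult.assoc[symmetric] by simp
  qed
  finally have "Im (schur_complement f z) = Im (cauchy_transform m (\<lambda>t. (f t)\<^sup>2) z) - 2 * Re g * Im ?F1 + (norm g)\<^sup>2 * Im (F z)"
    by (simp add: schur_complement_def)
  also have "\<dots> = (LINT t|m. (f t)\<^sup>2 * ?k t) - 2 * Re g * (LINT t|m. f t * ?k t) + (norm g)\<^sup>2 * (b * y + (LINT t|m. ?k t))"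
    unfolding z_def Im_herglotz_rep[OF y] poisson_def Im_cauchy_transform[OF f y] Im_cauchy_transform[OF f2 f2b y] ..
  also have "\<dots> = (LINT t|m. (f t)\<^sup>2 * ?k t - 2 * Re g * (f t * ?k t) + (norm g)\<^sup>2 * ?k t) + (norm g)\<^sup>2 * (b * y)"
  proof -
    note i = integrable_bounded_mult_poisson_kernel[OF f2 f2b y, of x] integrable_bounded_mult_poisson_kernel[OF f y, of x] integrable_kernel[OF y, of x]
    show ?thesis
      by (subst Bochner_Integration.integral_add Bochner_Integration.integral_diff integral_mult_right_zero;
          (intro Bochner_Integration.integrable_diff integrable_mult_right i)?)+ (simp add: algebra_simps)
  qed
  also have "(\<lambda>t. (f t)\<^sup>2 * ?k t - 2 * Re g * (f t * ?k t) + (norm g)\<^sup>2 * ?k t) = (\<lambda>t. ((f t)\<^sup>2 - 2 * Re g * f t + (norm g)\<^sup>2) * ?k t)"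
    by (simp only: left_diff_distrib distrib_right mult.assoc)
  finally show ?thesis .
qed

lemma norm_cauchy_ratio_poisson_le:
  fixes x y :: real
  assumes f: "f \<in> borel_measurable borel" "\<And>t. \<bar>f t\<bar> \<le> C" and y: "y > 0"
  defines "z \<equiv> Complex x y"
  shows "(norm (cauchy_ratio f z))\<^sup>2 * poisson m x y \<le>
     2 * Im (schur_complement f z) + 2 * poisson (density m (\<lambda>t. ennreal ((f t)\<^sup>2))) x y"
    and "Im (schur_complement f z) \<ge> 0"
proof -
  let ?k = "\<lambda>t. y / ((t - x)\<^sup>2 + y\<^sup>2)"
  define g where "g = cauchy_ratio f z"
  have f2: "(\<lambda>t. (f t)\<^sup>2) \<in> borel_measurable borel" using f(1) by measurable
  have f2b: "\<bar>(f t)\<^sup>2\<bar> \<le> C\<^sup>2" for t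
    using power_mono[OF f(2)[of t], of 2] by simp
  define q where "q t = (f t)\<^sup>2 - 2 * Re g * f t + (norm g)\<^sup>2" for t
  have im: "Im (schur_complement f z) = (LINT t|m. q t * ?k t) + (norm g)\<^sup>2 * (b * y)"
    unfolding z_def g_def q_def by (rule Im_schur_complement[OF f y])
  have k0: "?k t \<ge> 0" for t using y by simp
  have ng: "(Re g)\<^sup>2 \<le> (norm g)\<^sup>2" by (simp add: cmod_power2)
  have q0: "q t \<ge> 0" for t
  proof -
    have "0 \<le> (f t - Re g)\<^sup>2" by simp
    also have "\<dots> \<le> q t" using ng by (simp add: q_def power2_diff)
    finally show ?thesis .
  qed
  have q1: "(norm g)\<^sup>2 / 2 - (f t)\<^sup>2 \<le> q t" for t
  proof -
    have "0 \<le> (Re g - 2 * f t)\<^sup>2" by simp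
    also have "\<dots> \<le> 2 * (q t - ((norm g)\<^sup>2 / 2 - (f t)\<^sup>2))"
      using ng by (simp add: q_def power2_diff)
    finally show ?thesis by simp
  qed
  have b0: "(norm g)\<^sup>2 * (b * y) \<ge> 0" using b_nonneg y by simp
  have "(LINT t|m. q t * ?k t) \<ge> 0" using mult_nonneg_nonneg[OF q0 k0] by (intro integral_nonneg_AE always_eventually allI)
  then show "Im (schur_complement f z) \<ge> 0" using im b0 by simp
  have qk: "integrable m (\<lambda>t. q t * ?k t)"
  proof (rule integrable_bounded_mult_poisson_kernel[OF _ _ y])
    show "q \<in> borel_measurable borel" unfolding q_def using f(1) by measurable
    fix t
    have "\<bar>2 * Re g * f t\<bar> \<le> \<bar>2 * Re g\<bar> * C" unfolding abs_mult using f(2)[of t] by (intro mult_left_mono) auto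
    then show "\<bar>q t\<bar> \<le> C\<^sup>2 + \<bar>2 * Re g\<bar> * C + (norm g)\<^sup>2" unfolding q_def using f2b[of t] zero_le_power2[of "f t"] zero_le_power2[of "norm g"]
      by (simp only: abs_le_iff) linarith
  qed
  have "(LINT t|m. (norm g)\<^sup>2 / 2 * ?k t - (f t)\<^sup>2 * ?k t) \<le> (LINT t|m. q t * ?k t)"
  proof (rule integral_mono)
    show "integrable m (\<lambda>t. (norm g)\<^sup>2 / 2 * ?k t - (f t)\<^sup>2 * ?k t)"
      by (intro Bochner_Integration.integrable_diff integrable_mult_right integrable_kernel y integrable_bounded_mult_poisson_kernel[OF f2 f2b])
    show "(norm g)\<^sup>2 / 2 * ?k t - (f t)\<^sup>2 * ?k t \<le> q t * ?k t" for t
      unfolding left_diff_distrib[symmetric] using q1 k0 by (intro mult_right_mono) auto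
  qed (rule qk)
  also have "(LINT t|m. (norm g)\<^sup>2 / 2 * ?k t - (f t)\<^sup>2 * ?k t) = (LINT t|m. (norm g)\<^sup>2 / 2 * ?k t) - (LINT t|m. (f t)\<^sup>2 * ?k t)"
    by (intro Bochner_Integration.integral_diff integrable_mult_right integrable_kernel y integrable_bounded_mult_poisson_kernel[OF f2 f2b])
  also have "(LINT t|m. (norm g)\<^sup>2 / 2 * ?k t) = (norm g)\<^sup>2 / 2 * poisson m x y"
    unfolding poisson_def by (rule integral_mult_right_zero)
  also have "(LINT t|m. (f t)\<^sup>2 * ?k t) = poisson (density m (\<lambda>t. ennreal ((f t)\<^sup>2))) x y"
    by (rule poisson_density[symmetric, OF f2]) simp
  finally show "(norm (cauchy_ratio f z))\<^sup>2 * poisson m x y \<le>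
     2 * Im (schur_complement f z) + 2 * poisson (density m (\<lambda>t. ennreal ((f t)\<^sup>2))) x y"
    using im b0 unfolding g_def[symmetric] by simp
qed

lemma holomorphic_schur_complement:
  assumes f: "f \<in> borel_measurable borel" "\<And>t. \<bar>f t\<bar> \<le> C"
  shows "schur_complement f holomorphic_on {z. Im z > 0}"
proof -
  have f2: "(\<lambda>t. (f t)\<^sup>2) \<in> borel_measurable borel" using f(1) by measurable
  have f2b: "\<bar>(f t)\<^sup>2\<bar> \<le> C\<^sup>2" for t
    using power_mono[OF f(2)[of t], of 2] by simp
  have "(\<lambda>z. cauchy_transform m (\<lambda>t. (f t)\<^sup>2) z - (cauchy_transform m f z)\<^sup>2 / F z) holomorphic_on {z. Im z > 0}"
    using F_nonzero by (intro holomorphic_intros holomorphic_cauchy_transform[OF f] holomorphic_cauchy_transform[OF f2 f2b] holomorphic_herglotz_rep) auto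
  then show ?thesis by (simp add: schur_complement_def[abs_def])
qed

text \<open>At \<open>\<i>\<close> the Cauchy transform of a real function is purely imaginary, so the subtracted square
  contributes with the right sign.\<close>

lemma Im_schur_complement_ii_le:
  assumes f: "f \<in> borel_measurable borel" "\<And>t. \<bar>f t\<bar> \<le> C"
  shows "Im (schur_complement f \<i>) \<le> (LINT t|m. (f t)\<^sup>2 * (1 / (t\<^sup>2 + 1)))"
proof -
  have f2: "(\<lambda>t. (f t)\<^sup>2) \<in> borel_measurable borel" using f(1) by measurable
  have f2b: "\<bar>(f t)\<^sup>2\<bar> \<le> C\<^sup>2" for t
    using power_mono[OF f(2)[of t], of 2] by simp
  have ii: "\<i> = Complex 0 1" by (simp add: complex_eq_iff)
  define A where "A = (LINT t|m. f t * (1 / (t\<^sup>2 + 1)))"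
  have "cauchy_transform m f \<i> = (LINT t|m. \<i> * of_real (f t * (1 / (t\<^sup>2 + 1))))"
    unfolding cauchy_transform_def herglotz_kernel_ii by (intro Bochner_Integration.integral_cong) auto
  also have "\<dots> = \<i> * (LINT t|m. of_real (f t * (1 / (t\<^sup>2 + 1))))" by (rule integral_mult_right_zero)
  also have "\<dots> = \<i> * of_real A" unfolding A_def by (simp only: integral_complex_of_real)
  finally have "(cauchy_transform m f \<i>)\<^sup>2 = - of_real (A\<^sup>2)" by (simp add: power_mult_distrib)
  then have "Im (schur_complement f \<i>) = Im (cauchy_transform m (\<lambda>t. (f t)\<^sup>2) \<i>) + Im (of_real (A\<^sup>2) / F \<i>)"
    by (simp add: schur_complement_def)
  also have "Im (of_real (A\<^sup>2) / F \<i>) \<le> 0"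
    using Im_pos[of \<i>] by (auto simp: Im_divide intro!: divide_nonpos_nonneg mult_nonneg_nonneg)
  also have "Im (cauchy_transform m (\<lambda>t. (f t)\<^sup>2) \<i>) = (LINT t|m. (f t)\<^sup>2 * (1 / (t\<^sup>2 + 1)))"
    unfolding ii by (subst Im_cauchy_transform[OF f2 f2b]) auto
  finally show ?thesis by simp
qed

text \<open>The weak type bound for the quotient. The Schur complement controls \<open>\<bar>g\<bar>\<^sup>2\<close> times the Poisson
  integral of \<open>m\<close>, up to the Poisson integral of \<open>f\<^sup>2 m\<close>, and its own representing measure has total
  weight at most the weighted integral of \<open>f\<^sup>2\<close>, as its value at \<open>\<i>\<close> shows. So the local maximal
  inequality applies to both.\<close>

lemma cauchy_ratio_maximal:
  assumes f: "f \<in> borel_measurable borel" "\<And>t. \<bar>f t\<bar> \<le> C"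
    and e: "e > 0" "(LINT t|m. (f t)\<^sup>2 * (1 / (t\<^sup>2 + 1))) \<le> e" and d: "d > 0" and R: "R > 0"
  obtains B where "open B" "emeasure m B \<le> ennreal (6 * (R\<^sup>2 + 1) * e / d)"
    "\<And>x. x \<in> {-R<..<R} \<Longrightarrow> x \<notin> B \<Longrightarrow> poisson_dominates m x \<Longrightarrow>
       \<forall>\<^sub>F y in at_right 0. (norm (cauchy_ratio f (Complex x y)))\<^sup>2 \<le> 8 * d"
proof -
  have C: "0 \<le> C" using f(2)[of 0] by linarith
  have f2: "(\<lambda>t. (f t)\<^sup>2) \<in> borel_measurable borel" using f(1) by measurable
  have f2b: "(f t)\<^sup>2 \<le> C\<^sup>2" for t
    using power_mono[OF f(2)[of t], of 2] by simp
  \<comment> \<open>The Schur complement may vanish identically; adding a small imaginary constant puts its values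
    into the open half plane.\<close>
  define H where "H z = schur_complement f z + \<i> * of_real e" for z
  have SIm: "Im (schur_complement f z) \<ge> 0" if "Im z > 0" for z
    using norm_cauchy_ratio_poisson_le(2)[OF f that, of "Re z"] by simp
  have "herglotz H"
    unfolding herglotz_def
  proof
    show "H holomorphic_on upper_half_plane"
      unfolding H_def upper_half_plane_def by (intro holomorphic_intros holomorphic_schur_complement[OF f])
    show "H ` upper_half_plane \<subseteq> upper_half_plane"
      using SIm e(1) by (auto simp: H_def upper_half_plane_def add_nonneg_pos)
  qed
  then obtain a' b' m' where m': "b' \<ge> 0" "herglotz_measure m'" "\<And>z. Im z > 0 \<Longrightarrow> H z = herglotz_rep a' b' m' z"
    using herglotz_representation by metis
  interpret m': herglotz_measure_space m' using m'(2) by unfold_locales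
  define mf where "mf = density m (\<lambda>t. ennreal ((f t)\<^sup>2))"
  have mf: "herglotz_measure mf" unfolding mf_def by (rule herglotz_measure_density[OF f2 _ f2b]) simp
  interpret mf: herglotz_measure_space mf using mf by unfold_locales
  have cmf: "cauchy_mass mf \<le> e"
    unfolding mf_def using cauchy_mass_density[OF f2] e(2) by simp
  have "b' + cauchy_mass m' = Im (H \<i>)" using m'(3)[of \<i>] m'.Im_herglotz_rep_ii by simp
  also have "\<dots> \<le> 2 * e" using Im_schur_complement_ii_le[OF f] e(2) by (simp add: H_def)
  finally have cm': "cauchy_mass m' \<le> 2 * e" using m'(1) by simp
  define V where "V = {-R<..<R}"
  have V: "open V" "V \<in> sets borel" "V \<subseteq> {-R..R}" by (auto simp: V_def)
  obtain B1 where B1: "open B1" "ennreal d * emeasure m B1 \<le> 2 * emeasure m' V"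
    "\<And>x c. x \<in> V \<Longrightarrow> x \<notin> B1 \<Longrightarrow> poisson_dominates m x \<Longrightarrow>
       \<forall>\<^sub>F y in at_right 0. poisson m' x y + c * y \<le> 2 * d * poisson m x y"
    using poisson_local_maximal[OF m'(2) hm V(1) d] by metis
  obtain B2 where B2: "open B2" "ennreal d * emeasure m B2 \<le> 2 * emeasure mf V"
    "\<And>x c. x \<in> V \<Longrightarrow> x \<notin> B2 \<Longrightarrow> poisson_dominates m x \<Longrightarrow>
       \<forall>\<^sub>F y in at_right 0. poisson mf x y + c * y \<le> 2 * d * poisson m x y"
    using poisson_local_maximal[OF mf hm V(1) d] by metis
  have two: "2 * ennreal u = ennreal (2 * u)" if "u \<ge> 0" for u
    using that by (simp add: ennreal_mult)
  have q: "R\<^sup>2 + 1 \<ge> 0" by simp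
  have e1: "emeasure m B1 \<le> ennreal (4 * (R\<^sup>2 + 1) * e / d)"
  proof (rule ennreal_mult_le_imp_le[OF _ d])
    have "emeasure m' V \<le> ennreal ((R\<^sup>2 + 1) * (2 * e))"
      using mult_left_mono[OF cm' q] by (intro order_trans[OF m'.emeasure_bounded_le_mass[OF V(2,3)]] ennreal_leI)
    then have "2 * emeasure m' V \<le> 2 * ennreal ((R\<^sup>2 + 1) * (2 * e))" by (rule mult_left_mono) simp
    also have "\<dots> = ennreal (4 * (R\<^sup>2 + 1) * e)" using q e(1) by (subst two) (auto simp: mult_ac)
    finally show "ennreal d * emeasure m B1 \<le> ennreal (4 * (R\<^sup>2 + 1) * e)" using B1(2) by (rule order_trans[rotated])
  qed
  have e2: "emeasure m B2 \<le> ennreal (2 * (R\<^sup>2 + 1) * e / d)"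
  proof (rule ennreal_mult_le_imp_le[OF _ d])
    have "emeasure mf V \<le> ennreal ((R\<^sup>2 + 1) * e)"
      using mult_left_mono[OF cmf q] by (intro order_trans[OF mf.emeasure_bounded_le_mass[OF V(2,3)]] ennreal_leI)
    then have "2 * emeasure mf V \<le> 2 * ennreal ((R\<^sup>2 + 1) * e)" by (rule mult_left_mono) simp
    also have "\<dots> = ennreal (2 * (R\<^sup>2 + 1) * e)" using q e(1) by (subst two) (auto simp: mult_ac)
    finally show "ennreal d * emeasure m B2 \<le> ennreal (2 * (R\<^sup>2 + 1) * e)" using B2(2) by (rule order_trans[rotated])
  qed
  show ?thesis
  proof (rule that)
    show "open (B1 \<union> B2)" using B1 B2 by auto
    have "emeasure m (B1 \<union> B2) \<le> emeasure m B1 + emeasure m B2"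
      using B1(1) B2(1) by (intro emeasure_subadditive) auto
    also have "\<dots> \<le> ennreal (4 * (R\<^sup>2 + 1) * e / d) + ennreal (2 * (R\<^sup>2 + 1) * e / d)"
      using e1 e2 by (rule add_mono)
    also have "\<dots> = ennreal (4 * (R\<^sup>2 + 1) * e / d + 2 * (R\<^sup>2 + 1) * e / d)"
      using q e(1) d by (intro ennreal_plus[symmetric] divide_nonneg_pos mult_nonneg_nonneg) auto
    also have "4 * (R\<^sup>2 + 1) * e / d + 2 * (R\<^sup>2 + 1) * e / d = 6 * (R\<^sup>2 + 1) * e / d"
      using d by (simp add: field_simps)
    finally show "emeasure m (B1 \<union> B2) \<le> ennreal (6 * (R\<^sup>2 + 1) * e / d)" .
    fix x assume x: "x \<in> {-R<..<R}" "x \<notin> B1 \<union> B2" and pd: "poisson_dominates m x"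
    have "\<forall>\<^sub>F y in at_right 0. poisson m' x y + b' * y \<le> 2 * d * poisson m x y"
      using x pd by (intro B1(3)) (auto simp: V_def)
    moreover have "\<forall>\<^sub>F y in at_right 0. poisson mf x y + 0 * y \<le> 2 * d * poisson m x y"
      using x pd by (intro B2(3)) (auto simp: V_def)
    moreover have "\<forall>\<^sub>F y in at_right 0. y \<le> 1 * poisson m x y"
      using pd unfolding poisson_dominates_def by (elim allE[of _ 1]) simp
    ultimately show "\<forall>\<^sub>F y in at_right 0. (norm (cauchy_ratio f (Complex x y)))\<^sup>2 \<le> 8 * d"
      using eventually_pos_at_right
    proof eventually_elim
      case (elim y)
      have "Im (schur_complement f (Complex x y)) \<le> Im (H (Complex x y))" using e(1) by (simp add: H_def)
      also have "\<dots> = b' * y + poisson m' x y" using m'(3)[of "Complex x y"] m'.Im_herglotz_rep[OF elim(4)] elim(4) by simp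
      finally have "(norm (cauchy_ratio f (Complex x y)))\<^sup>2 * poisson m x y \<le> (8 * d) * poisson m x y"
        using norm_cauchy_ratio_poisson_le(1)[OF f elim(4), of x] elim(1,2) unfolding mf_def[symmetric] by simp
      moreover have "poisson m x y > 0" using elim(3,4) by simp
      ultimately show ?case by simp
    qed
  qed
qed

end

lemma AE_density_imp:
  assumes "AE x in m. P x" "f \<in> borel_measurable m"
  shows "AE x in density m f. P x"
  using assms by (subst AE_density) auto

lemma eventually_affine_bounded:
  "\<forall>\<^sub>F y in at_right 0. norm (of_real c + of_real d * Complex x y) \<le> \<bar>c\<bar> + \<bar>d\<bar> * (\<bar>x\<bar> + 1)"
proof -
  have "\<forall>\<^sub>F y in at_right (0::real). y < 1" by (rule eventually_at_rightI[of 0 1]) auto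
  then show ?thesis
    using eventually_pos_at_right
  proof eventually_elim
    case (elim y)
    have "norm (Complex x y) \<le> \<bar>x\<bar> + 1" using cmod_le[of "Complex x y"] elim by simp
    then have "norm (of_real d * Complex x y) \<le> \<bar>d\<bar> * (\<bar>x\<bar> + 1)"
      unfolding norm_mult by (simp add: mult_left_mono)
    then show ?case using norm_triangle_ineq[of "of_real c" "of_real d * Complex x y"] by simp
  qed
qed

context herglotz_function
begin

text \<open>Almost every point of a Lebesgue null set is of this kind. There \<open>F\<close> tends to infinity, and terms
  of order \<open>O(y)\<close> are negligible against its imaginary part.\<close>

definition normal_point :: "real \<Rightarrow> bool" where
  "normal_point x \<longleftrightarrow> poisson_dominates m x \<and> filterlim (poisson m x) at_top (at_right 0)"

lemma AE_normal_point:
  assumes "N \<in> null_sets lborel"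
  shows "AE x in m. x \<in> N \<longrightarrow> normal_point x"
  using AE_poisson_dominates[OF hm] poisson_at_top_on_null_set[OF hm assms]
  by eventually_elim (simp add: normal_point_def)

lemma bounded_over_F_tendsto_0:
  assumes x: "normal_point x" and bnd: "\<forall>\<^sub>F y in at_right 0. norm (h y) \<le> C"
  shows "((\<lambda>y. h y / F (Complex x y)) \<longlongrightarrow> 0) (at_right 0)"
proof (rule Lim_null_comparison)
  have pt: "filterlim (poisson m x) at_top (at_right 0)" using x by (simp add: normal_point_def)
  then have "((\<lambda>y. \<bar>C\<bar> / poisson m x y) \<longlongrightarrow> 0) (at_right 0)"
    by (intro tendsto_divide_0[OF tendsto_const] filterlim_at_top_imp_at_infinity)
  then show "((\<lambda>y. \<bar>C\<bar> / poisson m x y) \<longlongrightarrow> 0) (at_right 0)" .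
  have "\<forall>\<^sub>F y in at_right 0. poisson m x y > 0"
    using pt by (auto simp: filterlim_at_top_dense)
  then show "\<forall>\<^sub>F y in at_right 0. norm (h y / F (Complex x y)) \<le> \<bar>C\<bar> / poisson m x y"
    using eventually_pos_at_right bnd
  proof eventually_elim
    case (elim y)
    have "poisson m x y \<le> Im (F (Complex x y))" using elim b_nonneg by (simp add: Im_herglotz_rep)
    also have "\<dots> \<le> norm (F (Complex x y))" using abs_Im_le_cmod[of "F (Complex x y)"] by simp
    finally show ?case unfolding norm_divide using elim by (intro frac_le) auto
  qed
qed

lemma cauchy_ratio_one_tendsto:
  assumes "normal_point x"
  shows "((\<lambda>y. cauchy_ratio (\<lambda>_. 1) (Complex x y)) \<longlongrightarrow> 1) (at_right 0)"
proof -
  from bounded_over_F_tendsto_0[OF assms eventually_affine_bounded[of a b x]]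
  have "((\<lambda>y. 1 - (of_real a + of_real b * Complex x y) / F (Complex x y)) \<longlongrightarrow> 1 - 0) (at_right 0)"
    by (intro tendsto_intros)
  then have "((\<lambda>y. 1 - (of_real a + of_real b * Complex x y) / F (Complex x y)) \<longlongrightarrow> 1) (at_right 0)" by simp
  moreover have "\<forall>\<^sub>F y in at_right 0. 1 - (of_real a + of_real b * Complex x y) / F (Complex x y) = cauchy_ratio (\<lambda>_. 1) (Complex x y)"
    using eventually_pos_at_right
  proof eventually_elim
    case (elim y)
    then have "F (Complex x y) \<noteq> 0" by (intro F_nonzero) simp
    then show ?case unfolding cauchy_ratio_def by (simp add: field_simps herglotz_rep_cauchy_transform)
  qed
  ultimately show ?thesis by (rule Lim_transform_eventually)
qed

lemma cauchy_ratio_local: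
  assumes x: "normal_point x" and U: "open U" "x \<in> U" and f: "f \<in> borel_measurable borel" "\<And>t. \<bar>f t\<bar> \<le> C"
    and van: "\<And>t. t \<in> U \<Longrightarrow> f t = 0"
  shows "((\<lambda>y. cauchy_ratio f (Complex x y)) \<longlongrightarrow> 0) (at_right 0)"
proof -
  have C: "0 \<le> C" using f(2)[of 0] by linarith
  obtain r where r: "r > 0" "ball x r \<subseteq> U" using U openE by blast
  define K where "K = (\<bar>x\<bar> + 1) + (1 + (\<bar>x\<bar> + 1)\<^sup>2) / r"
  have "\<forall>\<^sub>F y in at_right (0::real). y < 1" by (rule eventually_at_rightI[of 0 1]) auto
  then have "\<forall>\<^sub>F y in at_right 0. norm (cauchy_transform m f (Complex x y)) \<le> C * (K * cauchy_mass m)"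
    using eventually_pos_at_right
  proof eventually_elim
    case (elim y)
    let ?z = "Complex x y"
    have nz: "norm ?z \<le> \<bar>x\<bar> + 1" using cmod_le[of ?z] elim by simp
    have "norm (1 + ?z\<^sup>2) \<le> 1 + (norm ?z)\<^sup>2"
      using norm_triangle_ineq[of 1 "?z\<^sup>2"] by (simp add: norm_power)
    moreover have "(norm ?z)\<^sup>2 \<le> (\<bar>x\<bar> + 1)\<^sup>2" using nz by (intro power_mono) auto
    ultimately have nz2: "norm (1 + ?z\<^sup>2) \<le> 1 + (\<bar>x\<bar> + 1)\<^sup>2" by linarith
    have bnd: "norm (of_real (f t) * herglotz_kernel t ?z) \<le> C * (K * (1 / (t\<^sup>2 + 1)))" for t
    proof (cases "t \<in> U")
      case True
      then show ?thesis using van C r(1) by (simp add: K_def)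
    next
      case False
      then have "r \<le> \<bar>t - x\<bar>" using r(2) by (force simp: dist_real_def)
      also have "\<dots> \<le> norm (of_real t - ?z)" using abs_Re_le_cmod[of "of_real t - ?z"] by simp
      finally have "norm (herglotz_kernel t ?z) \<le> (norm ?z + norm (1 + ?z\<^sup>2) / r) * (1 / (t\<^sup>2 + 1))"
        by (rule norm_herglotz_kernel_le[OF r(1)])
      also have "\<dots> \<le> K * (1 / (t\<^sup>2 + 1))"
        unfolding K_def using nz nz2 r(1) by (intro mult_right_mono add_mono divide_right_mono) auto
      finally show ?thesis unfolding norm_mult using f(2)[of t] C by (intro mult_mono) auto
    qed
    have "norm (cauchy_transform m f ?z) \<le> (LINT t|m. norm (of_real (f t) * herglotz_kernel t ?z))"
      unfolding cauchy_transform_def by (rule integral_norm_bound)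
    also have "\<dots> \<le> (LINT t|m. C * (K * (1 / (t\<^sup>2 + 1))))"
      using elim bnd
      by (intro integral_mono integrable_norm integrable_bounded_mult_kernel[OF f] integrable_mult_right integrable_weight) auto
    also have "\<dots> = C * (K * cauchy_mass m)"
      unfolding cauchy_mass_def by (simp only: integral_mult_right_zero)
    finally show ?case .
  qed
  from bounded_over_F_tendsto_0[OF x this] show ?thesis by (simp add: cauchy_ratio_def)
qed

lemma cauchy_ratio_add:
  assumes "f \<in> borel_measurable borel" "\<And>t. \<bar>f t\<bar> \<le> C" "h \<in> borel_measurable borel" "\<And>t. \<bar>h t\<bar> \<le> D" "Im z > 0"
  shows "cauchy_ratio (\<lambda>t. f t + h t) z = cauchy_ratio f z + cauchy_ratio h z"
  unfolding cauchy_ratio_def cauchy_transform_add[OF assms] by (rule add_divide_distrib)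

lemma cauchy_ratio_diff:
  assumes "f \<in> borel_measurable borel" "\<And>t. \<bar>f t\<bar> \<le> C" "h \<in> borel_measurable borel" "\<And>t. \<bar>h t\<bar> \<le> D" "Im z > 0"
  shows "cauchy_ratio (\<lambda>t. f t - h t) z = cauchy_ratio f z - cauchy_ratio h z"
  unfolding cauchy_ratio_def cauchy_transform_diff[OF assms] by (rule diff_divide_distrib)

lemma AE_tendstoI_windows:
  fixes u :: "real \<Rightarrow> real \<Rightarrow> complex"
  assumes N: "N \<in> null_sets lborel"
    and small: "\<And>R k e. R > 0 \<Longrightarrow> k > 0 \<Longrightarrow> e > 0 \<Longrightarrow> \<exists>B\<in>sets borel. emeasure m B \<le> ennreal e \<and>
      (\<forall>x\<in>{-R<..<R} - B. Q x \<longrightarrow> normal_point x \<longrightarrow> (\<forall>\<^sub>F y in at_right 0. dist (u x y) (v x) < k))"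
  shows "AE x in m. x \<in> N \<longrightarrow> Q x \<longrightarrow> (u x \<longlongrightarrow> v x) (at_right 0)"
proof -
  have "AE x in m. Q x \<longrightarrow> normal_point x \<longrightarrow> (\<forall>\<^sub>F y in at_right 0. dist (u x y) (v x) < 1 / Suc k)" for k :: nat
    by (rule AE_I_small_windows[OF sets_m small]) auto
  then have "AE x in m. \<forall>k. Q x \<longrightarrow> normal_point x \<longrightarrow> (\<forall>\<^sub>F y in at_right 0. dist (u x y) (v x) < 1 / Suc k)"
    by (simp only: AE_all_countable) blast
  then show ?thesis using AE_normal_point[OF N]
  proof eventually_elim
    case (elim x)
    show ?case
    proof (intro impI tendstoI)
      fix e :: real assume x: "x \<in> N" "Q x" and e: "e > 0"
      obtain k where k: "1 / real (Suc k) < e" using nat_approx_posE[OF e] by auto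
      have "\<forall>\<^sub>F y in at_right 0. dist (u x y) (v x) < 1 / Suc k" using elim x by blast
      then show "\<forall>\<^sub>F y in at_right 0. dist (u x y) (v x) < e"
        by (rule eventually_mono) (use k in linarith)
    qed
  qed
qed

text \<open>The complement of \<open>A\<close> has an open neighbourhood \<open>U\<close> that meets \<open>A\<close> in a set of small measure.
  The part of \<open>A\<close> outside \<open>U\<close> has a Cauchy transform that is bounded near each point of \<open>U\<close>, and the part inside \<open>U\<close> is handled by the weak type bound.\<close>

lemma cauchy_ratio_indicator_outside:
  assumes N: "N \<in> null_sets lborel" and A: "A \<in> sets borel"
  shows "AE x in m. x \<in> N \<longrightarrow> x \<notin> A \<longrightarrow> ((\<lambda>y. cauchy_ratio (indicator A) (Complex x y)) \<longlongrightarrow> 0) (at_right 0)"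
proof (rule AE_tendstoI_windows[OF N])
  fix R k e :: real assume R: "R > 0" and k: "k > 0" and e: "e > 0"
  \<comment> \<open>The weak type bound gives the square of the quotient at most \<open>8 d\<close>, less than \<open>(k / 2)\<^sup>2\<close>, outside a
    set of measure at most \<open>e\<close>.\<close>
  define d where "d = (k / 2)\<^sup>2 / 16"
  have "(k / 2)\<^sup>2 > 0" using k by simp
  then have d: "d > 0" and dk: "8 * d < (k / 2)\<^sup>2" unfolding d_def by linarith+
  define e' where "e' = e * d / (6 * (R\<^sup>2 + 1))"
  have R1: "R\<^sup>2 + 1 > 0" by (simp add: add_nonneg_pos)
  have e': "e' > 0" unfolding e'_def using e d R1 by simp
  define \<rho> where "\<rho> = density (weighted m) (indicator A)"
  have sr: "sets \<rho> = sets borel" by (simp add: \<rho>_def weighted_def)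
  have er: "emeasure \<rho> X = (\<integral>\<^sup>+t. ennreal (1 / (t\<^sup>2 + 1)) * indicator (A \<inter> X) t \<partial>m)" if X: "X \<in> sets borel" for X
  proof -
    have "emeasure \<rho> X = (\<integral>\<^sup>+t. indicator A t * indicator X t \<partial>weighted m)"
      unfolding \<rho>_def using A X by (subst emeasure_density) (auto simp: weighted_def)
    also have "\<dots> = (\<integral>\<^sup>+t. indicator (A \<inter> X) t \<partial>weighted m)"
      by (intro nn_integral_cong) (auto simp: indicator_def)
    also have "\<dots> = emeasure (weighted m) (A \<inter> X)" using A X by (intro nn_integral_indicator) (auto simp: weighted_def)
    finally show ?thesis using A X by (simp add: emeasure_weighted)
  qed
  have fr: "finite_measure \<rho>"
  proof (rule finite_measureI)
    have "emeasure \<rho> (space \<rho>) \<le> (\<integral>\<^sup>+t. ennreal (1 / (t\<^sup>2 + 1)) \<partial>m)"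
      using sets_eq_imp_space_eq[OF sr] by (simp add: er) (intro nn_integral_mono, auto simp: indicator_def)
    then show "emeasure \<rho> (space \<rho>) \<noteq> \<infinity>" unfolding nn_weight by (auto simp: top_unique)
  qed
  have "emeasure \<rho> (-A) = 0" using A by (subst er) auto
  then obtain U where U: "open U" "-A \<subseteq> U" "emeasure \<rho> U < ennreal e'"
    using open_superset_small[OF fr sr _ _ e', of "-A"] A by (auto simp: borel_comp)
  have Ub: "U \<in> sets borel" using U by simp
  let ?f1 = "indicator (A \<inter> U) :: real \<Rightarrow> real"
  let ?f2 = "indicator (A - U) :: real \<Rightarrow> real"
  have m1: "?f1 \<in> borel_measurable borel" "?f2 \<in> borel_measurable borel" using A Ub by auto
  have b1: "\<bar>?f1 t\<bar> \<le> 1" "\<bar>?f2 t\<bar> \<le> 1" for t by (auto simp: indicator_def)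
  have "ennreal (LINT t|m. (?f1 t)\<^sup>2 * (1 / (t\<^sup>2 + 1))) = (\<integral>\<^sup>+t. ennreal ((?f1 t)\<^sup>2 * (1 / (t\<^sup>2 + 1))) \<partial>m)"
  proof (rule nn_integral_eq_integral[symmetric])
    show "integrable m (\<lambda>t. (?f1 t)\<^sup>2 * (1 / (t\<^sup>2 + 1)))"
      using A Ub by (intro integrable_le_weight[where C=1]) (auto simp: indicator_def)
  qed auto
  also have "\<dots> = emeasure \<rho> U"
    unfolding er[OF Ub] by (intro nn_integral_cong) (auto simp: indicator_def)
  also have "\<dots> < ennreal e'" by (rule U(3))
  finally have i1: "(LINT t|m. (?f1 t)\<^sup>2 * (1 / (t\<^sup>2 + 1))) \<le> e'" using e' by (simp add: ennreal_less_iff integral_nonneg_AE less_imp_le)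
  obtain B where B: "open B" "emeasure m B \<le> ennreal (6 * (R\<^sup>2 + 1) * e' / d)"
    "\<And>x. x \<in> {-R<..<R} \<Longrightarrow> x \<notin> B \<Longrightarrow> poisson_dominates m x \<Longrightarrow>
       \<forall>\<^sub>F y in at_right 0. (norm (cauchy_ratio ?f1 (Complex x y)))\<^sup>2 \<le> 8 * d"
    using cauchy_ratio_maximal[OF m1(1) b1(1) e' i1 d R] by metis
  have "6 * (R\<^sup>2 + 1) * e' / d = e" unfolding e'_def using R1 d by simp
  then have Be: "emeasure m B \<le> ennreal e" using B(2) by simp
  have "\<forall>\<^sub>F y in at_right 0. dist (cauchy_ratio (indicator A) (Complex x y)) 0 < k"
    if x: "x \<notin> B" "x \<notin> A" "normal_point x" "x \<in> {-R<..<R}" for x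
  proof -
    have "x \<in> U" using x U by auto
    then have "((\<lambda>y. cauchy_ratio ?f2 (Complex x y)) \<longlongrightarrow> 0) (at_right 0)"
      by (intro cauchy_ratio_local[OF x(3) U(1) _ m1(2) b1(2)]) auto
    then have "\<forall>\<^sub>F y in at_right 0. dist (cauchy_ratio ?f2 (Complex x y)) 0 < k / 2"
      using k by (intro tendstoD) auto
    moreover have "\<forall>\<^sub>F y in at_right 0. (norm (cauchy_ratio ?f1 (Complex x y)))\<^sup>2 \<le> 8 * d"
      using x by (intro B(3)) (auto simp: normal_point_def)
    ultimately show ?thesis using eventually_pos_at_right
    proof eventually_elim
      case (elim y)
      have "(norm (cauchy_ratio ?f1 (Complex x y)))\<^sup>2 < (k / 2)\<^sup>2"
        by (rule le_less_trans[OF elim(2) dk])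
      then have "norm (cauchy_ratio ?f1 (Complex x y)) < k / 2"
        by (rule power2_less_imp_less) (use k in simp)
      moreover have "indicator A = (\<lambda>t. ?f1 t + ?f2 t)" by (rule ext) (simp split: split_indicator)
      then have "cauchy_ratio (indicator A) (Complex x y) = cauchy_ratio (\<lambda>t. ?f1 t + ?f2 t) (Complex x y)"
        by (rule arg_cong)
      then have "cauchy_ratio (indicator A) (Complex x y) = cauchy_ratio ?f1 (Complex x y) + cauchy_ratio ?f2 (Complex x y)"
        using cauchy_ratio_add[OF m1(1) b1(1) m1(2) b1(2), of "Complex x y"] elim(3) by simp
      ultimately show ?case
        using elim(1) norm_triangle_ineq[of "cauchy_ratio ?f1 (Complex x y)" "cauchy_ratio ?f2 (Complex x y)"] by simp
    qed
  qed
  then show "\<exists>B\<in>sets borel. emeasure m B \<le> ennreal e \<and> (\<forall>x\<in>{-R<..<R} - B. x \<notin> A \<longrightarrow> normal_point x \<longrightarrow>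
      (\<forall>\<^sub>F y in at_right 0. dist (cauchy_ratio (indicator A) (Complex x y)) 0 < k))"
    using B(1) Be by (intro bexI[of _ B]) auto
qed

lemma cauchy_ratio_indicator:
  assumes N: "N \<in> null_sets lborel" and A: "A \<in> sets borel"
  shows "AE x in m. x \<in> N \<longrightarrow> ((\<lambda>y. cauchy_ratio (indicator A) (Complex x y)) \<longlongrightarrow> indicator A x) (at_right 0)"
proof -
  have A': "-A \<in> sets borel" using A by (rule borel_comp)
  show ?thesis
    using cauchy_ratio_indicator_outside[OF N A] cauchy_ratio_indicator_outside[OF N A'] AE_normal_point[OF N]
  proof eventually_elim
    case (elim x)
    show ?case
    proof (intro impI)
      assume x: "x \<in> N"
      show "((\<lambda>y. cauchy_ratio (indicator A) (Complex x y)) \<longlongrightarrow> indicator A x) (at_right 0)"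
      proof (cases "x \<in> A")
        case True
        then have "((\<lambda>y. cauchy_ratio (indicator (-A)) (Complex x y)) \<longlongrightarrow> 0) (at_right 0)" using elim(2) x by simp
        moreover have "((\<lambda>y. cauchy_ratio (\<lambda>_. 1) (Complex x y)) \<longlongrightarrow> 1) (at_right 0)"
          using elim(3) x by (intro cauchy_ratio_one_tendsto) simp
        ultimately have "((\<lambda>y. cauchy_ratio (\<lambda>_. 1) (Complex x y) - cauchy_ratio (indicator (-A)) (Complex x y)) \<longlongrightarrow> 1 - 0) (at_right 0)"
          by (rule tendsto_diff[rotated])
        moreover have "\<forall>\<^sub>F y in at_right 0. cauchy_ratio (\<lambda>_. 1) (Complex x y) - cauchy_ratio (indicator (-A)) (Complex x y) = cauchy_ratio (indicator A) (Complex x y)"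
          using eventually_pos_at_right
        proof eventually_elim
          case (elim y)
          have "indicator A = (\<lambda>t. (1::real) - indicator (-A) t)" by (auto simp: indicator_def fun_eq_iff)
          then show ?case
            using elim A' by (simp only:) (subst cauchy_ratio_diff[where C=1 and D=1], auto simp: indicator_def)
        qed
        ultimately show ?thesis using True by (auto intro: Lim_transform_eventually)
      qed (use elim x in simp)
    qed
  qed
qed

lemma floor_staircase:
  fixes u :: real
  assumes "0 \<le> u" "u \<le> 1" "n > 0"
  shows "\<bar>u - (\<Sum>j\<in>{1..n}. 1 / real n * indicator {t. real j / real n \<le> t} u)\<bar> \<le> 1 / real n"
proof -
  define k where "k = nat \<lfloor>real n * u\<rfloor>"
  have k: "real k \<le> real n * u" "real n * u < real k + 1"
    unfolding k_def using assms by (auto simp: of_nat_nat floor_le_iff)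
  have kn: "k \<le> n"
  proof -
    have "real n * u \<le> real n * 1" using assms by (intro mult_left_mono) auto
    then show ?thesis using k(1) by simp
  qed
  have iff: "real j / real n \<le> u \<longleftrightarrow> j \<le> k" for j :: nat
  proof -
    have "real j / real n \<le> u \<longleftrightarrow> real j \<le> real n * u" using assms(3) by (simp add: field_simps)
    also have "\<dots> \<longleftrightarrow> j \<le> k" using k by (intro iffI) linarith+
    finally show ?thesis .
  qed
  have "(\<Sum>j\<in>{1..n}. 1 / real n * indicator {t. real j / real n \<le> t} u) = (\<Sum>j\<in>{1..n}. if j \<le> k then 1 / real n else 0)"
    by (intro sum.cong) (auto simp: iff)
  also have "\<dots> = (\<Sum>j\<in>{1..n} \<inter> {j. j \<le> k}. 1 / real n)" by (simp add: sum.If_cases)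
  also have "{1..n} \<inter> {j. j \<le> k} = {1..k}" using kn by auto
  also have "(\<Sum>j\<in>{1..k}. 1 / real n) = real k / real n" by simp
  finally show ?thesis using k assms(3) by (simp add: abs_le_iff field_simps)
qed

text \<open>Poltoratski's theorem for \<open>f m\<close> with \<open>f\<close> between zero and one. It passes from indicators to
  staircase functions by linearity and to \<open>f\<close> by uniform approximation, where the weak type bound
  controls the error.\<close>

theorem cauchy_ratio_tendsto:
  assumes N: "N \<in> null_sets lborel" and f: "f \<in> borel_measurable borel" "\<And>t. 0 \<le> f t" "\<And>t. f t \<le> 1"
  shows "AE x in m. x \<in> N \<longrightarrow> ((\<lambda>y. cauchy_ratio f (Complex x y)) \<longlongrightarrow> of_real (f x)) (at_right 0)"
proof -
  define s where "s n t = (\<Sum>j\<in>{1..n}. 1 / real n * indicator {u. real j / real n \<le> f u} t)" for n :: nat and t :: real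
  have sm: "s n \<in> borel_measurable borel" for n unfolding s_def using f(1) by measurable
  have sf: "\<bar>f t - s n t\<bar> \<le> 1 / real n" if "n > 0" for n t
    using floor_staircase[OF f(2)[of t] f(3)[of t] that] by (simp add: s_def indicator_def)
  have sb: "\<bar>s n t\<bar> \<le> real n" for n t
  proof -
    have "\<bar>s n t\<bar> \<le> (\<Sum>j\<in>{1..n}. \<bar>1 / real n * indicator {u. real j / real n \<le> f u} t\<bar>)" unfolding s_def by (rule sum_abs)
    also have "\<dots> \<le> (\<Sum>j\<in>{1..n}. 1)" by (intro sum_mono) (auto simp: indicator_def)
    finally show ?thesis by simp
  qed
  have simple: "AE x in m. x \<in> N \<longrightarrow> ((\<lambda>y. cauchy_ratio (s n) (Complex x y)) \<longlongrightarrow> of_real (s n x)) (at_right 0)" for n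
  proof -
    have "AE x in m. \<forall>j\<in>{1..n}. x \<in> N \<longrightarrow> ((\<lambda>y. cauchy_ratio (indicator {u. real j / real n \<le> f u}) (Complex x y)) \<longlongrightarrow> indicator {u. real j / real n \<le> f u} x) (at_right 0)"
    proof (rule AE_finite_allI)
      fix j
      have "{u. real j / real n \<le> f u} \<in> sets borel" using f(1) by measurable
      from cauchy_ratio_indicator[OF N this]
      show "AE x in m. x \<in> N \<longrightarrow> ((\<lambda>y. cauchy_ratio (indicator {u. real j / real n \<le> f u}) (Complex x y)) \<longlongrightarrow> indicator {u. real j / real n \<le> f u} x) (at_right 0)" .
    qed simp
    then show ?thesis
    proof (rule eventually_mono, intro impI)
      fix x assume x: "x \<in> N" and *: "\<forall>j\<in>{1..n}. x \<in> N \<longrightarrow> ((\<lambda>y. cauchy_ratio (indicator {u. real j / real n \<le> f u}) (Complex x y)) \<longlongrightarrow> indicator {u. real j / real n \<le> f u} x) (at_right 0)"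
      have L: "((\<lambda>y. \<Sum>j\<in>{1..n}. of_real (1 / real n) * cauchy_ratio (indicator {u. real j / real n \<le> f u}) (Complex x y)) \<longlongrightarrow>
         (\<Sum>j\<in>{1..n}. of_real (1 / real n) * indicator {u. real j / real n \<le> f u} x)) (at_right 0)"
        using * x by (intro tendsto_sum tendsto_mult tendsto_const) auto
      have S: "(\<Sum>j\<in>{1..n}. of_real (1 / real n) * indicator {u. real j / real n \<le> f u} x) = (of_real (s n x) :: complex)"
        unfolding s_def of_real_sum of_real_mult by (intro sum.cong) (auto simp: indicator_def)
      have E: "\<forall>\<^sub>F y in at_right 0. (\<Sum>j\<in>{1..n}. of_real (1 / real n) * cauchy_ratio (indicator {u. real j / real n \<le> f u}) (Complex x y)) = cauchy_ratio (s n) (Complex x y)"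
        using eventually_pos_at_right
      proof eventually_elim
        case (elim y)
        have "cauchy_transform m (s n) (Complex x y) = (\<Sum>j\<in>{1..n}. cauchy_transform m (\<lambda>t. 1 / real n * indicator {u. real j / real n \<le> f u} t) (Complex x y))"
          unfolding s_def
        proof (rule cauchy_transform_sum[where C=1])
          show "\<bar>1 / real n * indicator {u. real j / real n \<le> f u} t\<bar> \<le> 1" for j t
            by (cases "n = 0") (auto simp: indicator_def)
        qed (use f(1) elim in auto)
        also have "\<dots> = (\<Sum>j\<in>{1..n}. of_real (1 / real n) * cauchy_transform m (indicator {u. real j / real n \<le> f u}) (Complex x y))"
          by (intro sum.cong refl) (rule cauchy_transform_cmult)
        finally show ?case unfolding cauchy_ratio_def by (simp add: sum_divide_distrib)
      qed
      show "((\<lambda>y. cauchy_ratio (s n) (Complex x y)) \<longlongrightarrow> of_real (s n x)) (at_right 0)"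
        using Lim_transform_eventually[OF L E] unfolding S .
    qed
  qed
  then have "AE x in m. \<forall>n. x \<in> N \<longrightarrow> ((\<lambda>y. cauchy_ratio (s n) (Complex x y)) \<longlongrightarrow> of_real (s n x)) (at_right 0)"
    by (simp only: AE_all_countable) blast
  moreover have "AE x in m. x \<in> N \<longrightarrow> (\<forall>n. ((\<lambda>y. cauchy_ratio (s n) (Complex x y)) \<longlongrightarrow> of_real (s n x)) (at_right 0)) \<longrightarrow>
      ((\<lambda>y. cauchy_ratio f (Complex x y)) \<longlongrightarrow> of_real (f x)) (at_right 0)"
  proof (rule AE_tendstoI_windows[OF N])
    fix R k e :: real assume R: "R > 0" and k: "k > 0" and e: "e > 0"
    define d where "d = (k / 3)\<^sup>2 / 16"
    have "(k / 3)\<^sup>2 > 0" using k by simp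
    then have d: "d > 0" and dk: "8 * d < (k / 3)\<^sup>2" unfolding d_def by linarith+
    define e' where "e' = e * d / (6 * (R\<^sup>2 + 1))"
    have R1: "R\<^sup>2 + 1 > 0" by (simp add: add_nonneg_pos)
    have e': "e' > 0" unfolding e'_def using e d R1 by simp
    have "min (k / 3) (min 1 (e' / (cauchy_mass m + 1))) > 0" using k e' cauchy_mass_nonneg by simp
    then obtain n where n: "n > 0" "1 / real n < min (k / 3) (min 1 (e' / (cauchy_mass m + 1)))"
      by (metis nat_approx_posE zero_less_Suc)
    define h where "h t = f t - s n t" for t
    have hm: "h \<in> borel_measurable borel" unfolding h_def using f(1) sm by measurable
    have hb: "\<bar>h t\<bar> \<le> 1 / real n" for t unfolding h_def by (rule sf[OF n(1)])
    have "(LINT t|m. (h t)\<^sup>2 * (1 / (t\<^sup>2 + 1))) \<le> (LINT t|m. 1 / real n * (1 / (t\<^sup>2 + 1)))"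
    proof (rule integral_mono')
      show "integrable m (\<lambda>t. 1 / real n * (1 / (t\<^sup>2 + 1)))" by (intro integrable_mult_right integrable_weight)
      fix t
      have "(h t)\<^sup>2 \<le> 1 / real n"
      proof -
        have 1: "1 / real n \<le> 1" using n(2) by linarith
        have "\<bar>h t\<bar> * \<bar>h t\<bar> \<le> 1 / real n * 1"
          using hb[of t] order_trans[OF hb[of t] 1] by (rule mult_mono) auto
        then show ?thesis by (simp add: power2_eq_square abs_mult_self_eq)
      qed
      then show "(h t)\<^sup>2 * (1 / (t\<^sup>2 + 1)) \<le> 1 / real n * (1 / (t\<^sup>2 + 1))" by (intro mult_right_mono) auto
    qed auto
    also have "\<dots> = 1 / real n * cauchy_mass m" unfolding cauchy_mass_def by (rule integral_mult_right_zero)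
    also have "\<dots> \<le> e' / (cauchy_mass m + 1) * (cauchy_mass m + 1)"
      using n e' cauchy_mass_nonneg by (intro mult_mono) auto
    also have "\<dots> = e'" using cauchy_mass_nonneg by simp
    finally have i1: "(LINT t|m. (h t)\<^sup>2 * (1 / (t\<^sup>2 + 1))) \<le> e'" .
    obtain B where B: "open B" "emeasure m B \<le> ennreal (6 * (R\<^sup>2 + 1) * e' / d)"
      "\<And>x. x \<in> {-R<..<R} \<Longrightarrow> x \<notin> B \<Longrightarrow> poisson_dominates m x \<Longrightarrow>
         \<forall>\<^sub>F y in at_right 0. (norm (cauchy_ratio h (Complex x y)))\<^sup>2 \<le> 8 * d"
      using cauchy_ratio_maximal[OF hm hb e' i1 d R] by metis
    have "6 * (R\<^sup>2 + 1) * e' / d = e" unfolding e'_def using R1 d by simp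
    then have Be: "emeasure m B \<le> ennreal e" using B(2) by simp
    have "\<forall>\<^sub>F y in at_right 0. dist (cauchy_ratio f (Complex x y)) (of_real (f x)) < k"
      if x: "x \<notin> B" "\<forall>n. ((\<lambda>y. cauchy_ratio (s n) (Complex x y)) \<longlongrightarrow> of_real (s n x)) (at_right 0)" "normal_point x" "x \<in> {-R<..<R}" for x
    proof -
      have "\<forall>\<^sub>F y in at_right 0. dist (cauchy_ratio (s n) (Complex x y)) (of_real (s n x)) < k / 3"
        using x(2) k by (intro tendstoD) auto
      moreover have "\<forall>\<^sub>F y in at_right 0. (norm (cauchy_ratio h (Complex x y)))\<^sup>2 \<le> 8 * d"
        using x by (intro B(3)) (auto simp: normal_point_def)
      ultimately show ?thesis using eventually_pos_at_right
      proof eventually_elim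
        case (elim y)
        have "(norm (cauchy_ratio h (Complex x y)))\<^sup>2 < (k / 3)\<^sup>2"
          by (rule le_less_trans[OF elim(2) dk])
        then have 1: "norm (cauchy_ratio h (Complex x y)) < k / 3"
          by (rule power2_less_imp_less) (use k in simp)
        have 2: "cauchy_ratio h (Complex x y) = cauchy_ratio f (Complex x y) - cauchy_ratio (s n) (Complex x y)"
          unfolding h_def using elim(3) f by (intro cauchy_ratio_diff[OF f(1) _ sm sb, where C=1]) auto
        have 3: "norm (of_real (s n x) - of_real (f x) :: complex) < k / 3"
        proof -
          have "norm (of_real (s n x) - of_real (f x) :: complex) = \<bar>h x\<bar>"
            unfolding h_def by (simp add: abs_minus_commute flip: of_real_diff)
          then show ?thesis using hb[of x] n(2) by linarith
        qed
        have "cauchy_ratio f (Complex x y) - of_real (f x) = cauchy_ratio h (Complex x y) +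
           (cauchy_ratio (s n) (Complex x y) - of_real (s n x)) + (of_real (s n x) - of_real (f x))" using 2 by simp
        also have "norm \<dots> \<le> norm (cauchy_ratio h (Complex x y)) + norm (cauchy_ratio (s n) (Complex x y) - of_real (s n x))
            + norm (of_real (s n x) - of_real (f x) :: complex)"
          by (intro order_trans[OF norm_triangle_ineq] add_right_mono norm_triangle_ineq)
        also have "\<dots> < k / 3 + k / 3 + k / 3" using 1 3 elim(1) by (intro add_strict_mono) (auto simp: dist_norm)
        finally show ?case by (simp add: dist_norm)
      qed
    qed
    then show "\<exists>B\<in>sets borel. emeasure m B \<le> ennreal e \<and> (\<forall>x\<in>{-R<..<R} - B. (\<forall>n. ((\<lambda>y. cauchy_ratio (s n) (Complex x y)) \<longlongrightarrow> of_real (s n x)) (at_right 0)) \<longrightarrow>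
       normal_point x \<longrightarrow> (\<forall>\<^sub>F y in at_right 0. dist (cauchy_ratio f (Complex x y)) (of_real (f x)) < k))"
      using B(1) Be by (intro bexI[of _ B]) auto
  qed
  ultimately show ?thesis by eventually_elim blast
qed

end

section \<open>Vertical limits of quotients of Herglotz functions\<close>

text \<open>Two measures are compared below through their densities with respect to their sum. These exist by
  the Radon-Nikodym theorem and add up to one.\<close>

lemma sum_of_measures:
  assumes \<mu>: "herglotz_measure \<mu>" and \<nu>: "herglotz_measure \<nu>"
  obtains m f where "herglotz_measure m" "f \<in> borel_measurable borel" "\<And>t. 0 \<le> f t" "\<And>t. f t \<le> (1::real)"
    "\<mu> = density m (\<lambda>t. ennreal (f t))" "\<nu> = density m (\<lambda>t. ennreal (1 - f t))"
proof -
  interpret \<mu>: herglotz_measure_space \<mu> using \<mu> by unfold_locales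
  interpret \<nu>: herglotz_measure_space \<nu> using \<nu> by unfold_locales
  define m :: "real measure" where "m = measure_of UNIV (sets borel) (\<lambda>A. emeasure \<mu> A + emeasure \<nu> A)"
  have sm [measurable_cong, simp]: "sets m = sets borel"
    using sets.sigma_sets_eq[of "borel :: real measure"] by (simp add: m_def sets_measure_of)
  have spm [simp]: "space m = UNIV" using sets_eq_imp_space_eq[OF sm] by simp
  have em: "emeasure m A = emeasure \<mu> A + emeasure \<nu> A" if A: "A \<in> sets borel" for A
    unfolding m_def
  proof (rule emeasure_measure_of_sigma)
    show "sigma_algebra UNIV (sets (borel :: real measure))" using sets.sigma_algebra_axioms[of borel] by simp
    show "positive (sets borel) (\<lambda>A. emeasure \<mu> A + emeasure \<nu> A)" by (simp add: positive_def)
    show "countably_additive (sets borel) (\<lambda>A. emeasure \<mu> A + emeasure \<nu> A)"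
    proof (rule countably_additiveI)
      fix X :: "nat \<Rightarrow> real set" assume X: "range X \<subseteq> sets borel" "disjoint_family X"
      have "(\<Sum>i. emeasure \<mu> (X i) + emeasure \<nu> (X i)) = (\<Sum>i. emeasure \<mu> (X i)) + (\<Sum>i. emeasure \<nu> (X i))"
        by (rule suminf_add[symmetric]) auto
      then show "(\<Sum>i. emeasure \<mu> (X i) + emeasure \<nu> (X i)) = emeasure \<mu> (\<Union>(range X)) + emeasure \<nu> (\<Union>(range X))"
        using X by (simp add: suminf_emeasure)
    qed
  qed (rule A)
  interpret sigma_finite_measure m
  proof (rule sigma_finite_measureI_bounded[OF sm])
    show "emeasure m {-R..R} \<noteq> \<infinity>" for R
      using \<mu>.emeasure_bounded_le_mass[of "{-R..R}" R] \<nu>.emeasure_bounded_le_mass[of "{-R..R}" R]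
      by (auto simp: top_unique em)
  qed
  have ac: "absolutely_continuous m \<mu>" "absolutely_continuous m \<nu>"
    unfolding absolutely_continuous_def by (auto simp: null_sets_def em)
  have bm: "borel_measurable m = borel_measurable borel"
    by (rule measurable_cong_sets) auto
  obtain f where f: "f \<in> borel_measurable borel" "density m f = \<mu>"
    using Radon_Nikodym[OF ac(1)] unfolding bm by auto
  obtain g where g: "g \<in> borel_measurable borel" "density m g = \<nu>"
    using Radon_Nikodym[OF ac(2)] unfolding bm by auto
  have "density m (\<lambda>t. f t + g t) = density m (\<lambda>_. 1)"
  proof (rule measure_eqI)
    fix A assume "A \<in> sets (density m (\<lambda>t. f t + g t))"
    then have A: "A \<in> sets borel" by simp
    have "emeasure (density m (\<lambda>t. f t + g t)) A = (\<integral>\<^sup>+t. f t * indicator A t + g t * indicator A t \<partial>m)"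
      using A f g by (subst emeasure_density) (auto simp: distrib_right)
    also have "\<dots> = (\<integral>\<^sup>+t. f t * indicator A t \<partial>m) + (\<integral>\<^sup>+t. g t * indicator A t \<partial>m)"
      using A f g by (intro nn_integral_add) auto
    also have "\<dots> = emeasure (density m f) A + emeasure (density m g) A"
      using A f(1) g(1) by (simp add: emeasure_density)
    also have "\<dots> = emeasure (density m (\<lambda>_. 1)) A" unfolding f(2) g(2) using A by (simp add: em density_1)
    finally show "emeasure (density m (\<lambda>t. f t + g t)) A = emeasure (density m (\<lambda>_. 1)) A" .
  qed simp
  then have fg: "AE t in m. f t + g t = 1"
    using f(1) g(1) by (intro density_unique) auto
  define h where "h t = enn2real (min 1 (f t))" for t
  have hm: "h \<in> borel_measurable borel" unfolding h_def using f(1) by measurable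
  have h0: "0 \<le> h t" for t by (simp add: h_def)
  have eh: "ennreal (h t) = min 1 (f t)" for t unfolding h_def
    by (rule ennreal_enn2real) (auto simp: min_less_iff_disj)
  have h1: "h t \<le> 1" for t
  proof -
    have "ennreal (h t) \<le> ennreal 1" unfolding eh by simp
    then show ?thesis by simp
  qed
  have \<mu>h: "\<mu> = density m (\<lambda>t. ennreal (h t))"
    unfolding f(2)[symmetric]
  proof (rule density_cong)
    show "AE t in m. f t = ennreal (h t)" using fg
    proof (rule eventually_mono)
      fix t assume "f t + g t = 1"
      then have "f t \<le> 1" by (metis le_iff_add)
      then show "f t = ennreal (h t)" by (simp add: eh min_def)
    qed
  qed (use f hm in auto)
  have \<nu>h: "\<nu> = density m (\<lambda>t. ennreal (1 - h t))"
    unfolding g(2)[symmetric]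
  proof (rule density_cong)
    show "AE t in m. g t = ennreal (1 - h t)" using fg
    proof (rule eventually_mono)
      fix t assume *: "f t + g t = 1"
      then have "f t \<le> 1" by (metis le_iff_add)
      then have ft: "f t = ennreal (h t)" by (simp add: eh min_def)
      have "ennreal (1 - h t) = ennreal 1 - ennreal (h t)" by (rule ennreal_minus[symmetric]) (rule h0)
      also have "\<dots> = (ennreal (h t) + g t) - ennreal (h t)" using * ft by simp
      also have "\<dots> = g t" by (rule ennreal_add_diff_cancel_left) simp
      finally show "g t = ennreal (1 - h t)" ..
    qed
  qed (use g hm in auto)
  have hg: "herglotz_measure m"
    unfolding herglotz_measure_def
  proof
    have "(\<integral>\<^sup>+t. ennreal (1 / (t\<^sup>2 + 1)) \<partial>m) = (\<integral>\<^sup>+t. f t * ennreal (1 / (t\<^sup>2 + 1)) + g t * ennreal (1 / (t\<^sup>2 + 1)) \<partial>m)"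
      using fg by (intro nn_integral_cong_AE) (auto elim!: eventually_mono simp flip: distrib_right)
    also have "\<dots> = (\<integral>\<^sup>+t. f t * ennreal (1 / (t\<^sup>2 + 1)) \<partial>m) + (\<integral>\<^sup>+t. g t * ennreal (1 / (t\<^sup>2 + 1)) \<partial>m)"
      using f g by (intro nn_integral_add) auto
    also have "\<dots> = (\<integral>\<^sup>+t. ennreal (1 / (t\<^sup>2 + 1)) \<partial>\<mu>) + (\<integral>\<^sup>+t. ennreal (1 / (t\<^sup>2 + 1)) \<partial>\<nu>)"
      unfolding f(2)[symmetric] g(2)[symmetric] using f(1) g(1) by (simp add: nn_integral_density)
    finally show "(\<integral>\<^sup>+t. ennreal (1 / (t\<^sup>2 + 1)) \<partial>m) < \<infinity>"
      using \<mu>.nn_weight \<nu>.nn_weight by simp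
  qed simp
  show ?thesis by (rule that[OF hg hm h0 h1 \<mu>h \<nu>h])
qed

lemma (in herglotz_measure_space) cauchy_transform_density:
  assumes "f \<in> borel_measurable borel" "\<And>t. 0 \<le> f t"
  shows "cauchy_transform (density m (\<lambda>t. ennreal (f t))) (\<lambda>_. 1) z = cauchy_transform m f z"
  unfolding cauchy_transform_def using assms
  by (subst integral_density) (auto simp: scaleR_conv_of_real)

text \<open>Over the sum of the two measures, the quotient \<open>F / (F + G)\<close> tends to the density \<open>f\<close> of \<open>\<mu>\<close>, and
  \<open>f\<close> is positive almost everywhere with respect to \<open>\<mu>\<close>. So \<open>G / F\<close> tends to \<open>1/f - 1\<close>.\<close>

theorem herglotz_ratio_limit:
  assumes \<mu>: "herglotz_measure \<mu>" and b: "b \<ge> 0" and pos: "\<And>z. Im z > 0 \<Longrightarrow> Im (herglotz_rep a b \<mu> z) > 0"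
    and \<nu>: "herglotz_measure \<nu>" and b': "b' \<ge> 0" and N: "N \<in> null_sets lborel"
  shows "AE x in \<mu>. x \<in> N \<longrightarrow> (\<exists>L\<ge>0. ((\<lambda>y. herglotz_rep a' b' \<nu> (Complex x y) / herglotz_rep a b \<mu> (Complex x y)) \<longlongrightarrow> of_real L) (at_right 0))"
proof -
  interpret \<mu>: herglotz_measure_space \<mu> using \<mu> by unfold_locales
  interpret \<nu>: herglotz_measure_space \<nu> using \<nu> by unfold_locales
  obtain m f where m: "herglotz_measure m" and f: "f \<in> borel_measurable borel" "\<And>t. 0 \<le> f t" "\<And>t. f t \<le> (1::real)"
    and \<mu>f: "\<mu> = density m (\<lambda>t. ennreal (f t))" and \<nu>f: "\<nu> = density m (\<lambda>t. ennreal (1 - f t))"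
    using sum_of_measures[OF \<mu> \<nu>] by metis
  let ?F = "herglotz_rep a b \<mu>" and ?G = "herglotz_rep a' b' \<nu>"
  interpret m: herglotz_measure_space m using m by unfold_locales
  have fb: "\<bar>f t\<bar> \<le> 1" "\<bar>1 - f t\<bar> \<le> 1" for t using f(2)[of t] f(3)[of t] by auto
  have f': "(\<lambda>t. 1 - f t) \<in> borel_measurable borel" using f(1) by measurable
  have c\<mu>: "cauchy_transform \<mu> (\<lambda>_. 1) = cauchy_transform m f"
    unfolding \<mu>f using m.cauchy_transform_density[OF f(1,2)] by (rule ext)
  have c\<nu>: "cauchy_transform \<nu> (\<lambda>_. 1) = cauchy_transform m (\<lambda>t. 1 - f t)"
    unfolding \<nu>f using m.cauchy_transform_density[OF f'] f(3) by (intro ext) auto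
  have sum: "herglotz_rep (a + a') (b + b') m z = ?F z + ?G z" if z: "Im z > 0" for z
  proof -
    have "cauchy_transform m (\<lambda>_. 1) z = cauchy_transform m (\<lambda>t. f t + (1 - f t)) z" by simp
    also have "\<dots> = cauchy_transform m f z + cauchy_transform m (\<lambda>t. 1 - f t) z"
      by (rule m.cauchy_transform_add[OF f(1) fb(1) f' fb(2) z])
    finally show ?thesis unfolding herglotz_rep_cauchy_transform c\<mu> c\<nu> by (simp add: algebra_simps)
  qed
  have Gim: "Im (?G z) \<ge> 0" if "Im z > 0" for z
    using \<nu>.Im_herglotz_rep[OF that, of a' b' "Re z"] \<nu>.poisson_nonneg[OF that, of "Re z"] b' that by simp
  interpret S: herglotz_function m "a + a'" "b + b'"
  proof
    show "b + b' \<ge> 0" using b b' by simp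
    show "Im (herglotz_rep (a + a') (b + b') m z) > 0" if "Im z > 0" for z
      unfolding sum[OF that] using pos[OF that] Gim[OF that] by simp
  qed
  have "AE x in m. 0 < f x \<longrightarrow> x \<in> N \<longrightarrow> (\<exists>L\<ge>0. ((\<lambda>y. ?G (Complex x y) / ?F (Complex x y)) \<longlongrightarrow> of_real L) (at_right 0))"
    using S.cauchy_ratio_tendsto[OF N f] S.AE_normal_point[OF N]
  proof eventually_elim
    case (elim x)
    show ?case
    proof (intro impI)
      assume fx: "0 < f x" and x: "x \<in> N"
      have 1: "((\<lambda>y. S.cauchy_ratio f (Complex x y)) \<longlongrightarrow> of_real (f x)) (at_right 0)" using elim x by simp
      have "S.normal_point x" using elim x by simp
      from S.bounded_over_F_tendsto_0[OF this eventually_affine_bounded[of a b x]]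
      have "((\<lambda>y. (of_real a + of_real b * Complex x y) / S.F (Complex x y) + S.cauchy_ratio f (Complex x y)) \<longlongrightarrow> 0 + of_real (f x)) (at_right 0)"
        by (rule tendsto_add) (rule 1)
      then have "((\<lambda>y. 1 / ((of_real a + of_real b * Complex x y) / S.F (Complex x y) + S.cauchy_ratio f (Complex x y)) - 1) \<longlongrightarrow> 1 / (0 + of_real (f x)) - 1) (at_right 0)"
        using fx by (intro tendsto_diff[OF tendsto_divide[OF tendsto_const] tendsto_const]) auto
      moreover have "\<forall>\<^sub>F y in at_right 0. 1 / ((of_real a + of_real b * Complex x y) / S.F (Complex x y) + S.cauchy_ratio f (Complex x y)) - 1 = ?G (Complex x y) / ?F (Complex x y)"
        using eventually_pos_at_right
      proof eventually_elim
        case (elim y)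
        let ?z = "Complex x y"
        have z: "Im ?z > 0" using elim by simp
        have F0: "?F ?z \<noteq> 0" using pos[OF z] by auto
        have S0: "?F ?z + ?G ?z \<noteq> 0" using S.F_nonzero[OF z] sum[OF z] by simp
        have eq: "(of_real a + of_real b * ?z) / S.F ?z + S.cauchy_ratio f ?z = ?F ?z / (?F ?z + ?G ?z)"
          unfolding S.cauchy_ratio_def sum[OF z] add_divide_distrib[symmetric] herglotz_rep_cauchy_transform[of a b] c\<mu> ..
        show ?case unfolding eq using F0 S0 by (simp add: field_simps)
      qed
      ultimately have "((\<lambda>y. ?G (Complex x y) / ?F (Complex x y)) \<longlongrightarrow> 1 / (0 + of_real (f x)) - 1) (at_right 0)"
        by (rule Lim_transform_eventually)
      moreover have "1 / (0 + of_real (f x)) - 1 = (of_real (1 / f x - 1) :: complex)" by simp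
      moreover have "1 / f x - 1 \<ge> 0" using fx f(3)[of x] by simp
      ultimately show "\<exists>L\<ge>0. ((\<lambda>y. ?G (Complex x y) / ?F (Complex x y)) \<longlongrightarrow> of_real L) (at_right 0)"
        by (metis (no_types, lifting))
    qed
  qed
  then show ?thesis unfolding \<mu>f using f(1) by (subst AE_density) auto
qed

section \<open>Boundary values and the argument of a Herglotz function\<close>

lemma AE_poisson_bounded:
  assumes m: "herglotz_measure m"
  shows "AE x in lborel. \<exists>K. \<forall>\<^sub>F y in at_right 0. poisson m x y \<le> K"
proof -
  interpret herglotz_measure_space m using m by unfold_locales
  have "AE x in lborel. poisson_dominates lborel x \<longrightarrow> (\<exists>K. \<forall>\<^sub>F y in at_right 0. poisson m x y \<le> K)"
  proof (rule AE_I_small_windows[OF sets_lborel])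
    fix R e :: real assume e: "e > 0"
    define M where "M = (R\<^sup>2 + 1) * cauchy_mass m"
    have M: "M \<ge> 0" unfolding M_def using cauchy_mass_nonneg by simp
    define d where "d = (2 * M + 1) / e"
    have d: "d > 0" using e M by (simp add: d_def add_nonneg_pos)
    have op: "open {-R<..<R}" by simp
    obtain B where B: "open B" "ennreal d * emeasure lborel B \<le> 2 * emeasure m {-R<..<R}"
      "\<And>x c. x \<in> {-R<..<R} \<Longrightarrow> x \<notin> B \<Longrightarrow> poisson_dominates lborel x \<Longrightarrow>
       \<forall>\<^sub>F y in at_right 0. poisson m x y + c * y \<le> 2 * d * poisson lborel x y"
      using poisson_local_maximal[OF m herglotz_measure_lborel op d] by metis
    have "2 * emeasure m {-R<..<R} \<le> 2 * ennreal M"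
      unfolding M_def by (intro mult_left_mono emeasure_bounded_le_mass) auto
    also have "\<dots> = ennreal (2 * M)" using M by (simp add: ennreal_mult)
    finally have "emeasure lborel B \<le> ennreal (2 * M / d)"
      using B(2) d by (intro ennreal_mult_le_imp_le) auto
    also have "\<dots> \<le> ennreal e"
      using e M by (intro ennreal_leI) (simp add: d_def field_simps)
    finally have "emeasure lborel B \<le> ennreal e" .
    moreover have "\<exists>K. \<forall>\<^sub>F y in at_right 0. poisson m x y \<le> K"
      if x: "x \<notin> B" "poisson_dominates lborel x" "x \<in> {-R<..<R}" for x
    proof (rule exI[of _ "2 * d * pi"])
      show "\<forall>\<^sub>F y in at_right 0. poisson m x y \<le> 2 * d * pi"
        using B(3)[OF x(3,1,2), of 0] eventually_pos_at_right
        by eventually_elim (simp add: poisson_lborel)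
    qed
    ultimately show "\<exists>B\<in>sets borel. emeasure lborel B \<le> ennreal e \<and> (\<forall>x\<in>{-R<..<R} - B. poisson_dominates lborel x \<longrightarrow>
        (\<exists>K. \<forall>\<^sub>F y in at_right 0. poisson m x y \<le> K))"
      using B(1) by (intro bexI[of _ B]) auto
  qed
  then show ?thesis using AE_poisson_dominates[OF herglotz_measure_lborel] by eventually_elim blast
qed

lemma AE_Im_herglotz_bounded:
  assumes "herglotz G"
  shows "AE x in lborel. \<exists>K. \<forall>\<^sub>F y in at_right 0. Im (G (Complex x y)) \<le> K"
proof -
  obtain a b \<mu> where r: "b \<ge> 0" "herglotz_measure \<mu>" "\<And>z. Im z > 0 \<Longrightarrow> G z = herglotz_rep a b \<mu> z"
    using herglotz_representation[OF assms] by metis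
  interpret herglotz_measure_space \<mu> using r(2) by unfold_locales
  show ?thesis using AE_poisson_bounded[OF r(2)]
  proof (rule eventually_mono)
    fix x assume "\<exists>K. \<forall>\<^sub>F y in at_right 0. poisson \<mu> x y \<le> K"
    then obtain K where K: "\<forall>\<^sub>F y in at_right 0. poisson \<mu> x y \<le> K" by blast
    have "\<forall>\<^sub>F y in at_right (0::real). y < 1" by (rule eventually_at_rightI[of 0 1]) auto
    with K have "\<forall>\<^sub>F y in at_right 0. Im (G (Complex x y)) \<le> b + K"
      using eventually_pos_at_right
    proof eventually_elim
      case (elim y)
      have "b * y \<le> b" using r(1) elim by (simp add: mult_left_le)
      then show ?case using elim r(3)[of "Complex x y"] by (simp add: Im_herglotz_rep)
    qed
    then show "\<exists>K. \<forall>\<^sub>F y in at_right 0. Im (G (Complex x y)) \<le> K" by blast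
  qed
qed

lemma herglotz_Im_pos: "herglotz F \<Longrightarrow> Im z > 0 \<Longrightarrow> Im (F z) > 0"
  by (simp add: herglotz_def upper_half_plane_def image_subset_iff)

lemma herglotz_comp:
  assumes G: "herglotz G" and h: "h holomorphic_on {z. Im z > 0}" "\<And>z. Im z > 0 \<Longrightarrow> Im (h z) > 0"
  shows "herglotz (\<lambda>z. h (G z))"
proof -
  have "G holomorphic_on {z. Im z > 0}" "G ` {z. Im z > 0} \<subseteq> {z. Im z > 0}"
    using G by (auto simp: herglotz_def upper_half_plane_def)
  from holomorphic_on_compose_gen[OF this(1) h(1) this(2)] h(2) this(2)
  show ?thesis by (auto simp: herglotz_def upper_half_plane_def o_def)
qed

lemma csqrt_upper:
  assumes "Im z > 0"
  shows "Re (csqrt z) > 0" "Im (csqrt z) > 0"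
proof -
  have "Im ((csqrt z)\<^sup>2) > 0" using assms by simp
  then have p: "Re (csqrt z) * Im (csqrt z) > 0" unfolding power2_eq_square by (simp add: mult.commute del: csqrt.sel)
  have "Re (csqrt z) \<ge> 0" using csqrt_principal[of z] by (auto simp del: csqrt.sel)
  then show "Re (csqrt z) > 0" "Im (csqrt z) > 0" using p zero_less_mult_iff[of "Re (csqrt z)" "Im (csqrt z)"] by linarith+
qed

text \<open>Only the imaginary part is controlled directly by the maximal inequality. But the square root \<open>S\<close>
  of \<open>G\<close> lies in the first quadrant, so that \<open>S\<close> and \<open>\<i> S\<close> are both Herglotz functions, and
  together their imaginary parts control \<open>S\<close>.\<close>

lemma AE_herglotz_bounded:
  assumes G: "herglotz G"
  shows "AE x in lborel. \<exists>K. \<forall>\<^sub>F y in at_right 0. norm (G (Complex x y)) \<le> K"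
proof -
  have nn: "z \<notin> \<real>\<^sub>\<le>\<^sub>0" if "Im z > 0" for z using that by (auto simp: complex_nonpos_Reals_iff)
  have hol: "csqrt holomorphic_on {z. Im z > 0}" using nn by (intro holomorphic_on_subset[OF holomorphic_on_csqrt]) auto
  have h1: "herglotz (\<lambda>z. csqrt (G z))"
    by (rule herglotz_comp[OF G hol csqrt_upper(2)])
  have h2: "herglotz (\<lambda>z. \<i> * csqrt (G z))"
    by (rule herglotz_comp[OF G, where h="\<lambda>z. \<i> * csqrt z"]) (use hol csqrt_upper(1) in \<open>auto intro!: holomorphic_intros simp del: csqrt.sel\<close>)
  show ?thesis using AE_Im_herglotz_bounded[OF h1] AE_Im_herglotz_bounded[OF h2]
  proof eventually_elim
    case (elim x)
    then obtain K1 K2 where K: "\<forall>\<^sub>F y in at_right 0. Im (csqrt (G (Complex x y))) \<le> K1"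
      "\<forall>\<^sub>F y in at_right 0. Im (\<i> * csqrt (G (Complex x y))) \<le> K2" by blast
    have "\<forall>\<^sub>F y in at_right 0. norm (G (Complex x y)) \<le> (K1 + K2)\<^sup>2"
      using K eventually_pos_at_right
    proof eventually_elim
      case (elim y)
      let ?s = "csqrt (G (Complex x y))"
      have "Im (G (Complex x y)) > 0" using elim by (intro herglotz_Im_pos[OF G]) simp
      then have s: "Re ?s > 0" "Im ?s > 0" by (rule csqrt_upper)+
      have "norm ?s \<le> \<bar>Re ?s\<bar> + \<bar>Im ?s\<bar>" by (rule cmod_le)
      also have "\<dots> \<le> K1 + K2" using elim s by (simp del: csqrt.sel)
      finally have "(norm ?s)\<^sup>2 \<le> (K1 + K2)\<^sup>2" by (intro power_mono) auto
      then show ?case by (simp add: norm_power[symmetric] del: csqrt.sel)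
    qed
    then show ?case by blast
  qed
qed

lemma minus_inverse_upper:
  assumes "Im z > 0"
  shows "Im (- 1 / z) > 0"
proof -
  have "z \<noteq> 0" using assms by auto
  then have "(Re z)\<^sup>2 + (Im z)\<^sup>2 > 0" by (simp add: complex_neq_0)
  then show ?thesis using assms by (simp add: Im_divide)
qed

lemma herglotz_minus_inverse:
  assumes "herglotz F"
  shows "herglotz (\<lambda>z. - 1 / F z)"
  by (rule herglotz_comp[OF assms, where h="\<lambda>z. - 1 / z"])
     (use minus_inverse_upper in \<open>auto intro!: holomorphic_intros\<close>)

text \<open>A boundary value zero is an infinite boundary value of the Herglotz function \<open>-1 / F\<close>. It must be
  excluded because at such a point the argument of \<open>F\<close> need not tend to \<open>\<pi>/2\<close>.\<close>

lemma AE_boundary_value_nonzero: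
  assumes F: "herglotz F"
  shows "AE x in lborel. \<not> has_boundary_value F x 0"
  using AE_herglotz_bounded[OF herglotz_minus_inverse[OF F]]
proof (rule eventually_mono, intro notI)
  fix x assume "\<exists>K. \<forall>\<^sub>F y in at_right 0. norm (- 1 / F (Complex x y)) \<le> K" and z: "has_boundary_value F x 0"
  then obtain K where K: "\<forall>\<^sub>F y in at_right 0. norm (- 1 / F (Complex x y)) \<le> K" by blast
  have "1 / (\<bar>K\<bar> + 1) > 0" by simp
  then have "\<forall>\<^sub>F y in at_right 0. dist (F (Complex x y)) 0 < 1 / (\<bar>K\<bar> + 1)"
    using z unfolding has_boundary_value_def by (rule tendstoD[rotated])
  then have "\<forall>\<^sub>F y in at_right (0::real). False"
    using K eventually_pos_at_right
  proof eventually_elim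
    case (elim y)
    have "Im (F (Complex x y)) > 0" using elim by (intro herglotz_Im_pos[OF F]) simp
    then have "norm (F (Complex x y)) > 0" by auto
    then have "\<bar>K\<bar> + 1 < 1 / norm (F (Complex x y))" using elim(1) by (simp add: field_simps)
    then show ?case using elim(2) by (simp add: norm_divide)
  qed
  then show False by (simp add: trivial_limit_at_right_real)
qed

text \<open>Let \<open>h\<close> be the density of \<open>\<kappa>\<close> with respect to the sum \<open>m\<close> of \<open>\<kappa>\<close> and Lebesgue measure. The positive part of \<open>h - q\<close> vanishes on the set where
  \<open>h\<close> is at most \<open>q\<close>, so by \<open>null_set_poisson_negligible\<close> the Poisson integral of \<open>\<kappa>\<close> is
  there asymptotically at most \<open>q\<close> times that of \<open>m\<close>, which tends to \<open>l + \<pi>\<close> on \<open>E\<close>.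
  Hence \<open>h\<close> is at least \<open>l / (l + \<pi>)\<close> at Lebesgue almost every point of \<open>E\<close>, which means that
  \<open>\<kappa>\<close> dominates \<open>l / \<pi>\<close> times Lebesgue measure there.\<close>

lemma density_lower_bound:
  assumes \<kappa>: "herglotz_measure \<kappa>" and E: "E \<in> sets borel" and l: "l > 0"
    and lim: "AE t in lborel. t \<in> E \<longrightarrow> (poisson \<kappa> t \<longlongrightarrow> l) (at_right 0)" and y: "y > 0"
  shows "l * (LINT t|lborel. indicator E t * (y / ((t - x)\<^sup>2 + y\<^sup>2))) \<le> pi * poisson \<kappa> x y"
proof -
  interpret \<kappa>: herglotz_measure_space \<kappa> using \<kappa> by unfold_locales
  obtain m h where m: "herglotz_measure m" and h: "h \<in> borel_measurable borel" "\<And>t. 0 \<le> h t" "\<And>t. h t \<le> (1::real)"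
    and \<kappa>h: "\<kappa> = density m (\<lambda>t. ennreal (h t))" and lh: "lborel = density m (\<lambda>t. ennreal (1 - h t))"
    using sum_of_measures[OF \<kappa> herglotz_measure_lborel] by metis
  interpret m: herglotz_measure_space m using m by unfold_locales
  have hb: "\<bar>h t\<bar> \<le> 1" "\<bar>1 - h t\<bar> \<le> 1" for t using h(2)[of t] h(3)[of t] by auto
  have h': "(\<lambda>t. 1 - h t) \<in> borel_measurable borel" using h(1) by measurable
  have P\<kappa>: "poisson \<kappa> x y = (LINT t|m. h t * (y / ((t - x)\<^sup>2 + y\<^sup>2)))" for x y
    unfolding \<kappa>h by (rule m.poisson_density[OF h(1,2)])
  have Pm: "poisson m x y = poisson \<kappa> x y + pi" if y: "y > 0" for x y
  proof -
    have "pi = (LINT t|m. (1 - h t) * (y / ((t - x)\<^sup>2 + y\<^sup>2)))"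
      unfolding poisson_lborel[OF y, of x, symmetric] by (subst lh, rule m.poisson_density[OF h']) (use h(3) in simp)
    then have "poisson \<kappa> x y + pi = (LINT t|m. h t * (y / ((t - x)\<^sup>2 + y\<^sup>2)) + (1 - h t) * (y / ((t - x)\<^sup>2 + y\<^sup>2)))"
      unfolding P\<kappa> using m.integrable_bounded_mult_poisson_kernel[OF h(1) hb(1) y] m.integrable_bounded_mult_poisson_kernel[OF h' hb(2) y]
      by (subst Bochner_Integration.integral_add) auto
    also have "\<dots> = poisson m x y" unfolding poisson_def distrib_right[symmetric] by simp
    finally show ?thesis ..
  qed
  \<comment> \<open>The value that \<open>h\<close> would have if \<open>\<kappa>\<close> were exactly \<open>l / \<pi>\<close> times Lebesgue measure.\<close>
  define p where "p = l / (l + pi)"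
  have lp: "l + pi > 0" using l pi_gt_zero by linarith
  have AE_gt: "AE t in lborel. t \<in> E \<longrightarrow> q < h t" if q: "q < p" for q
  proof -
    define f where "f t = max 0 (h t - q)" for t
    have fm: "f \<in> borel_measurable borel" unfolding f_def using h(1) by measurable
    have f0: "0 \<le> f t" and f1: "f t \<le> 1 + \<bar>q\<bar>" for t using h(2)[of t] h(3)[of t] by (auto simp: f_def)
    have fb: "\<bar>f t\<bar> \<le> 1 + \<bar>q\<bar>" for t using f0[of t] f1[of t] by simp
    define mf where "mf = density m (\<lambda>t. ennreal (f t))"
    have hmf: "herglotz_measure mf" unfolding mf_def by (rule m.herglotz_measure_density[OF fm f0 f1])
    define A where "A = {t. h t \<le> q}"
    have A: "A \<in> sets borel" unfolding A_def using h(1) by measurable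
    have "emeasure mf A = (\<integral>\<^sup>+t. ennreal (f t) * indicator A t \<partial>m)"
      unfolding mf_def using fm A by (subst emeasure_density) auto
    also have "\<dots> = (\<integral>\<^sup>+t. 0 \<partial>m)" by (intro nn_integral_cong) (auto simp: f_def A_def indicator_def ennreal_eq_0_iff)
    finally have A0: "emeasure mf A = 0" by simp
    have "AE t in m. t \<in> A \<longrightarrow> (\<forall>e>0. \<forall>\<^sub>F y in at_right 0. poisson mf t y \<le> e * poisson m t y)"
      by (rule null_set_poisson_negligible[OF hmf m A A0])
    then have "AE t in lborel. t \<in> A \<longrightarrow> (\<forall>e>0. \<forall>\<^sub>F y in at_right 0. poisson mf t y \<le> e * poisson m t y)"
      by (subst lh) (rule AE_density_imp, use h(1) in auto)
    then show ?thesis using lim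
    proof eventually_elim
      case (elim t)
      show ?case
      proof (intro impI, rule ccontr)
        assume t: "t \<in> E" and "\<not> q < h t"
        then have tA: "t \<in> A" by (simp add: A_def)
        have L: "(poisson \<kappa> t \<longlongrightarrow> l) (at_right 0)" using elim t by simp
        have bound: "l \<le> (q + e) * (l + pi)" if e: "e > 0" for e
        proof (rule tendsto_le[OF trivial_limit_at_right_real _ L])
          show "((\<lambda>y. (q + e) * (poisson \<kappa> t y + pi)) \<longlongrightarrow> (q + e) * (l + pi)) (at_right 0)"
            by (intro tendsto_intros L)
          have "\<forall>\<^sub>F y in at_right 0. poisson mf t y \<le> e * poisson m t y" using elim tA e by blast
          then show "\<forall>\<^sub>F y in at_right 0. poisson \<kappa> t y \<le> (q + e) * (poisson \<kappa> t y + pi)"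
            using eventually_pos_at_right
          proof eventually_elim
            case (elim y)
            let ?k = "\<lambda>s. y / ((s - t)\<^sup>2 + y\<^sup>2)"
            have i: "integrable m (\<lambda>s. q * ?k s)" "integrable m (\<lambda>s. f s * ?k s)"
              by (intro integrable_mult_right m.integrable_kernel elim(2))
                 (rule m.integrable_bounded_mult_poisson_kernel[OF fm fb elim(2)])
            have "poisson \<kappa> t y \<le> (LINT s|m. q * ?k s + f s * ?k s)"
              unfolding P\<kappa>
            proof (rule integral_mono)
              show "h s * ?k s \<le> q * ?k s + f s * ?k s" for s
                unfolding distrib_right[symmetric] using elim(2) by (intro mult_right_mono) (auto simp: f_def)
              show "integrable m (\<lambda>s. h s * ?k s)"
                by (rule m.integrable_bounded_mult_poisson_kernel[OF h(1) hb(1) elim(2)])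
              show "integrable m (\<lambda>s. q * ?k s + f s * ?k s)"
                using i by (rule Bochner_Integration.integrable_add)
            qed
            also have "\<dots> = (LINT s|m. q * ?k s) + (LINT s|m. f s * ?k s)"
              by (rule Bochner_Integration.integral_add[OF i])
            also have "(LINT s|m. q * ?k s) = q * poisson m t y"
              unfolding poisson_def by (rule integral_mult_right_zero)
            also have "(LINT s|m. f s * ?k s) = poisson mf t y"
              unfolding mf_def m.poisson_density[OF fm f0] ..
            also have "q * poisson m t y + poisson mf t y \<le> (q + e) * poisson m t y" using elim(1) by (simp add: distrib_right)
            finally show ?case unfolding Pm[OF elim(2)] .
          qed
        qed
        have "((\<lambda>e. (q + e) * (l + pi)) \<longlongrightarrow> (q + 0) * (l + pi)) (at_right 0)" by (intro tendsto_intros)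
        then have "l \<le> (q + 0) * (l + pi)"
          by (rule tendsto_lowerbound) (use bound eventually_pos_at_right in \<open>auto elim!: eventually_mono\<close>)
        then have "p \<le> q" using lp by (simp add: p_def divide_le_eq)
        then show False using q by simp
      qed
    qed
  qed
  have "AE t in lborel. \<forall>n. t \<in> E \<longrightarrow> p - 1 / real (Suc n) < h t"
    unfolding AE_all_countable using AE_gt by (intro allI) simp
  then have hp: "AE t in lborel. t \<in> E \<longrightarrow> p \<le> h t"
  proof (rule eventually_mono, intro impI)
    fix t assume *: "\<forall>n. t \<in> E \<longrightarrow> p - 1 / real (Suc n) < h t" and t: "t \<in> E"
    show "p \<le> h t"
    proof (rule field_le_epsilon)
      fix e :: real assume "e > 0"
      then obtain n where "1 / real (Suc n) < e" using nat_approx_posE by auto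
      then show "p \<le> h t + e" using * t by (smt (verit))
    qed
  qed
  \<comment> \<open>Lebesgue measure does not see the difference between \<open>E\<close> and this set, but \<open>\<kappa>\<close> might.\<close>
  define E0 where "E0 = E \<inter> {t. p \<le> h t}"
  have E0: "E0 \<in> sets borel" unfolding E0_def using E h(1) by measurable
  let ?k = "\<lambda>t. y / ((t - x)\<^sup>2 + y\<^sup>2)"
  have k0: "0 \<le> ?k t" for t using y by simp
  have "(LINT t|lborel. indicator E t * ?k t) = (LINT t|lborel. indicator E0 t * ?k t)"
  proof (rule integral_cong_AE)
    show "AE t in lborel. indicator E t * ?k t = indicator E0 t * ?k t"
      using hp by (rule eventually_mono) (auto simp: E0_def indicator_def)
  qed (use E E0 in measurable)
  also have "\<dots> = (LINT t|m. (1 - h t) * (indicator E0 t * ?k t))"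
    using h E0 by (subst lh, subst integral_density) auto
  finally have "l * (LINT t|lborel. indicator E t * ?k t) = (LINT t|m. l * ((1 - h t) * (indicator E0 t * ?k t)))"
    by (simp only: integral_mult_right_zero)
  also have "\<dots> \<le> (LINT t|m. pi * (h t * ?k t))"
  proof (rule integral_mono')
    show "integrable m (\<lambda>t. pi * (h t * ?k t))"
      by (intro integrable_mult_right m.integrable_bounded_mult_poisson_kernel[OF h(1) hb(1)] y)
    fix t
    show "0 \<le> pi * (h t * ?k t)" using h(2)[of t] k0[of t] by (intro mult_nonneg_nonneg) auto
    show "l * ((1 - h t) * (indicator E0 t * ?k t)) \<le> pi * (h t * ?k t)"
    proof (cases "t \<in> E0")
      case True
      then have "l \<le> h t * (l + pi)" using lp by (simp add: E0_def p_def divide_le_eq)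
      then have "l * (1 - h t) \<le> pi * h t" by (simp add: algebra_simps)
      from mult_right_mono[OF this k0[of t]] True show ?thesis by (simp add: mult.assoc)
    next
      case False
      then have "indicator E0 t = (0::real)" by simp
      moreover have "0 \<le> pi * (h t * ?k t)" using h(2)[of t] k0[of t] by (intro mult_nonneg_nonneg) auto
      ultimately show ?thesis by (simp only: mult_zero_left mult_zero_right)
    qed
  qed
  also have "\<dots> = pi * poisson \<kappa> x y" unfolding P\<kappa> by (rule integral_mult_right_zero)
  finally show ?thesis .
qed

lemma Ln_minus_inverse:
  assumes "Im z > 0"
  shows "Ln (- 1 / z) = \<i> * of_real pi - Ln z"
proof -
  have z0: "z \<noteq> 0" using assms by auto
  have im: "0 < Im (Ln z)" "Im (Ln z) < pi" using Im_Ln_pos_lt_imp[OF assms] by auto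
  have "exp (\<i> * of_real pi - Ln z) = - 1 / z"
    using z0 by (simp add: exp_diff)
  moreover have "Ln (exp (\<i> * of_real pi - Ln z)) = \<i> * of_real pi - Ln z"
    by (rule Ln_exp) (use im in auto)
  ultimately show ?thesis by simp
qed

lemma Im_Ln_imaginary:
  assumes "Re w = 0" "Im w > 0"
  shows "Im (Ln w) = pi / 2" "w \<notin> \<real>\<^sub>\<le>\<^sub>0"
proof -
  have w: "w = of_real (Im w) * \<i>" using assms by (simp add: complex_eq_iff)
  have "Ln w = of_real (ln (Im w)) + Ln \<i>"
    by (subst w, subst Ln_times_of_real) (use assms in \<open>auto simp: Ln_of_real\<close>)
  then show "Im (Ln w) = pi / 2" by simp
  show "w \<notin> \<real>\<^sub>\<le>\<^sub>0" using assms by (auto simp: complex_nonpos_Reals_iff)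
qed

definition imaginary_on :: "real set \<Rightarrow> (complex \<Rightarrow> complex) \<Rightarrow> bool" where
  "imaginary_on E F \<longleftrightarrow> (AE t in lborel. t \<in> E \<longrightarrow> (\<exists>w. has_boundary_value F t w \<and> Re w = 0))"

lemma imaginary_on_pos:
  assumes F: "herglotz F" and E: "imaginary_on E F"
  shows "AE t in lborel. t \<in> E \<longrightarrow> (\<exists>w. has_boundary_value F t w \<and> Re w = 0 \<and> Im w > 0)"
  using E[unfolded imaginary_on_def] AE_boundary_value_nonzero[OF F]
proof eventually_elim
  case (elim t)
  show ?case
  proof
    assume "t \<in> E"
    then obtain w where w: "has_boundary_value F t w" "Re w = 0" using elim by blast
    have "w \<noteq> 0" using w elim by auto
    have "((\<lambda>y. Im (F (Complex t y))) \<longlongrightarrow> Im w) (at_right 0)"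
      using w(1) unfolding has_boundary_value_def by (rule tendsto_Im)
    then have "0 \<le> Im w"
    proof (rule tendsto_lowerbound)
      show "\<forall>\<^sub>F y in at_right 0. 0 \<le> Im (F (Complex t y))"
        using eventually_pos_at_right
      proof eventually_elim
        case (elim y)
        then show ?case using herglotz_Im_pos[OF F, of "Complex t y"] by simp
      qed
    qed (rule trivial_limit_at_right_real)
    then have "Im w > 0" using \<open>w \<noteq> 0\<close> w(2) by (simp add: complex_eq_iff less_le)
    then show "\<exists>w. has_boundary_value F t w \<and> Re w = 0 \<and> Im w > 0" using w by blast
  qed
qed

lemma herglotz_Ln:
  assumes "herglotz F"
  shows "herglotz (\<lambda>z. Ln (F z))"
proof (rule herglotz_comp[OF assms])
  show "Ln holomorphic_on {z. Im z > 0}"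
    by (intro holomorphic_on_Ln) (auto simp: complex_nonpos_Reals_iff)
qed (use Im_Ln_pos_lt_imp in blast)

text \<open>The logarithm of \<open>F\<close> is again a Herglotz function, and its imaginary part has the boundary value
  \<open>\<pi>/2\<close> almost everywhere on \<open>E\<close>.\<close>

lemma argument_lower_bound:
  assumes F: "herglotz F" and E: "E \<in> sets borel" "imaginary_on E F" and y: "y > 0"
  shows "(LINT t|lborel. indicator E t * (y / ((t - x)\<^sup>2 + y\<^sup>2))) \<le> 2 * Im (Ln (F (Complex x y)))"
proof -
  obtain a b \<kappa> where r: "b \<ge> 0" "herglotz_measure \<kappa>" "\<And>z. Im z > 0 \<Longrightarrow> Ln (F z) = herglotz_rep a b \<kappa> z"
    using herglotz_representation[OF herglotz_Ln[OF F]] by metis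
  interpret \<kappa>: herglotz_measure_space \<kappa> using r(2) by unfold_locales
  have im: "Im (Ln (F (Complex x y))) = b * y + poisson \<kappa> x y" if "y > 0" for x y
    using r(3)[of "Complex x y"] \<kappa>.Im_herglotz_rep[OF that] that by simp
  have lim: "AE t in lborel. t \<in> E \<longrightarrow> (poisson \<kappa> t \<longlongrightarrow> pi / 2) (at_right 0)"
    using imaginary_on_pos[OF F E(2)]
  proof (rule eventually_mono, intro impI)
    fix t assume "t \<in> E \<longrightarrow> (\<exists>w. has_boundary_value F t w \<and> Re w = 0 \<and> Im w > 0)" "t \<in> E"
    then obtain w where w: "has_boundary_value F t w" "Re w = 0" "Im w > 0" by blast
    note L = Im_Ln_imaginary[OF w(2,3)]
    have "((\<lambda>y. Ln (F (Complex t y))) \<longlongrightarrow> Ln w) (at_right 0)"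
      using isCont_tendsto_compose[OF continuous_at_Ln[OF L(2)] w(1)[unfolded has_boundary_value_def]] .
    then have "((\<lambda>y. Im (Ln (F (Complex t y))) - b * y) \<longlongrightarrow> Im (Ln w) - b * 0) (at_right 0)"
      by (intro tendsto_diff tendsto_Im tendsto_mult tendsto_const tendsto_ident_at)
    then have "((\<lambda>y. Im (Ln (F (Complex t y))) - b * y) \<longlongrightarrow> pi / 2) (at_right 0)" using L(1) by simp
    moreover have "\<forall>\<^sub>F y in at_right 0. Im (Ln (F (Complex t y))) - b * y = poisson \<kappa> t y"
      using eventually_pos_at_right by eventually_elim (simp add: im)
    ultimately show "(poisson \<kappa> t \<longlongrightarrow> pi / 2) (at_right 0)" by (rule Lim_transform_eventually)
  qed
  have "pi / 2 * (LINT t|lborel. indicator E t * (y / ((t - x)\<^sup>2 + y\<^sup>2))) \<le> pi * poisson \<kappa> x y"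
    by (rule density_lower_bound[OF r(2) E(1) _ lim y]) simp
  then have "pi * (LINT t|lborel. indicator E t * (y / ((t - x)\<^sup>2 + y\<^sup>2))) \<le> pi * (2 * poisson \<kappa> x y)" by simp
  then have "(LINT t|lborel. indicator E t * (y / ((t - x)\<^sup>2 + y\<^sup>2))) \<le> 2 * poisson \<kappa> x y"
    using mult_le_cancel_left_pos[OF pi_gt_zero] by blast
  also have "\<dots> \<le> 2 * Im (Ln (F (Complex x y)))" using im[OF y] r(1) y by simp
  finally show ?thesis .
qed

lemma imaginary_on_minus_inverse:
  assumes F: "herglotz F" and E: "imaginary_on E F"
  shows "imaginary_on E (\<lambda>z. - 1 / F z)"
  unfolding imaginary_on_def using imaginary_on_pos[OF F E]
proof (rule eventually_mono, intro impI)
  fix t assume "t \<in> E \<longrightarrow> (\<exists>w. has_boundary_value F t w \<and> Re w = 0 \<and> Im w > 0)" "t \<in> E"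
  then obtain w where w: "has_boundary_value F t w" "Re w = 0" "Im w > 0" by blast
  have "((\<lambda>y. - 1 / F (Complex t y)) \<longlongrightarrow> - 1 / w) (at_right 0)"
    by (rule tendsto_divide[OF tendsto_const w(1)[unfolded has_boundary_value_def]]) (use w(3) in auto)
  moreover have "Re (- 1 / w) = 0" using w(2) by (simp add: Re_divide)
  ultimately show "\<exists>v. has_boundary_value (\<lambda>z. - 1 / F z) t v \<and> Re v = 0"
    unfolding has_boundary_value_def by blast
qed

text \<open>The second bound is the first one for \<open>-1 / F\<close>, whose argument is \<open>\<pi> - arg F\<close> and which has
  imaginary boundary values on \<open>E\<close> as well.\<close>

lemma poisson_indicator_le_argument:
  fixes x y :: real
  assumes F: "herglotz F" and E: "E \<in> sets borel" "imaginary_on E F" and y: "y > 0"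
  defines "P \<equiv> (LINT t|lborel. indicator E t * (y / ((t - x)\<^sup>2 + y\<^sup>2)))" and "A \<equiv> Im (Ln (F (Complex x y)))"
  shows "P \<le> 2 * A" "P \<le> 2 * (pi - A)"
proof -
  show "P \<le> 2 * A" unfolding P_def A_def by (rule argument_lower_bound[OF F E y])
  have "P \<le> 2 * Im (Ln (- 1 / F (Complex x y)))"
    unfolding P_def by (rule argument_lower_bound[OF herglotz_minus_inverse[OF F] E(1) imaginary_on_minus_inverse[OF F E(2)] y])
  then show "P \<le> 2 * (pi - A)"
    using Ln_minus_inverse[OF herglotz_Im_pos[OF F, of "Complex x y"]] y by (simp add: A_def)
qed

section \<open>Perturbation of a reflectionless function\<close>

lemma Im_cauchy_transform_supported:
  assumes E: "E \<in> sets borel" and \<theta>: "\<theta> \<in> borel_measurable borel" "\<And>t. \<bar>\<theta> t\<bar> \<le> c * indicator E t" and y: "y > 0"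
  shows "\<bar>Im (cauchy_transform lborel \<theta> (Complex x y))\<bar> \<le> c * (LINT t|lborel. indicator E t * (y / ((t - x)\<^sup>2 + y\<^sup>2)))"
proof -
  have b: "\<bar>\<theta> t\<bar> \<le> \<bar>c\<bar>" for t using \<theta>(2)[of t] by (cases "t \<in> E") auto
  have "\<bar>Im (cauchy_transform lborel \<theta> (Complex x y))\<bar> \<le> (LINT t|lborel. \<bar>\<theta> t * (y / ((t - x)\<^sup>2 + y\<^sup>2))\<bar>)"
    unfolding lborel_herglotz.Im_cauchy_transform[OF \<theta>(1) b y] by (rule integral_abs_bound)
  also have "\<dots> \<le> (LINT t|lborel. c * (indicator E t * (y / ((t - x)\<^sup>2 + y\<^sup>2))))"
  proof (rule integral_mono)
    show "integrable lborel (\<lambda>t. \<bar>\<theta> t * (y / ((t - x)\<^sup>2 + y\<^sup>2))\<bar>)"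
      by (intro integrable_abs lborel_herglotz.integrable_bounded_mult_poisson_kernel[OF \<theta>(1) b y])
    show "integrable lborel (\<lambda>t. c * (indicator E t * (y / ((t - x)\<^sup>2 + y\<^sup>2))))"
      by (intro integrable_mult_right lborel_herglotz.integrable_bounded_mult_poisson_kernel[where C=1] y) (use E in \<open>auto simp: indicator_def\<close>)
    fix t
    have k: "0 \<le> y / ((t - x)\<^sup>2 + y\<^sup>2)" using y by simp
    have "\<bar>\<theta> t * (y / ((t - x)\<^sup>2 + y\<^sup>2))\<bar> = \<bar>\<theta> t\<bar> * (y / ((t - x)\<^sup>2 + y\<^sup>2))"
      unfolding abs_mult using abs_of_nonneg[OF k] by (simp only:)
    also have "\<dots> \<le> (c * indicator E t) * (y / ((t - x)\<^sup>2 + y\<^sup>2))" by (rule mult_right_mono[OF \<theta>(2) k])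
    finally show "\<bar>\<theta> t * (y / ((t - x)\<^sup>2 + y\<^sup>2))\<bar> \<le> c * (indicator E t * (y / ((t - x)\<^sup>2 + y\<^sup>2)))" by (simp only: mult.assoc)
  qed
  also have "\<dots> = c * (LINT t|lborel. indicator E t * (y / ((t - x)\<^sup>2 + y\<^sup>2)))" by (rule integral_mult_right_zero)
  finally show ?thesis .
qed

text \<open>The constant \<open>1/4\<close> makes the imaginary part of the Cauchy transform at most half of \<open>arg F\<close> and at
  most half of \<open>\<pi> - arg F\<close>, so the argument of the product stays in \<open>(0, \<pi>)\<close>.\<close>

lemma reflectionless_perturbation:
  assumes F: "herglotz F" and E: "E \<in> sets borel" "imaginary_on E F"
    and \<theta>: "\<theta> \<in> borel_measurable borel" "\<And>t. \<bar>\<theta> t\<bar> \<le> 1/4 * indicator E t"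
  shows "herglotz (\<lambda>z. F z * exp (cauchy_transform lborel \<theta> z))"
    and "Im z > 0 \<Longrightarrow> \<bar>Im (cauchy_transform lborel \<theta> z)\<bar> < pi"
proof -
  let ?T = "cauchy_transform lborel \<theta>"
  have b: "\<bar>\<theta> t\<bar> \<le> 1/4" for t using \<theta>(2)[of t] by (cases "t \<in> E") auto
  have arg: "\<bar>Im (?T z)\<bar> < Im (Ln (F z))" "\<bar>Im (?T z)\<bar> < pi - Im (Ln (F z))" if z: "Im z > 0" for z
  proof -
    obtain x y where xy: "z = Complex x y" by (cases z)
    have y: "y > 0" using z xy by simp
    define A where "A = Im (Ln (F (Complex x y)))"
    define P where "P = (LINT t|lborel. indicator E t * (y / ((t - x)\<^sup>2 + y\<^sup>2)))"
    have A: "0 < A" "A < pi" using Im_Ln_pos_lt_imp[OF herglotz_Im_pos[OF F z]] by (auto simp: A_def xy)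
    have "\<bar>Im (?T (Complex x y))\<bar> \<le> 1/4 * P" unfolding P_def by (rule Im_cauchy_transform_supported[OF E(1) \<theta> y])
    moreover have P: "P \<le> 2 * A" "P \<le> 2 * (pi - A)"
      unfolding P_def A_def by (rule poisson_indicator_le_argument[OF F E y])+
    ultimately have "\<bar>Im (?T (Complex x y))\<bar> \<le> A / 2" "\<bar>Im (?T (Complex x y))\<bar> \<le> (pi - A) / 2"
      by (simp_all add: field_simps)
    then show "\<bar>Im (?T z)\<bar> < Im (Ln (F z))" "\<bar>Im (?T z)\<bar> < pi - Im (Ln (F z))"
      unfolding xy A_def[symmetric] using A by (simp_all add: field_simps)
  qed
  show "Im z > 0 \<Longrightarrow> \<bar>Im (?T z)\<bar> < pi" using arg[of z] by linarith
  show "herglotz (\<lambda>z. F z * exp (?T z))"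
    unfolding herglotz_def
  proof
    show "(\<lambda>z. F z * exp (?T z)) holomorphic_on upper_half_plane"
      unfolding upper_half_plane_def using F lborel_herglotz.holomorphic_cauchy_transform[OF \<theta>(1) b]
      by (intro holomorphic_intros) (auto simp: herglotz_def upper_half_plane_def)
    have "Im (F z * exp (?T z)) > 0" if z: "Im z > 0" for z
    proof -
      have "F z \<noteq> 0" using herglotz_Im_pos[OF F z] by auto
      then have "F z * exp (?T z) = exp (Ln (F z) + ?T z)" by (simp add: exp_add)
      moreover have "sin (Im (Ln (F z) + ?T z)) > 0"
        by (rule sin_gt_zero) (use arg[OF z] in auto)
      ultimately show ?thesis by (simp only: Im_exp) simp
    qed
    then show "(\<lambda>z. F z * exp (?T z)) ` upper_half_plane \<subseteq> upper_half_plane"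
      by (auto simp: upper_half_plane_def)
  qed
qed

text \<open>After rescaling \<open>\<theta>\<close>, both \<open>exp \<Theta>\<close> and \<open>exp (-\<Theta>)\<close> are quotients of Herglotz functions
  with denominator \<open>F\<close> and have finite nonnegative limits. The product of the limits is one, so they are
  positive, and the logarithm may be taken because the imaginary part of \<open>\<Theta>\<close> has absolute
  value less than \<open>\<pi>\<close>.\<close>

theorem cauchy_transform_tendsto_real:
  assumes \<mu>: "herglotz_measure \<mu>" and b: "b \<ge> 0" and F: "herglotz (herglotz_rep a b \<mu>)"
    and E: "E \<in> sets borel" "imaginary_on E (herglotz_rep a b \<mu>)" and N: "N \<in> null_sets lborel"
    and \<theta>: "\<theta> \<in> borel_measurable borel" "\<And>t. \<bar>\<theta> t\<bar> \<le> c * indicator E t"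
  shows "AE x in \<mu>. x \<in> N \<longrightarrow> (\<exists>l. ((\<lambda>y. cauchy_transform lborel \<theta> (Complex x y)) \<longlongrightarrow> of_real l) (at_right 0))"
proof -
  let ?F = "herglotz_rep a b \<mu>"
  define d where "d = 4 * \<bar>c\<bar> + 1"
  have d: "d > 0" by (simp add: d_def)
  define \<eta> where "\<eta> t = 1 / d * \<theta> t" for t
  have \<eta>m: "\<eta> \<in> borel_measurable borel" unfolding \<eta>_def using \<theta>(1) by measurable
  have \<eta>b: "\<bar>\<eta> t\<bar> \<le> 1/4 * indicator E t" for t
  proof (cases "t \<in> E")
    case True
    have "\<bar>\<theta> t\<bar> \<le> 1/4 * d" using \<theta>(2)[of t] True by (simp add: d_def)
    then show ?thesis using d True by (simp add: \<eta>_def abs_mult field_simps)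
  next
    case False
    then show ?thesis using \<theta>(2)[of t] by (simp add: \<eta>_def)
  qed
  let ?T = "cauchy_transform lborel \<eta>"
  have m\<eta>: "cauchy_transform lborel (\<lambda>t. - \<eta> t) z = - ?T z" for z
    using lborel_herglotz.cauchy_transform_cmult[of "-1" \<eta> z] by simp
  have \<eta>m': "(\<lambda>t. - \<eta> t) \<in> borel_measurable borel" using \<eta>m by measurable
  have \<eta>b': "\<bar>- \<eta> t\<bar> \<le> 1/4 * indicator E t" for t using \<eta>b[of t] by simp
  note pert = reflectionless_perturbation[OF F E \<eta>m \<eta>b]
  note pert' = reflectionless_perturbation[OF F E \<eta>m' \<eta>b', unfolded m\<eta>]
  obtain a1 b1 \<nu>1 where r1: "b1 \<ge> 0" "herglotz_measure \<nu>1" "\<And>z. Im z > 0 \<Longrightarrow> ?F z * exp (?T z) = herglotz_rep a1 b1 \<nu>1 z"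
    using herglotz_representation[OF pert(1)] by metis
  obtain a2 b2 \<nu>2 where r2: "b2 \<ge> 0" "herglotz_measure \<nu>2" "\<And>z. Im z > 0 \<Longrightarrow> ?F z * exp (- ?T z) = herglotz_rep a2 b2 \<nu>2 z"
    using herglotz_representation[OF pert'(1)] by metis
  have R1: "AE x in \<mu>. x \<in> N \<longrightarrow> (\<exists>L\<ge>0. ((\<lambda>y. herglotz_rep a1 b1 \<nu>1 (Complex x y) / ?F (Complex x y)) \<longlongrightarrow> of_real L) (at_right 0))"
    by (rule herglotz_ratio_limit[OF \<mu> b _ r1(2,1) N]) (rule herglotz_Im_pos[OF F])
  have R2: "AE x in \<mu>. x \<in> N \<longrightarrow> (\<exists>L\<ge>0. ((\<lambda>y. herglotz_rep a2 b2 \<nu>2 (Complex x y) / ?F (Complex x y)) \<longlongrightarrow> of_real L) (at_right 0))"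
    by (rule herglotz_ratio_limit[OF \<mu> b _ r2(2,1) N]) (rule herglotz_Im_pos[OF F])
  show ?thesis
    using R1 R2
  proof eventually_elim
    case (elim x)
    show ?case
    proof
      assume x: "x \<in> N"
      obtain L1 where L1: "L1 \<ge> 0" "((\<lambda>y. herglotz_rep a1 b1 \<nu>1 (Complex x y) / ?F (Complex x y)) \<longlongrightarrow> of_real L1) (at_right 0)"
        using elim x by blast
      obtain L2 where L2: "L2 \<ge> 0" "((\<lambda>y. herglotz_rep a2 b2 \<nu>2 (Complex x y) / ?F (Complex x y)) \<longlongrightarrow> of_real L2) (at_right 0)"
        using elim x by blast
      have F0: "?F (Complex x y) \<noteq> 0" if "y > 0" for y using herglotz_Im_pos[OF F, of "Complex x y"] that by auto
      have "\<forall>\<^sub>F y in at_right 0. herglotz_rep a1 b1 \<nu>1 (Complex x y) / ?F (Complex x y) = exp (?T (Complex x y))"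
        using eventually_pos_at_right
      proof eventually_elim
        case (elim y)
        then show ?case using r1(3)[of "Complex x y", symmetric] F0[OF elim] by simp
      qed
      with L1(2) have e1: "((\<lambda>y. exp (?T (Complex x y))) \<longlongrightarrow> of_real L1) (at_right 0)"
        by (rule Lim_transform_eventually)
      have "\<forall>\<^sub>F y in at_right 0. herglotz_rep a2 b2 \<nu>2 (Complex x y) / ?F (Complex x y) = exp (- ?T (Complex x y))"
        using eventually_pos_at_right
      proof eventually_elim
        case (elim y)
        then show ?case using r2(3)[of "Complex x y", symmetric] F0[OF elim] by simp
      qed
      with L2(2) have e2: "((\<lambda>y. exp (- ?T (Complex x y))) \<longlongrightarrow> of_real L2) (at_right 0)"
        by (rule Lim_transform_eventually)
      have "((\<lambda>y. exp (?T (Complex x y)) * exp (- ?T (Complex x y))) \<longlongrightarrow> of_real L1 * of_real L2) (at_right 0)"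
        by (rule tendsto_mult[OF e1 e2])
      then have "((\<lambda>y. 1) \<longlongrightarrow> of_real L1 * (of_real L2 :: complex)) (at_right (0::real))"
        by (simp add: exp_minus_inverse)
      then have "of_real L1 * of_real L2 = (1::complex)"
        by (rule tendsto_unique[OF trivial_limit_at_right_real _ tendsto_const])
      then have "L1 \<noteq> 0" by auto
      then have L1p: "L1 > 0" using L1(1) by simp
      have "((\<lambda>y. Ln (exp (?T (Complex x y)))) \<longlongrightarrow> Ln (of_real L1)) (at_right 0)"
        by (rule isCont_tendsto_compose[OF continuous_at_Ln e1]) (use L1p in \<open>auto simp: complex_nonpos_Reals_iff\<close>)
      moreover have "\<forall>\<^sub>F y in at_right 0. Ln (exp (?T (Complex x y))) = ?T (Complex x y)"
        using eventually_pos_at_right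
      proof eventually_elim
        case (elim y)
        have "\<bar>Im (?T (Complex x y))\<bar> < pi" using pert(2)[of "Complex x y"] elim by simp
        then show ?case by (intro Ln_exp) auto
      qed
      ultimately have "((\<lambda>y. ?T (Complex x y)) \<longlongrightarrow> Ln (of_real L1)) (at_right 0)"
        by (rule Lim_transform_eventually)
      then have "((\<lambda>y. of_real d * ?T (Complex x y)) \<longlongrightarrow> of_real d * Ln (of_real L1)) (at_right 0)"
        by (intro tendsto_mult tendsto_const)
      moreover have "of_real d * ?T z = cauchy_transform lborel \<theta> z" for z
        using lborel_herglotz.cauchy_transform_cmult[of d \<eta> z] d by (simp add: \<eta>_def)
      moreover have "of_real d * Ln (of_real L1) = (of_real (d * ln L1) :: complex)"
        using L1p by (simp add: Ln_of_real)
      ultimately show "\<exists>l. ((\<lambda>y. cauchy_transform lborel \<theta> (Complex x y)) \<longlongrightarrow> of_real l) (at_right 0)"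
        by (intro exI[of _ "d * ln L1"]) (simp only:)
    qed
  qed
qed

section \<open>Borel measurability of convergence sets\<close>

text \<open>Cauchy's criterion needs only rational heights, since the function is continuous. This turns the
  existence of a limit into countably many conditions.\<close>

lemma vertical_limit_iff_rational_Cauchy:
  fixes u :: "real \<Rightarrow> complex"
  assumes cont: "continuous_on {0<..} u"
  shows "(\<exists>w. (u \<longlongrightarrow> w) (at_right 0)) \<longleftrightarrow>
    (\<forall>n. \<exists>m. \<forall>p\<in>\<rat> \<inter> {0<..<1 / real (Suc m)}. \<forall>q\<in>\<rat> \<inter> {0<..<1 / real (Suc m)}. dist (u p) (u q) \<le> 1 / real (Suc n))"
proof
  assume "\<exists>w. (u \<longlongrightarrow> w) (at_right 0)"
  then obtain w where w: "(u \<longlongrightarrow> w) (at_right 0)" by blast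
  show "\<forall>n. \<exists>m. \<forall>p\<in>\<rat> \<inter> {0<..<1 / real (Suc m)}. \<forall>q\<in>\<rat> \<inter> {0<..<1 / real (Suc m)}. dist (u p) (u q) \<le> 1 / real (Suc n)"
  proof
    fix n
    have "1 / real (Suc n) / 2 > 0" by simp
    then have "\<forall>\<^sub>F y in at_right 0. dist (u y) w < 1 / real (Suc n) / 2"
      using w by (rule tendstoD[rotated])
    then obtain d where d: "d > 0" "\<And>y. 0 < y \<Longrightarrow> y < d \<Longrightarrow> dist (u y) w < 1 / real (Suc n) / 2"
      by (auto simp: eventually_at_right_field)
    obtain m where m: "1 / real (Suc m) < d" using nat_approx_posE[OF d(1)] by auto
    have "dist (u p) (u q) \<le> 1 / real (Suc n)" if "p \<in> {0<..<1 / real (Suc m)}" "q \<in> {0<..<1 / real (Suc m)}" for p q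
    proof -
      have "dist (u p) w < 1 / real (Suc n) / 2" "dist (u q) w < 1 / real (Suc n) / 2"
        using that m by (intro d(2); simp)+
      then show ?thesis using dist_triangle2[of "u p" "u q" w] by linarith
    qed
    then show "\<exists>m. \<forall>p\<in>\<rat> \<inter> {0<..<1 / real (Suc m)}. \<forall>q\<in>\<rat> \<inter> {0<..<1 / real (Suc m)}. dist (u p) (u q) \<le> 1 / real (Suc n)"
      by blast
  qed
next
  assume C: "\<forall>n. \<exists>m. \<forall>p\<in>\<rat> \<inter> {0<..<1 / real (Suc m)}. \<forall>q\<in>\<rat> \<inter> {0<..<1 / real (Suc m)}. dist (u p) (u q) \<le> 1 / real (Suc n)"
  have approx: "\<exists>q\<in>\<rat>. 0 < q \<and> q < y \<and> dist (u q) (u y) < e" if y: "y > 0" and e: "e > 0" for y e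
  proof -
    have "isCont u y" using cont y by (simp add: continuous_on_eq_continuous_at)
    then obtain d where d: "d > 0" "\<And>q. dist q y < d \<Longrightarrow> dist (u q) (u y) < e"
      using e unfolding continuous_at_eps_delta by blast
    obtain q where q: "q \<in> \<rat>" "max 0 (y - d) < q" "q < y"
      using Rats_dense_in_real[of "max 0 (y - d)" y] y d(1) by auto
    then have "dist (u q) (u y) < e" by (intro d(2)) (auto simp: dist_real_def)
    then show ?thesis using q by auto
  qed
  have C': "\<exists>d>0. \<forall>p q. 0 < p \<longrightarrow> p < d \<longrightarrow> 0 < q \<longrightarrow> q < d \<longrightarrow> dist (u p) (u q) < e" if e: "e > 0" for e :: real
  proof -
    obtain n where n: "1 / real (Suc n) < e / 3" using nat_approx_posE[of "e / 3"] e by auto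
    obtain m where m: "\<And>p q. p\<in>\<rat> \<inter> {0<..<1 / real (Suc m)} \<Longrightarrow> q\<in>\<rat> \<inter> {0<..<1 / real (Suc m)} \<Longrightarrow> dist (u p) (u q) \<le> 1 / real (Suc n)"
      using C by blast
    have "dist (u p) (u q) < e" if p: "0 < p" "p < 1 / real (Suc m)" and q: "0 < q" "q < 1 / real (Suc m)" for p q
    proof -
      have e3: "e / 3 > 0" using e by simp
      obtain p' where p': "p' \<in> \<rat>" "0 < p'" "p' < p" "dist (u p') (u p) < e / 3" using approx[OF p(1) e3] by blast
      obtain q' where q': "q' \<in> \<rat>" "0 < q'" "q' < q" "dist (u q') (u q) < e / 3" using approx[OF q(1) e3] by blast
      have "dist (u p') (u q') \<le> 1 / real (Suc n)" using p p' q q' by (intro m) auto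
      moreover have "dist (u p) (u q) \<le> dist (u p') (u p) + dist (u p') (u q') + dist (u q') (u q)"
        using dist_triangle[of "u p" "u q" "u p'"] dist_triangle[of "u p'" "u q" "u q'"] by (simp add: dist_commute)
      ultimately show ?thesis using p'(4) q'(4) n by linarith
    qed
    then show ?thesis by (intro exI[of _ "1 / real (Suc m)"]) auto
  qed
  define v where "v k = u (1 / real (Suc k))" for k
  have "Cauchy v"
  proof (rule metric_CauchyI)
    fix e :: real assume "e > 0"
    from C'[OF this] obtain d where d: "d > 0" "\<And>p q. 0 < p \<Longrightarrow> p < d \<Longrightarrow> 0 < q \<Longrightarrow> q < d \<Longrightarrow> dist (u p) (u q) < e" by blast
    obtain K where K: "1 / real (Suc K) < d" using nat_approx_posE[OF d(1)] by auto
    have "1 / real (Suc k) < d" if "k \<ge> K" for k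
    proof -
      have "1 / real (Suc k) \<le> 1 / real (Suc K)" using that by (intro divide_left_mono) auto
      then show ?thesis using K by linarith
    qed
    then show "\<exists>M. \<forall>m\<ge>M. \<forall>n\<ge>M. dist (v m) (v n) < e"
      unfolding v_def by (intro exI[of _ K] allI impI d(2)) auto
  qed
  then obtain w where w: "v \<longlonglongrightarrow> w" by (auto simp: Cauchy_convergent_iff convergent_def)
  have "(u \<longlongrightarrow> w) (at_right 0)"
  proof (rule tendstoI)
    fix e :: real assume e: "e > 0"
    then have "e / 2 > 0" by simp
    from C'[OF this] obtain d where d: "d > 0" "\<And>p q. 0 < p \<Longrightarrow> p < d \<Longrightarrow> 0 < q \<Longrightarrow> q < d \<Longrightarrow> dist (u p) (u q) < e / 2" by blast
    have "dist (u y) w < e" if y: "0 < y" "y < d" for y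
    proof -
      have "dist (u y) w \<le> e / 2"
      proof (rule tendsto_upperbound[OF tendsto_dist[OF tendsto_const w]])
        obtain K where K: "1 / real (Suc K) < d" using nat_approx_posE[OF d(1)] by auto
        have "dist (u y) (v k) \<le> e / 2" if "k \<ge> K" for k
        proof -
          have "1 / real (Suc k) \<le> 1 / real (Suc K)" using that by (intro divide_left_mono) auto
          then show ?thesis unfolding v_def using d(2)[OF y, of "1 / real (Suc k)"] K by simp
        qed
        then show "\<forall>\<^sub>F k in sequentially. dist (u y) (v k) \<le> e / 2" by (auto simp: eventually_sequentially)
      qed simp
      then show ?thesis using e by linarith
    qed
    then show "\<forall>\<^sub>F y in at_right 0. dist (u y) w < e"
      using d(1) by (auto simp: eventually_at_right_field)
  qed
  then show "\<exists>w. (u \<longlongrightarrow> w) (at_right 0)" by blast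
qed

lemma borel_vertical_convergence_set:
  fixes u :: "real \<Rightarrow> real \<Rightarrow> complex"
  assumes meas: "\<And>y. y > 0 \<Longrightarrow> (\<lambda>x. u x y) \<in> borel_measurable borel" and cont: "\<And>x. continuous_on {0<..} (u x)"
  shows "{x. \<exists>w. (u x \<longlongrightarrow> w) (at_right 0)} \<in> sets borel"
proof -
  let ?Q = "\<lambda>m. \<rat> \<inter> {0<..<1 / real (Suc m)}"
  have "{x. dist (u x p) (u x q) \<le> 1 / real (Suc n)} \<in> sets borel" if "p \<in> ?Q m" "q \<in> ?Q m" for m n p q
  proof -
    have [measurable]: "(\<lambda>x. u x p) \<in> borel_measurable borel" "(\<lambda>x. u x q) \<in> borel_measurable borel"
      using that by (auto intro!: meas)
    show ?thesis by measurable
  qed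
  moreover have "countable (?Q m)" for m by (intro countable_Int1 countable_rat)
  ultimately have "(\<Inter>p\<in>?Q m. \<Inter>q\<in>?Q m. {x. dist (u x p) (u x q) \<le> 1 / real (Suc n)}) \<in> sets borel" for m n
    by (intro sets.countable_INT'') auto
  then have "(\<Inter>n. \<Union>m. \<Inter>p\<in>?Q m. \<Inter>q\<in>?Q m. {x. dist (u x p) (u x q) \<le> 1 / real (Suc n)}) \<in> sets borel"
    by (intro sets.countable_INT'' sets.countable_UN) auto
  moreover have "{x. \<exists>w. (u x \<longlongrightarrow> w) (at_right 0)} = (\<Inter>n. \<Union>m. \<Inter>p\<in>?Q m. \<Inter>q\<in>?Q m. {x. dist (u x p) (u x q) \<le> 1 / real (Suc n)})"
    unfolding vertical_limit_iff_rational_Cauchy[OF cont] by auto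
  ultimately show ?thesis by simp
qed

lemma borel_vertical_null_limit_set:
  fixes u :: "real \<Rightarrow> real \<Rightarrow> real"
  assumes meas: "\<And>y. y > 0 \<Longrightarrow> (\<lambda>x. u x y) \<in> borel_measurable borel" and cont: "\<And>x. continuous_on {0<..} (u x)"
  shows "{x. (u x \<longlongrightarrow> 0) (at_right 0)} \<in> sets borel"
proof -
  let ?v = "\<lambda>x y. complex_of_real (u x y)"
  have A: "{x. \<exists>w. (?v x \<longlongrightarrow> w) (at_right 0)} \<in> sets borel"
  proof (rule borel_vertical_convergence_set)
    show "(\<lambda>x. ?v x y) \<in> borel_measurable borel" if "y > 0" for y
      using meas[OF that] by measurable
  qed (intro continuous_on_of_real cont)
  have [measurable]: "(\<lambda>x. u x (1 / real (Suc n))) \<in> borel_measurable borel" for n by (rule meas) simp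
  have B: "{x. (\<lambda>n. u x (1 / real (Suc n))) \<longlonglongrightarrow> 0} \<in> sets borel" by measurable
  have f: "filterlim (\<lambda>n. 1 / real (Suc n)) (at_right 0) sequentially"
    using LIMSEQ_Suc[OF lim_1_over_n]
    by (auto simp: filterlim_at intro!: always_eventually)
  have "{x. (u x \<longlongrightarrow> 0) (at_right 0)} = {x. \<exists>w. (?v x \<longlongrightarrow> w) (at_right 0)} \<inter> {x. (\<lambda>n. u x (1 / real (Suc n))) \<longlonglongrightarrow> 0}"
  proof (intro equalityI subsetI IntI CollectI)
    fix x assume "x \<in> {x. (u x \<longlongrightarrow> 0) (at_right 0)}"
    then have L: "(u x \<longlongrightarrow> 0) (at_right 0)" by simp
    then show "\<exists>w. (?v x \<longlongrightarrow> w) (at_right 0)" using tendsto_of_real by blast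
    show "(\<lambda>n. u x (1 / real (Suc n))) \<longlonglongrightarrow> 0" by (rule filterlim_compose[OF L f])
  next
    fix x assume "x \<in> {x. \<exists>w. (?v x \<longlongrightarrow> w) (at_right 0)} \<inter> {x. (\<lambda>n. u x (1 / real (Suc n))) \<longlonglongrightarrow> 0}"
    then obtain w where w: "(?v x \<longlongrightarrow> w) (at_right 0)" and z: "(\<lambda>n. u x (1 / real (Suc n))) \<longlonglongrightarrow> 0" by auto
    have "(\<lambda>n. ?v x (1 / real (Suc n))) \<longlonglongrightarrow> w" by (rule filterlim_compose[OF w f])
    moreover have "(\<lambda>n. ?v x (1 / real (Suc n))) \<longlonglongrightarrow> of_real 0" by (rule tendsto_of_real[OF z])
    ultimately have "w = 0" using LIMSEQ_unique by fastforce
    then show "(u x \<longlongrightarrow> 0) (at_right 0)" using tendsto_Re[OF w] by simp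
  qed
  then show ?thesis using A B by simp
qed

section \<open>The singular part of a reflectionless measure\<close>

text \<open>The singular part is dominated by \<open>\<mu>\<close> and lives on a Lebesgue null set.\<close>

lemma supported_byI:
  assumes s: "singular_part \<mu> \<mu>s" and S: "S \<in> sets borel" and sm: "sets \<mu> = sets borel"
    and ae: "\<And>N. N \<in> null_sets lborel \<Longrightarrow> AE x in \<mu>. x \<in> N \<longrightarrow> x \<in> S"
  shows "supported_by \<mu>s S"
proof -
  from s have ss: "sets \<mu>s = sets borel" by (simp add: singular_part_def)
  from s obtain N where N: "N \<in> null_sets lborel" "emeasure \<mu>s (- N) = 0" by (auto simp: singular_part_def)
  from s obtain \<mu>a where "\<And>A. A \<in> sets borel \<Longrightarrow> emeasure \<mu> A = emeasure \<mu>a A + emeasure \<mu>s A"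
    by (auto simp: singular_part_def)
  then have le: "emeasure \<mu>s A \<le> emeasure \<mu> A" if "A \<in> sets borel" for A using that by simp
  have Nb: "N \<in> sets borel" using N by auto
  have "AE x in \<mu>. x \<notin> N - S" using ae[OF N(1)] by (rule eventually_mono) auto
  then have "emeasure \<mu> (N - S) = 0"
    using Nb S sm by (subst (asm) AE_iff_null_sets[symmetric]) (auto simp: null_sets_def)
  then have z: "emeasure \<mu>s (N - S) = 0" using le[of "N - S"] Nb S by auto
  have "emeasure \<mu>s (space \<mu>s - S) \<le> emeasure \<mu>s ((N - S) \<union> (- N))"
    using Nb S ss by (intro emeasure_mono) auto
  also have "\<dots> \<le> emeasure \<mu>s (N - S) + emeasure \<mu>s (- N)"
    using Nb S ss by (intro emeasure_subadditive) auto
  finally show ?thesis using z N(2) S ss by (simp add: supported_by_def)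
qed

definition window :: "real set \<Rightarrow> real \<Rightarrow> real \<Rightarrow> real" where
  "window E x h = measure lborel (E \<inter> {x - h<..<x + h})"

lemma emeasure_window_finite: "emeasure lborel (E \<inter> {x - h<..<x + h::real}) < \<infinity>"
proof -
  have "emeasure lborel (E \<inter> {x - h<..<x + h}) \<le> emeasure lborel {x - h<..<x + h}"
    by (intro emeasure_mono) auto
  also have "\<dots> < \<infinity>" by (cases "h \<ge> 0") auto
  finally show ?thesis .
qed

lemma measurable_window:
  assumes E: "E \<in> sets borel"
  shows "(\<lambda>x. window E x h) \<in> borel_measurable borel"
proof -
  have "open {p::real \<times> real. \<bar>snd p - fst p\<bar> < h}"
    by (intro open_Collect_less continuous_intros)
  then have "{p::real \<times> real. \<bar>snd p - fst p\<bar> < h} \<in> sets (borel \<Otimes>\<^sub>M borel)"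
    unfolding borel_prod by (rule borel_open)
  also have "sets (borel \<Otimes>\<^sub>M borel) = sets (borel \<Otimes>\<^sub>M (lborel :: real measure))"
    by (intro sets_pair_measure_cong) auto
  finally have "{p::real \<times> real. \<bar>snd p - fst p\<bar> < h} \<in> sets (borel \<Otimes>\<^sub>M lborel)" .
  moreover have "snd -` E \<inter> space (borel \<Otimes>\<^sub>M lborel) \<in> sets ((borel :: real measure) \<Otimes>\<^sub>M lborel)"
    by (rule measurable_sets[OF measurable_snd]) (use E in simp)
  ultimately have "(snd -` E \<inter> space (borel \<Otimes>\<^sub>M lborel)) \<inter> {p::real \<times> real. \<bar>snd p - fst p\<bar> < h} \<in> sets (borel \<Otimes>\<^sub>M lborel)"
    by (rule sets.Int[rotated])
  also have "(snd -` E \<inter> space (borel \<Otimes>\<^sub>M lborel)) \<inter> {p::real \<times> real. \<bar>snd p - fst p\<bar> < h} = {p. snd p \<in> E \<and> \<bar>snd p - fst p\<bar> < h}"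
    by (auto simp: space_pair_measure)
  finally have "{p::real \<times> real. snd p \<in> E \<and> \<bar>snd p - fst p\<bar> < h} \<in> sets (borel \<Otimes>\<^sub>M lborel)" .
  from lborel.measurable_emeasure_Pair[OF this]
  have "(\<lambda>x. emeasure lborel (Pair x -` {p::real \<times> real. snd p \<in> E \<and> \<bar>snd p - fst p\<bar> < h})) \<in> borel_measurable borel" .
  moreover have "Pair x -` {p::real \<times> real. snd p \<in> E \<and> \<bar>snd p - fst p\<bar> < h} = E \<inter> {x - h<..<x + h}" for x by auto
  ultimately have "(\<lambda>x. emeasure lborel (E \<inter> {x - h<..<x + h})) \<in> borel_measurable borel" by simp
  then show ?thesis unfolding window_def measure_def by measurable
qed

text \<open>The Lipschitz bound gives continuity in the radius, which the measurability of the set of points of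
  density zero requires.\<close>

lemma window_diff_le:
  assumes E: "E \<in> sets borel" and h: "0 < h" "h \<le> k"
  shows "\<bar>window E x k - window E x h\<bar> \<le> 2 * \<bar>k - h\<bar>"
proof -
  let ?I = "{x - h<..<x + h}" and ?J = "{x - k<..<x + k}"
  have fm: "E \<inter> {x - j<..<x + j} \<in> fmeasurable lborel" for j
    using E emeasure_window_finite[of E x j] by (auto simp: fmeasurable_def)
  have fi: "{x - j<..<x + j} \<in> fmeasurable lborel" for j
    using emeasure_window_finite[of UNIV x j] by (auto simp: fmeasurable_def)
  have "measure lborel ((E \<inter> ?J) - (E \<inter> ?I)) = window E x k - window E x h"
    unfolding window_def using h E by (intro measurable_measure_Diff fm) auto
  moreover have "measure lborel ((E \<inter> ?J) - (E \<inter> ?I)) \<le> measure lborel (?J - ?I)"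
    using E by (intro measure_mono_fmeasurable fmeasurable_Diff fi) auto
  moreover have "measure lborel (?J - ?I) = measure lborel ?J - measure lborel ?I"
    using h by (intro measurable_measure_Diff fi) auto
  moreover have "measure lborel ?J = 2 * k" "measure lborel ?I = 2 * h" using h by auto
  ultimately have "window E x k - window E x h \<le> 2 * (k - h)" by simp
  moreover have "0 \<le> window E x k - window E x h"
    using \<open>measure lborel ((E \<inter> ?J) - (E \<inter> ?I)) = _\<close> by (metis measure_nonneg)
  ultimately show ?thesis using h by simp
qed

lemma continuous_window:
  assumes E: "E \<in> sets borel"
  shows "continuous_on {0<..} (window E x)"
proof -
  have "2-lipschitz_on {0<..} (window E x)"
  proof (rule lipschitz_onI)
    fix h k :: real assume "h \<in> {0<..}" "k \<in> {0<..}"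
    then show "dist (window E x h) (window E x k) \<le> 2 * dist h k"
      using window_diff_le[OF E, of h k x] window_diff_le[OF E, of k h x]
      by (cases "h \<le> k") (auto simp: dist_real_def abs_minus_commute)
  qed simp
  then show ?thesis by (rule lipschitz_on_continuous_on)
qed

lemma window_le_poisson:
  assumes E: "E \<in> sets borel" and h: "h > 0"
  shows "window E x h / (2 * h) \<le> (LINT t|lborel. indicator E t * (h / ((t - x)\<^sup>2 + h\<^sup>2)))"
proof -
  have fm: "E \<inter> {x - h<..<x + h} \<in> sets lborel" "emeasure lborel (E \<inter> {x - h<..<x + h}) < \<infinity>"
    using E emeasure_window_finite[of E x h] by auto
  have "window E x h / (2 * h) = (LINT t|lborel. 1 / (2 * h) * indicator (E \<inter> {x - h<..<x + h}) t)"
    unfolding window_def integral_mult_right_zero using fm by simp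
  also have "\<dots> \<le> (LINT t|lborel. indicator E t * (h / ((t - x)\<^sup>2 + h\<^sup>2)))"
  proof (rule integral_mono)
    show "integrable lborel (\<lambda>t. 1 / (2 * h) * indicator (E \<inter> {x - h<..<x + h}) t)"
      using fm by (intro integrable_mult_right integrable_real_indicator) auto
    show "integrable lborel (\<lambda>t. indicator E t * (h / ((t - x)\<^sup>2 + h\<^sup>2)))"
      by (intro lborel_herglotz.integrable_bounded_mult_poisson_kernel[where C=1] h) (use E in \<open>auto simp: indicator_def\<close>)
    fix t
    show "1 / (2 * h) * indicator (E \<inter> {x - h<..<x + h}) t \<le> indicator E t * (h / ((t - x)\<^sup>2 + h\<^sup>2))"
    proof (cases "t \<in> E \<inter> {x - h<..<x + h}")
      case True
      then have "\<bar>t - x\<bar> \<le> \<bar>h\<bar>" using h by auto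
      then have "(t - x)\<^sup>2 \<le> h\<^sup>2" by (simp add: abs_le_square_iff)
      then have "(t - x)\<^sup>2 + h\<^sup>2 \<le> 2 * h * h" by (simp add: power2_eq_square)
      then have "h / (2 * h * h) \<le> h / ((t - x)\<^sup>2 + h\<^sup>2)"
        using h kernel_pos[OF h, of t x] by (intro divide_left_mono) auto
      then show ?thesis using True h by simp
    next
      case False
      then have "1 / (2 * h) * indicator (E \<inter> {x - h<..<x + h}) t = 0" by simp
      also have "0 \<le> indicator E t * (h / ((t - x)\<^sup>2 + h\<^sup>2))" using h by simp
      finally show ?thesis .
    qed
  qed
  finally show ?thesis .
qed

lemma borel_version_of_set:
  fixes E :: "real set"
  assumes "E \<in> sets lebesgue"
  obtains E' where "E' \<in> sets borel" "AE t in lebesgue. t \<in> E \<longleftrightarrow> t \<in> E'"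
proof -
  have "(indicator E :: real \<Rightarrow> real) \<in> borel_measurable (completion lborel)" using assms by simp
  then obtain g where g: "g \<in> borel_measurable lborel" "AE t in lborel. indicator E t = (g t :: real)"
    using completion_ex_borel_measurable_real by blast
  show ?thesis
  proof (rule that)
    show "{t. g t = 1} \<in> sets borel" using g(1) by simp
    show "AE t in lebesgue. t \<in> E \<longleftrightarrow> t \<in> {t. g t = 1}"
      using AE_completion[OF g(2)] by (rule eventually_mono) (auto simp: indicator_def split: if_splits)
  qed
qed

text \<open>Both parts follow from \<open>cauchy_transform_tendsto_real\<close>, for the indicator of a Borel version
  of \<open>E\<close> and for the real and imaginary parts of a Borel version of \<open>\<theta>\<close>.\<close>

theorem theorem1p1:
  fixes E :: "real set" and \<mu> \<mu>s :: "real measure"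
  assumes "E \<in> sets lebesgue"
    and "\<mu> \<in> reflectionless_measures E"
    and "singular_part \<mu> \<mu>s"
  shows "supported_by \<mu>s
           {x. ((\<lambda>h. measure lebesgue (E \<inter> {x - h<..<x + h}) / (2 * h)) \<longlongrightarrow> 0) (at_right 0)} \<and>
         (\<forall>\<theta>\<in>L_infinity E. supported_by \<mu>s {x. \<exists>w. has_hilbert_value E \<theta> x w})"
proof -
  note E = assms(1)
  obtain a b where \<mu>: "herglotz_measure \<mu>" and b: "b \<ge> 0" and R: "herglotz_rep a b \<mu> \<in> reflectionless E"
    using assms(2) by (auto simp: reflectionless_measures_def)
  have sm: "sets \<mu> = sets borel" using \<mu> by (simp add: herglotz_measure_def)
  have F: "herglotz (herglotz_rep a b \<mu>)" using R by (simp add: reflectionless_def)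
  obtain E' where E': "E' \<in> sets borel" "AE t in lebesgue. t \<in> E \<longleftrightarrow> t \<in> E'"
    using borel_version_of_set[OF E] by metis
  have "AE t in lebesgue. t \<in> E' \<longrightarrow> (\<exists>w. has_boundary_value (herglotz_rep a b \<mu>) t w \<and> Re w = 0)"
    using R E'(2) unfolding reflectionless_def by (auto elim: eventually_elim2)
  then have im: "imaginary_on E' (herglotz_rep a b \<mu>)"
    unfolding imaginary_on_def by (simp add: AE_completion_iff)
  note lim = cauchy_transform_tendsto_real[OF \<mu> b F E'(1) im]
  have win: "measure lebesgue (E \<inter> {x - h<..<x + h}) = window E' x h" for x h
  proof -
    have "emeasure lebesgue (E \<inter> {x - h<..<x + h}) = emeasure lebesgue (E' \<inter> {x - h<..<x + h})"
      using E' E by (intro emeasure_eq_AE) (auto elim!: eventually_mono)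
    also have "\<dots> = emeasure lborel (E' \<inter> {x - h<..<x + h})" using E' by simp
    finally show ?thesis unfolding window_def measure_def by simp
  qed
  have "supported_by \<mu>s {x. ((\<lambda>h. window E' x h / (2 * h)) \<longlongrightarrow> 0) (at_right 0)}"
  proof (rule supported_byI[OF assms(3) _ sm])
    show "{x. ((\<lambda>h. window E' x h / (2 * h)) \<longlongrightarrow> 0) (at_right 0)} \<in> sets borel"
    proof (rule borel_vertical_null_limit_set)
      show "(\<lambda>x. window E' x h / (2 * h)) \<in> borel_measurable borel" for h
        using measurable_window[OF E'(1), of h] by measurable
      show "continuous_on {0<..} (\<lambda>h. window E' x h / (2 * h))" for x
        by (intro continuous_intros continuous_window[OF E'(1)]) auto
    qed
    fix N :: "real set" assume N: "N \<in> null_sets lborel"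
    have im1: "(indicator E' :: real \<Rightarrow> real) \<in> borel_measurable borel" using E'(1) by simp
    have b1: "\<bar>indicator E' t\<bar> \<le> 1 * (indicator E' t :: real)" and b2: "\<bar>indicator E' t\<bar> \<le> (1::real)" for t
      by (auto simp: indicator_def)
    show "AE x in \<mu>. x \<in> N \<longrightarrow> x \<in> {x. ((\<lambda>h. window E' x h / (2 * h)) \<longlongrightarrow> 0) (at_right 0)}"
      using lim[OF N im1 b1]
    proof (rule eventually_mono, intro impI CollectI)
      fix x assume "x \<in> N \<longrightarrow> (\<exists>l. ((\<lambda>y. cauchy_transform lborel (indicator E') (Complex x y)) \<longlongrightarrow> of_real l) (at_right 0))" "x \<in> N"
      then obtain l where "((\<lambda>y. cauchy_transform lborel (indicator E') (Complex x y)) \<longlongrightarrow> of_real l) (at_right 0)" by blast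
      then have L: "((\<lambda>y. Im (cauchy_transform lborel (indicator E') (Complex x y))) \<longlongrightarrow> 0) (at_right 0)"
        using tendsto_Im by fastforce
      show "((\<lambda>h. window E' x h / (2 * h)) \<longlongrightarrow> 0) (at_right 0)"
      proof (rule tendsto_sandwich[OF _ _ tendsto_const L])
        show "\<forall>\<^sub>F h in at_right 0. 0 \<le> window E' x h / (2 * h)"
          using eventually_pos_at_right by eventually_elim (simp add: window_def)
        show "\<forall>\<^sub>F h in at_right 0. window E' x h / (2 * h) \<le> Im (cauchy_transform lborel (indicator E') (Complex x h))"
          using eventually_pos_at_right
        proof eventually_elim
          case (elim h)
          show ?case using window_le_poisson[OF E'(1) elim, of x]
            by (simp add: lborel_herglotz.Im_cauchy_transform[OF im1 b2 elim])
        qed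
      qed
    qed
  qed
  moreover have "supported_by \<mu>s {x. \<exists>w. has_hilbert_value E \<theta> x w}" if \<theta>: "\<theta> \<in> L_infinity E" for \<theta>
  proof -
    define f where "f t = indicator E t *\<^sub>R \<theta> t" for t
    have "\<theta> \<in> borel_measurable (restrict_space lebesgue E)" using \<theta> by (simp add: L_infinity_def)
    then have fm: "f \<in> borel_measurable lebesgue"
      unfolding f_def using E by (simp add: borel_measurable_restrict_space_iff)
    obtain C where C: "AE t in lebesgue_on E. norm (\<theta> t) \<le> C" using \<theta> by (auto simp: L_infinity_def)
    then have C': "AE t in lebesgue. t \<in> E \<longrightarrow> norm (\<theta> t) \<le> C"
      using E by (simp add: AE_restrict_space_iff)
    have "(\<lambda>t. Re (f t)) \<in> borel_measurable (completion lborel)" "(\<lambda>t. Im (f t)) \<in> borel_measurable (completion lborel)"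
      using fm by measurable
    then obtain p q where p: "p \<in> borel_measurable lborel" "AE t in lborel. Re (f t) = p t"
      and q: "q \<in> borel_measurable lborel" "AE t in lborel. Im (f t) = q t"
      using completion_ex_borel_measurable_real by metis
    define D where "D = max C 0"
    have D: "D \<ge> 0" by (simp add: D_def)
    \<comment> \<open>Cutting off at the essential bound makes the Borel versions bounded everywhere and supported by
      the Borel version of \<open>E\<close>, without a change almost everywhere on \<open>E\<close>.\<close>
    define clip where "clip r t = indicator E' t * max (- D) (min D (r t))" for r :: "real \<Rightarrow> real" and t
    have cm: "clip r \<in> borel_measurable borel" if "r \<in> borel_measurable lborel" for r
      unfolding clip_def using that E'(1) by measurable
    have cb: "\<bar>clip r t\<bar> \<le> D * indicator E' t" and cb': "\<bar>clip r t\<bar> \<le> D" for r t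
      unfolding clip_def using D by (auto simp: indicator_def)
    have eqf: "AE t in lebesgue. f t = Complex (clip p t) (clip q t)"
      using C' AE_completion[OF p(2)] AE_completion[OF q(2)] E'(2)
    proof eventually_elim
      case (elim t)
      show ?case
      proof (cases "t \<in> E")
        case True
        then have "norm (f t) \<le> D" using elim by (simp add: f_def D_def)
        then have "\<bar>p t\<bar> \<le> D" "\<bar>q t\<bar> \<le> D"
          using abs_Re_le_cmod[of "f t"] abs_Im_le_cmod[of "f t"] elim by auto
        then show ?thesis using True elim by (simp add: clip_def complex_eq_iff abs_le_iff)
      next
        case False
        then show ?thesis using elim by (simp add: clip_def f_def complex_eq_iff)
      qed
    qed
    define P where "P z = cauchy_transform lborel (clip p) z" for z
    define Q where "Q z = cauchy_transform lborel (clip q) z" for z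
    have hol: "P holomorphic_on {z. Im z > 0}" "Q holomorphic_on {z. Im z > 0}"
      unfolding P_def[abs_def] Q_def[abs_def]
      by (intro lborel_herglotz.holomorphic_cauchy_transform[OF cm cb'] p q)+
    \<comment> \<open>The Hilbert integral at height \<open>y\<close>. Expressed by holomorphic functions it is visibly continuous in
      both variables, as the measurability of the convergence set requires.\<close>
    define V where "V x y = Complex (Re (P (Complex x y))) (Re (Q (Complex x y)))" for x y
    have V: "(LINT t:E|lebesgue. of_real ((t - x) / ((t - x)\<^sup>2 + y\<^sup>2) - t / (t\<^sup>2 + 1)) * \<theta> t) = V x y" if y: "y > 0" for x y
    proof -
      define k where "k t = (t - x) / ((t - x)\<^sup>2 + y\<^sup>2) - t / (t\<^sup>2 + 1)" for t
      have km [measurable]: "k \<in> borel_measurable borel" unfolding k_def by measurable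
      have kl [measurable]: "k \<in> borel_measurable lebesgue" by (rule measurable_completion) simp
      note [measurable] = fm cm[OF p(1)] cm[OF q(1)]
      let ?h = "\<lambda>t. of_real (k t) * (of_real (clip p t) + \<i> * of_real (clip q t))"
      have hm: "?h \<in> borel_measurable lborel" by measurable
      have "(LINT t:E|lebesgue. of_real (k t) * \<theta> t) = (LINT t|lebesgue. of_real (k t) * f t)"
        unfolding set_lebesgue_integral_def f_def by (intro Bochner_Integration.integral_cong) auto
      also have "\<dots> = (LINT t|lebesgue. ?h t)"
      proof (rule integral_cong_AE)
        show "(\<lambda>t. of_real (k t) * f t) \<in> borel_measurable lebesgue" by measurable
        show "?h \<in> borel_measurable lebesgue" using hm by (rule measurable_completion)
        show "AE t in lebesgue. of_real (k t) * f t = ?h t" using eqf by (rule eventually_mono) (simp add: Complex_eq)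
      qed
      also have "\<dots> = (LINT t|lborel. ?h t)" by (rule integral_completion[OF hm])
      also have "\<dots> = V x y"
      proof -
        have i: "integrable lborel (\<lambda>t. clip r t * k t)" if r: "r \<in> borel_measurable lborel" for r
        proof -
          have "integrable lborel (\<lambda>t. Re (of_real (clip r t) * herglotz_kernel t (Complex x y)))"
            by (intro integrable_Re lborel_herglotz.integrable_bounded_mult_kernel[OF cm[OF r] cb']) (use y in simp)
          then show ?thesis by (simp add: Re_herglotz_kernel k_def)
        qed
        have e: "?h t = of_real (clip p t * k t) + \<i> * of_real (clip q t * k t)" for t
          by (simp add: complex_eq_iff)
        have "(LINT t|lborel. ?h t) = (LINT t|lborel. of_real (clip p t * k t)) + (LINT t|lborel. \<i> * of_real (clip q t * k t))"
          unfolding e using i[OF p(1)] i[OF q(1)]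
          by (intro Bochner_Integration.integral_add integrable_mult_right integrable_of_real)
        also have "\<dots> = of_real (Re (P (Complex x y))) + \<i> * of_real (Re (Q (Complex x y)))"
          unfolding integral_mult_right_zero integral_complex_of_real P_def Q_def
            lborel_herglotz.Re_cauchy_transform[OF cm[OF p(1)] cb' y] lborel_herglotz.Re_cauchy_transform[OF cm[OF q(1)] cb' y] k_def ..
        also have "\<dots> = V x y" by (simp add: V_def complex_eq_iff)
        finally show ?thesis .
      qed
      finally show ?thesis unfolding k_def .
    qed
    have hv: "has_hilbert_value E \<theta> x w \<longleftrightarrow> (V x \<longlongrightarrow> w) (at_right 0)" for x w
      unfolding has_hilbert_value_def
      by (rule filterlim_cong[OF refl refl]) (rule eventually_mono[OF eventually_pos_at_right V])
    have set: "{x. \<exists>w. has_hilbert_value E \<theta> x w} = {x. \<exists>w. (V x \<longlongrightarrow> w) (at_right 0)}"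
      unfolding hv ..
    have cV: "continuous_on {p. snd p > 0} (\<lambda>p. V (fst p) (snd p))"
    proof -
      have c: "continuous_on {p. snd p > 0} (\<lambda>p::real \<times> real. Complex (fst p) (snd p))"
        unfolding Complex_eq by (intro continuous_intros)
      have "continuous_on {p. snd p > 0} (\<lambda>p. P (Complex (fst p) (snd p)))"
        by (rule continuous_on_compose2[OF holomorphic_on_imp_continuous_on[OF hol(1)] c]) auto
      moreover have "continuous_on {p. snd p > 0} (\<lambda>p. Q (Complex (fst p) (snd p)))"
        by (rule continuous_on_compose2[OF holomorphic_on_imp_continuous_on[OF hol(2)] c]) auto
      ultimately show ?thesis unfolding V_def Complex_eq by (intro continuous_intros)
    qed
    show ?thesis
      unfolding set
    proof (rule supported_byI[OF assms(3) _ sm])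
      show "{x. \<exists>w. (V x \<longlongrightarrow> w) (at_right 0)} \<in> sets borel"
      proof (rule borel_vertical_convergence_set)
        show "(\<lambda>x. V x y) \<in> borel_measurable borel" if "y > 0" for y
        proof (rule borel_measurable_continuous_onI)
          have "continuous_on UNIV (\<lambda>x. V (fst (x, y)) (snd (x, y)))"
            by (rule continuous_on_compose2[OF cV]) (use that in \<open>auto intro!: continuous_intros\<close>)
          then show "continuous_on UNIV (\<lambda>x. V x y)" by simp
        qed
        show "continuous_on {0<..} (V x)" for x
        proof -
          have "continuous_on {0<..} (\<lambda>y. V (fst (x, y)) (snd (x, y)))"
            by (rule continuous_on_compose2[OF cV]) (auto intro!: continuous_intros)
          then show ?thesis by simp
        qed
      qed
      fix N :: "real set" assume N: "N \<in> null_sets lborel"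
      show "AE x in \<mu>. x \<in> N \<longrightarrow> x \<in> {x. \<exists>w. (V x \<longlongrightarrow> w) (at_right 0)}"
        using lim[OF N cm[OF p(1)] cb] lim[OF N cm[OF q(1)] cb]
      proof eventually_elim
        case (elim x)
        show ?case
        proof (intro impI CollectI)
          assume "x \<in> N"
          then obtain l1 l2 where "((\<lambda>y. P (Complex x y)) \<longlongrightarrow> of_real l1) (at_right 0)"
            "((\<lambda>y. Q (Complex x y)) \<longlongrightarrow> of_real l2) (at_right 0)"
            using elim unfolding P_def Q_def by blast
          then have "((\<lambda>y. Re (P (Complex x y))) \<longlongrightarrow> l1) (at_right 0)" "((\<lambda>y. Re (Q (Complex x y))) \<longlongrightarrow> l2) (at_right 0)"
            using tendsto_Re by fastforce+
          then show "\<exists>w. (V x \<longlongrightarrow> w) (at_right 0)"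
            unfolding V_def by (intro exI[of _ "Complex l1 l2"] tendsto_Complex)
        qed
      qed
    qed
  qed
  ultimately show ?thesis unfolding win by blast
qed

end
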